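(* Let $F(\omega)$ be the uniformly random self-similar fractal in $\mathbb R^d$ and let $s$ be the unique number with $\mathbb E\big(\sum_{i=1}^m r_i^s\big)=1$. Then $\dim_{\mathcal H}F(\omega)=\min\{s,d\}$ for $\mathbb P$-almost every $\omega\in\Omega$. Furthermore, if $s>d$, then the set $F(\omega)$ has positive $d$-dimensional Lebesgue measure for $\mathbb P$-almost every $\omega\in\Omega$.
   Context: Fix integers $d\ge 1$, $m\ge 1$, vectors $a_1,\dots,a_m\in\mathbb R^d$ with $a_i\ne a_j$ for $i\neq j$, and numbers $0<\sigma_-<\sigma_+<1$. Let $\mathbf J_k=\{1,\dots,m\}^k$, $\mathbf J=\bigcup_{k\ge1}\mathbf J_k$ (nonempty finite words) and $\mathbf J_\infty=\{1,\dots,m\}^{\mathbb N}$. Let $\mathcal O(d)$ be the orthogonal group of $\mathbb R^d$, and let $\Omega$ be the set of all maps $\omega:\mathbf J\to(\sigma_-,\sigma_+)\times\mathcal O(d)$. Write $\omega(\mathbf i)=(r_{\mathbf i}^\omega,Q_{\mathbf i}^\omega)$ and identify it with the linear map $T_{\mathbf i}^\omega=r_{\mathbf i}^\omega Q_{\mathbf i}^\omega$. Let $\lambda$ be normalized Lebesgue measure on $(\sigma_-,\sigma_+)$, $\theta$ the Haar probability measure on $\mathcal O(d)$, and $\mathbb P=(\lambda\times\theta)^{\mathbf J}$ the product probability measure on $\Omega$ (so all labels are independent with law $\lambda\times\theta$); $\mathbb E$ is its expectation. For $i\in\{1,\dots,m\}$, $r_i$ is the random contraction ratio at the word $i$ of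 length one. There is a unique number $s$ with $\mathbb E(\sum_{i=1}^m r_i^s)=1$. For $\mathbf i\in\mathbf J_\infty$ let $\mathbf i_k$ be its initial word of length $k$ and $i_k$ its $k$-th symbol. Define $$\pi(\mathbf i,\omega)=\lim_{k\to\infty}\left(a_{i_1}+T^\omega_{\mathbf i_1}(a_{i_2})+\dots+T^\omega_{\mathbf i_1}T^\omega_{\mathbf i_2}\cdots T^\omega_{\mathbf i_k}(a_{i_{k+1}})\right),$$ and the uniformly random self-similar fractal $F(\omega)=\bigcup_{\mathbf i\in\mathbf J_\infty}\{\pi(\mathbf i,\omega)\}$. $\dim_{\mathcal H}$ denotes Hausdorff dimension. *)

theory Defs
  imports "HOL-Probability.Probability"
begin

section \<open>Hausdorff measure and dimension\<close>

text \<open>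
  The power \<open>|U|^t\<close> of the diameter, with \<open>|U|^0 = 1\<close> for \<open>U \<noteq> {}\<close> and \<open>|{}|^t = 0\<close>.
  The case \<open>t = 0\<close> is explicit because \<^term>\<open>(0::real) powr 0\<close> is \<open>0\<close>.
\<close>

definition diam_power :: "real \<Rightarrow> 'a::metric_space set \<Rightarrow> ennreal" where
  "diam_power t U =
     (if U = {} then 0 else if t = 0 then 1 else ennreal (diameter U powr t))"

text \<open>Boundedness is required explicitly: \<^const>\<open>diameter\<close> is unspecified on unbounded sets.\<close>

definition delta_covers :: "real \<Rightarrow> 'a::metric_space set \<Rightarrow> (nat \<Rightarrow> 'a set) set" where
  "delta_covers \<delta> A =
     {U. A \<subseteq> (\<Union>n. U n) \<and> (\<forall>n. bounded (U n) \<and> diameter (U n) \<le> \<delta>)}"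

definition hausdorff_premeasure :: "real \<Rightarrow> real \<Rightarrow> 'a::metric_space set \<Rightarrow> ennreal" where
  "hausdorff_premeasure t \<delta> A = (INF U\<in>delta_covers \<delta> A. \<Sum>n. diam_power t (U n))"

definition hausdorff_measure :: "real \<Rightarrow> 'a::metric_space set \<Rightarrow> ennreal" where
  "hausdorff_measure t A = (SUP \<delta>\<in>{0<..}. hausdorff_premeasure t \<delta> A)"

definition hausdorff_dim :: "'a::metric_space set \<Rightarrow> ereal" where
  "hausdorff_dim A = (INF t\<in>{t. 0 \<le> t \<and> hausdorff_measure t A = 0}. ereal t)"


section \<open>The probability space of labels\<close>

definition orthogonal_group :: "(real^'d^'d) set" where
  "orthogonal_group = {Q. orthogonal_matrix Q}"

definition haar_probability :: "(real^'d^'d) measure \<Rightarrow> bool" where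
  "haar_probability \<theta> \<longleftrightarrow>
     prob_space \<theta> \<and>
     sets \<theta> = sets (restrict_space borel orthogonal_group) \<and>
     (\<forall>Q\<in>orthogonal_group. distr \<theta> \<theta> (\<lambda>R. Q ** R) = \<theta>)"

definition ratio_law :: "real \<Rightarrow> real \<Rightarrow> real measure" where
  "ratio_law \<sigma>_lo \<sigma>_hi = restrict_space (uniform_measure lborel {\<sigma>_lo<..<\<sigma>_hi}) {\<sigma>_lo<..<\<sigma>_hi}"

definition finite_words :: "nat \<Rightarrow> nat list set" where
  "finite_words m = {w. w \<noteq> [] \<and> set w \<subseteq> {1..m}}"

definition infinite_words :: "nat \<Rightarrow> (nat \<Rightarrow> nat) set" where
  "infinite_words m = {i. \<forall>k. i k \<in> {1..m}}"

type_synonym 'd labelling = "nat list \<Rightarrow> real \<times> (real^'d^'d)"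

definition label_space ::
    "nat \<Rightarrow> real \<Rightarrow> real \<Rightarrow> (real^'d^'d) measure \<Rightarrow> 'd labelling measure" where
  "label_space m \<sigma>_lo \<sigma>_hi \<theta> = (\<Pi>\<^sub>M w\<in>finite_words m. ratio_law \<sigma>_lo \<sigma>_hi \<Otimes>\<^sub>M \<theta>)"


section \<open>The random self-similar fractal\<close>

definition label_map :: "'d::finite labelling \<Rightarrow> nat list \<Rightarrow> real^'d \<Rightarrow> real^'d" where
  "label_map \<omega> w x = fst (\<omega> w) *\<^sub>R (snd (\<omega> w) *v x)"

text \<open>
  Infinite words are indexed from \<open>0\<close>: the \<open>k\<close>-th symbol of \<open>i\<close> is \<open>i (k - 1)\<close>, and the initial
  word of length \<open>k\<close> is \<^term>\<open>map i [0..<k]\<close>. Thus \<open>path_map \<omega> i k\<close> is the composition of the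
  label maps at the initial words of lengths \<open>1, \<dots>, k\<close>, the map for length \<open>k\<close> being applied
  first, and it is evaluated below at the translation belonging to symbol number \<open>k + 1\<close>.
\<close>

primrec path_map :: "'d::finite labelling \<Rightarrow> (nat \<Rightarrow> nat) \<Rightarrow> nat \<Rightarrow> real^'d \<Rightarrow> real^'d" where
  "path_map \<omega> i 0 = id"
| "path_map \<omega> i (Suc k) = path_map \<omega> i k \<circ> label_map \<omega> (map i [0..<Suc k])"

definition projection ::
    "(nat \<Rightarrow> real^'d) \<Rightarrow> (nat \<Rightarrow> nat) \<Rightarrow> 'd::finite labelling \<Rightarrow> real^'d" where
  "projection a i \<omega> = lim (\<lambda>k. \<Sum>j\<le>k. path_map \<omega> i j (a (i j)))"

definition random_fractal ::
    "nat \<Rightarrow> (nat \<Rightarrow> real^'d) \<Rightarrow> 'd::finite labelling \<Rightarrow> (real^'d) set" where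
  "random_fractal m a \<omega> = (\<Union>i\<in>infinite_words m. {projection a i \<omega>})"

end

(* Upper bound: the pieces of generation k have expected t-th power sum (m E r^t)^k, which tends to 0
   for t > s.

   Lower bound: for t < s with t <= d put c = m E r^t > 1 and give the piece of the word w of length k
   the mass c^(-k) r_w^t. The law of r Q x is rotation invariant and has a bounded radial density, so
   it gives a ball of radius rho mass at most C rho^d when |x| is bounded below (transversality).
   Splitting the pairs of points according to whether their first symbols agree gives a recursion in k,
   which shows that the expected mass of pairs at distance at most rho is at most A rho^t + c^(-k).
   A second moment argument then yields an event of positive probability on which the masses have bounded
   u-energy for u < t (so that the Hausdorff measure is positive), or, for t = d < s, a bounded
   squared density (so that Lebesgue measure is positive). The subtrees below the words 1^n 2 are independent
   copies of the whole tree, hence almost surely one of them lies in this event. *)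

theory Submission
  imports Defs
begin

section \<open>Hausdorff measure: covers and energies\<close>

text \<open>The obstacle to transversality is the origin: scaling and rotating hardly moves a point
  near 0, so resampling its label separates nothing. This is where distinct translations enter. For
  two pieces with different first symbols, either one of the two subtree points is far from 0 and
  its label is resampled, or both stay close to their translations, which are apart. No limit
  measure is constructed. The fractal is compact, so a cover involves finitely many dyadic scales,
  and a finite weighted family of points that depends on the cut-off K is enough. The error c^-k of
  the recursion is made harmless by choosing the generation k after K. The resulting events vary
  with K, but their probabilities have a common lower bound, so infinitely many of them occur
  together with positive probability. Every point of the probability space is an admissible
  labelling, since both label laws live on exactly the allowed values. The geometry is therefore
  deterministic, and null sets arise only from expectations and independence.\<close>

lemma hausdorff_premeasure_le_sum:
  assumes "finite I" "A \<subseteq> (\<Union>i\<in>I. U i)" "0 \<le> \<delta>"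
    and "\<And>i. i \<in> I \<Longrightarrow> bounded (U i) \<and> diameter (U i) \<le> \<delta>"
  shows "hausdorff_premeasure t \<delta> A \<le> (\<Sum>i\<in>I. diam_power t (U i))"
proof -
  obtain h where h: "bij_betw h {0..<card I} I"
    using ex_bij_betw_nat_finite[OF assms(1)] by auto
  \<comment> \<open>The finite cover is padded with empty sets, which cost 0 even for t = 0.\<close>
  define V where "V n = (if n < card I then U (h n) else {})" for n
  have hI: "h n \<in> I" if "n < card I" for n
    using bij_betwE[OF h] that by auto
  have "A \<subseteq> (\<Union>n. V n)"
  proof
    fix x assume "x \<in> A"
    then obtain i where i: "i \<in> I" "x \<in> U i" using assms(2) by auto
    then obtain n where "n < card I" "h n = i"
      using bij_betw_imp_surj_on[OF h] by (metis atLeastLessThan_iff imageE)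
    then show "x \<in> (\<Union>n. V n)" using i by (auto simp: V_def intro!: exI[of _ n])
  qed
  then have "V \<in> delta_covers \<delta> A"
    using assms(3,4) hI by (auto simp: delta_covers_def V_def)
  then have "hausdorff_premeasure t \<delta> A \<le> (\<Sum>n. diam_power t (V n))"
    unfolding hausdorff_premeasure_def by (rule INF_lower)
  also have "\<dots> = (\<Sum>n\<in>{0..<card I}. diam_power t (V n))"
    by (rule suminf_finite) (auto simp: V_def diam_power_def)
  also have "\<dots> = (\<Sum>n\<in>{0..<card I}. diam_power t (U (h n)))"
    by (rule sum.cong) (auto simp: V_def)
  also have "\<dots> = (\<Sum>i\<in>I. diam_power t (U i))"
    by (rule sum.reindex_bij_betw[OF h])
  finally show ?thesis .
qed

text \<open>The first assumption is there for the empty set, whose diameter is 0.\<close>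

lemma diameter_le_dist:
  assumes "S \<noteq> {} \<or> 0 \<le> \<delta>" "\<And>x y. x \<in> S \<Longrightarrow> y \<in> S \<Longrightarrow> dist x y \<le> \<delta>"
  shows "diameter S \<le> \<delta>"
  using assms by (auto simp: diameter_def intro: cSUP_least)

lemma diam_power_le_powr:
  assumes "bounded U" "diameter U \<le> D" "0 < D" "0 \<le> t"
  shows "diam_power t U \<le> ennreal (D powr t)"
  using assms diameter_ge_0[OF assms(1)]
  by (auto simp: diam_power_def intro!: ennreal_leI powr_mono2 simp flip: ennreal_1)

lemma diam_power_eq_powr: "t \<noteq> 0 \<Longrightarrow> diam_power t U = ennreal (diameter U powr t)"
  by (auto simp: diam_power_def)

lemma hausdorff_premeasure_antimono:
  "\<delta> \<le> \<delta>' \<Longrightarrow> hausdorff_premeasure t \<delta>' A \<le> hausdorff_premeasure t \<delta> A"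
  unfolding hausdorff_premeasure_def
  by (rule INF_superset_mono) (auto simp: delta_covers_def intro: order_trans)

lemma hausdorff_premeasure_mono:
  "A \<subseteq> B \<Longrightarrow> hausdorff_premeasure t \<delta> A \<le> hausdorff_premeasure t \<delta> B"
  unfolding hausdorff_premeasure_def
  by (rule INF_superset_mono) (auto simp: delta_covers_def)

lemma hausdorff_measure_eq_0_iff:
  "hausdorff_measure t A = 0 \<longleftrightarrow> (\<forall>\<delta>>0. hausdorff_premeasure t \<delta> A = 0)"
  unfolding hausdorff_measure_def bot_ennreal[symmetric] SUP_bot_conv by auto

lemma hausdorff_measure_0_subset:
  "A \<subseteq> B \<Longrightarrow> hausdorff_measure t B = 0 \<Longrightarrow> hausdorff_measure t A = 0"
  unfolding hausdorff_measure_eq_0_iff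
  by (metis hausdorff_premeasure_mono le_zero_eq)

lemma hausdorff_measure_0_mono:
  assumes "0 \<le> t" "t \<le> t'" "hausdorff_measure t A = 0"
  shows "hausdorff_measure t' A = 0"
  unfolding hausdorff_measure_eq_0_iff
proof (intro allI impI)
  fix \<delta> :: real assume "\<delta> > 0"
  have le: "diam_power t' U \<le> diam_power t U" if "bounded U" "diameter U \<le> 1" for U :: "'a set"
    using assms(1,2) that diameter_ge_0[OF that(1)]
    by (auto simp: diam_power_def intro!: ennreal_leI powr_mono' powr_le1 simp flip: ennreal_1)
  \<comment> \<open>Raising the exponent lowers a covering sum only if all diameters are at most 1.
    Passing to a finer mesh is allowed because it can only increase the premeasure.\<close>
  have "hausdorff_premeasure t' \<delta> A \<le> hausdorff_premeasure t' (min \<delta> 1) A"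
    by (rule hausdorff_premeasure_antimono) auto
  also have "\<dots> \<le> hausdorff_premeasure t (min \<delta> 1) A"
    unfolding hausdorff_premeasure_def
    by (intro INF_mono' suminf_le le summableI INF_superset_mono) (auto simp: delta_covers_def intro!: INF_mono suminf_le le)
  also have "\<dots> = 0"
    using assms(3) \<open>\<delta> > 0\<close> unfolding hausdorff_measure_eq_0_iff by auto
  finally show "hausdorff_premeasure t' \<delta> A = 0" by simp
qed

text \<open>Preimages of a cover of the image cover \<open>A\<close>, with diameters divided by r.
  Vanishing thus passes from a scaled copy inside the fractal to the set that was scaled.\<close>

lemma hausdorff_measure_0_similarity:
  fixes T :: "'a::metric_space \<Rightarrow> 'b::metric_space"
  assumes r: "0 < r" and T: "\<And>x y. dist (T x) (T y) = r * dist x y" and t: "0 \<le> t"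
    and 0: "hausdorff_measure t (T ` A) = 0"
  shows "hausdorff_measure t A = 0"
  unfolding hausdorff_measure_eq_0_iff
proof (intro allI impI)
  fix \<delta> :: real assume \<delta>: "\<delta> > 0"
  have "ennreal (r powr t) * hausdorff_premeasure t \<delta> A \<le> hausdorff_premeasure t (r * \<delta>) (T ` A)"
    unfolding hausdorff_premeasure_def[of t "r * \<delta>"]
  proof (rule INF_greatest)
    fix U assume U: "U \<in> delta_covers (r * \<delta>) (T ` A)"
    define V where "V n = T -` U n" for n
    have Ub: "bounded (U n)" "diameter (U n) \<le> r * \<delta>" for n
      using U by (auto simp: delta_covers_def)
    have dV: "dist x y \<le> diameter (U n) / r" if "x \<in> V n" "y \<in> V n" for x y n
      using diameter_bounded_bound[OF Ub(1)[of n], of "T x" "T y"] that r T[of x y]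
      by (auto simp: V_def field_simps)
    have bV: "bounded (V n)" for n
      using dV unfolding bounded_two_points by blast
    have diam: "diameter (V n) \<le> diameter (U n) / r" for n
      using r diameter_ge_0[OF Ub(1), of n] dV
      by (cases "V n = {}") (auto intro!: diameter_le_dist)
    have "diameter (U n) / r \<le> \<delta>" for n
      using r Ub(2)[of n] by (simp add: field_simps)
    then have "V \<in> delta_covers \<delta> A"
      using U bV order_trans[OF diam] by (auto simp: delta_covers_def V_def image_subset_iff)
    then have "hausdorff_premeasure t \<delta> A \<le> (\<Sum>n. diam_power t (V n))"
      unfolding hausdorff_premeasure_def by (rule INF_lower)
    then have "ennreal (r powr t) * hausdorff_premeasure t \<delta> A \<le> ennreal (r powr t) * (\<Sum>n. diam_power t (V n))"
      by (rule mult_left_mono) simp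
    also have "\<dots> = (\<Sum>n. ennreal (r powr t) * diam_power t (V n))"
      by simp
    also have "\<dots> \<le> (\<Sum>n. diam_power t (U n))"
    proof (intro suminf_le summableI)
      fix n
      show "ennreal (r powr t) * diam_power t (V n) \<le> diam_power t (U n)"
      proof (cases "V n = {}")
        case True then show ?thesis by (simp add: diam_power_def)
      next
        case False
        then have "U n \<noteq> {}" by (auto simp: V_def)
        have "r powr t * diameter (V n) powr t = (r * diameter (V n)) powr t"
          using r diameter_ge_0[OF bV, of n] by (simp add: powr_mult)
        also have "\<dots> \<le> diameter (U n) powr t"
          using r diameter_ge_0[OF bV, of n] diam[of n] t by (intro powr_mono2) (auto simp: field_simps)
        finally show ?thesis
          using False \<open>U n \<noteq> {}\<close> r by (auto simp: diam_power_def ennreal_mult[symmetric] intro!: ennreal_leI)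
      qed
    qed
    finally show "ennreal (r powr t) * hausdorff_premeasure t \<delta> A \<le> (\<Sum>n. diam_power t (U n))" .
  qed
  also have "\<dots> = 0"
    using 0 r \<delta> unfolding hausdorff_measure_eq_0_iff by auto
  finally show "hausdorff_premeasure t \<delta> A = 0" using r by simp
qed

section \<open>Vanishing of Hausdorff measures above the dimension of the space\<close>

lemma floor_abs_bound: "\<bar>y\<bar> \<le> real N \<Longrightarrow> \<lfloor>y\<rfloor> \<in> {- int N..int N}"
  by (auto simp: le_floor_iff floor_le_iff)

text \<open>Grid cubes of side 1/n: at most (3Rn)^d of them meet \<open>A\<close>, each of diameter
  at most d/n by the l1 norm, so the covering sum is of order n^(d-t). This supplies the bound d on
  the dimension when s exceeds d.\<close>

lemma hausdorff_measure_above_dim_eq_0: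
  fixes A :: "(real^'d) set"
  assumes "bounded A" and t: "real CARD('d) < t"
  shows "hausdorff_measure t A = 0"
  unfolding hausdorff_measure_eq_0_iff
proof (intro allI impI)
  fix \<delta> :: real assume \<delta>: "\<delta> > 0"
  let ?d = "real CARD('d)"
  have d: "?d > 0" by simp
  obtain B where B: "\<And>x. x \<in> A \<Longrightarrow> norm x \<le> B" using assms(1) by (auto simp: bounded_iff)
  obtain R0 :: nat where "B \<le> real R0" using real_arch_simple by blast
  then obtain R :: nat where R: "B \<le> real R" "R > 0" by (intro that[of "Suc R0"]) auto
  have bound: "hausdorff_premeasure t \<delta> A \<le> ennreal ((3 * real R) ^ CARD('d) * ?d powr t * real n powr (?d - t))"
    if n: "n > 0" "?d / \<delta> \<le> real n" for n :: nat
  proof -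
    define I :: "('d \<Rightarrow> int) set" where "I = PiE UNIV (\<lambda>_. {- int (n * R)..int (n * R)})"
    define U :: "('d \<Rightarrow> int) \<Rightarrow> (real^'d) set" where "U f = {x. \<forall>i. \<lfloor>real n * x $ i\<rfloor> = f i}" for f
    have finI: "finite I" unfolding I_def by (rule finite_PiE) auto
    have cov: "A \<subseteq> (\<Union>f\<in>I. U f)"
    proof
      fix x assume x: "x \<in> A"
      have "\<bar>x $ i\<bar> \<le> real R" for i using component_le_norm_cart[of x i] B[OF x] R by linarith
      then have "\<bar>real n * x $ i\<bar> \<le> real (n * R)" for i by (simp add: abs_mult mult_left_mono)
      then have "\<lfloor>real n * x $ i\<rfloor> \<in> {- int (n * R)..int (n * R)}" for i
        by (rule floor_abs_bound)
      then have "(\<lambda>i. \<lfloor>real n * x $ i\<rfloor>) \<in> I" unfolding I_def by auto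
      then show "x \<in> (\<Union>f\<in>I. U f)" by (auto simp: U_def)
    qed
    have dist: "dist x y \<le> ?d / n" if "x \<in> U f" "y \<in> U f" for x y f
    proof -
      have "\<bar>(x - y) $ i\<bar> \<le> 1 / real n" for i
      proof -
        have "\<bar>real n * x $ i - real n * y $ i\<bar> \<le> 1"
          using that floor_correct[of "real n * x $ i"] floor_correct[of "real n * y $ i"]
          unfolding U_def by simp linarith
        then have "real n * \<bar>x $ i - y $ i\<bar> \<le> 1"
          by (metis abs_mult abs_of_nat right_diff_distrib)
        then show ?thesis using n by (simp add: field_simps)
      qed
      then have "(\<Sum>i\<in>UNIV. \<bar>(x - y) $ i\<bar>) \<le> (\<Sum>i\<in>(UNIV::'d set). 1 / real n)"
        by (intro sum_mono)
      then show ?thesis using norm_le_l1_cart[of "x - y"] by (simp add: dist_norm)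
    qed
    have bU: "bounded (U f)" for f using dist[of _ f] unfolding bounded_two_points by blast
    have dU: "diameter (U f) \<le> ?d / n" for f
      using dist[of _ f] n by (intro diameter_le_dist) auto
    have dn: "?d / n \<le> \<delta>" using n \<delta> by (simp add: field_simps)
    have "hausdorff_premeasure t \<delta> A \<le> (\<Sum>f\<in>I. diam_power t (U f))"
      using finI cov \<delta> bU order_trans[OF dU dn] by (intro hausdorff_premeasure_le_sum) auto
    also have "\<dots> \<le> (\<Sum>f\<in>I. ennreal ((?d / n) powr t))"
      using bU dU n t d by (intro sum_mono diam_power_le_powr) auto
    also have "\<dots> = ennreal (real (card I) * (?d / n) powr t)"
      by (simp add: ennreal_mult ennreal_of_nat_eq_real_of_nat)
    also have "\<dots> \<le> ennreal ((3 * real R) ^ CARD('d) * ?d powr t * real n powr (?d - t))"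
    proof (rule ennreal_leI)
      have "card I = (2 * n * R + 1) ^ CARD('d)"
        unfolding I_def by (simp add: card_PiE nat_add_distrib nat_mult_distrib algebra_simps)
      moreover have "2 * n * R + 1 \<le> 3 * R * n" using n R(2)
        by (smt (verit) One_nat_def Suc_leI add_mult_distrib mult.commute mult.assoc nat_0_less_mult_iff numeral_3_eq_3 numeral_2_eq_2 add_le_mono le_refl mult_Suc plus_1_eq_Suc add.commute)
      ultimately have "card I \<le> (3 * R * n) ^ CARD('d)" by (simp add: power_mono)
      then have "real (card I) \<le> real ((3 * R * n) ^ CARD('d))" by (rule of_nat_mono)
      then have "real (card I) \<le> (3 * real R) ^ CARD('d) * real n powr ?d"
        using n by (simp add: powr_realpow power_mult_distrib)
      then have "real (card I) * (?d / n) powr t \<le> ((3 * real R) ^ CARD('d) * real n powr ?d) * (?d / n) powr t"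
        by (rule mult_right_mono) simp
      then show "real (card I) * (?d / n) powr t \<le> (3 * real R) ^ CARD('d) * ?d powr t * real n powr (?d - t)"
        using n by (simp add: powr_divide powr_diff field_simps)
    qed
    finally show ?thesis .
  qed
  have "(\<lambda>n. ennreal ((3 * real R) ^ CARD('d) * ?d powr t * real n powr (?d - t)))
        \<longlonglongrightarrow> ennreal ((3 * real R) ^ CARD('d) * ?d powr t * 0)"
    using t by (intro tendsto_ennrealI tendsto_mult tendsto_const tendsto_neg_powr filterlim_real_sequentially) auto
  moreover have "\<exists>N. \<forall>n\<ge>N. hausdorff_premeasure t \<delta> A
      \<le> ennreal ((3 * real R) ^ CARD('d) * ?d powr t * real n powr (?d - t))"
  proof -
    obtain N :: nat where N: "?d / \<delta> \<le> real N" using real_arch_simple by blast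
    show ?thesis
      by (intro exI[of _ "Suc N"] allI impI bound) (use N in auto)
  qed
  ultimately have "hausdorff_premeasure t \<delta> A \<le> ennreal ((3 * real R) ^ CARD('d) * ?d powr t * 0)"
    by (rule LIMSEQ_le_const)
  then show "hausdorff_premeasure t \<delta> A = 0" by simp
qed

section \<open>Positivity criteria from pair sums of finite weighted families\<close>

lemma obtain_dyadic_scale:
  fixes d :: real
  assumes "0 < d" "d \<le> 1"
  obtains l :: nat where "(1/2) ^ Suc l < d" "d \<le> (1/2) ^ l"
proof -
  define l where "l = (LEAST l. (1/2::real) ^ Suc l < d)"
  obtain n where "(1/2::real) ^ n < d" using real_arch_pow_inv[OF assms(1), of "1/2"] by auto
  then have "(1/2::real) ^ Suc n < d" using assms(1) by simp
  then have 1: "(1/2) ^ Suc l < d" unfolding l_def by (rule LeastI)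
  have "d \<le> (1/2) ^ l"
  proof (cases l)
    case 0 then show ?thesis using assms by simp
  next
    case (Suc k)
    then have "k < (LEAST l. (1/2::real) ^ Suc l < d)" unfolding l_def by simp
    from not_less_Least[OF this] have "\<not> (1/2::real) ^ Suc k < d" .
    then show ?thesis using Suc by auto
  qed
  with 1 show ?thesis by (rule that)
qed

text \<open>A linearised Cauchy-Schwarz inequality: summed or integrated, it bounds a total mass by
  a size term and a quadratic term, with \<open>c\<close> balancing the two.\<close>

lemma AM_GM_weighted:
  fixes x y c :: real
  assumes "0 < c" "0 < y"
  shows "x \<le> c * y / 2 + x\<^sup>2 / y / (2 * c)"
proof -
  have "0 \<le> (x - c * y)\<^sup>2 / (2 * c * y)" using assms by auto
  also have "\<dots> = c * y / 2 + x\<^sup>2 / y / (2 * c) - x"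
    using assms by (simp add: field_simps power2_eq_square)
  finally show ?thesis by simp
qed

text \<open>A finite weighted family of points plays the role of a measure in Frostman's lemma; the pair
  sums at the scales \<open>2\<^sup>-\<^sup>n\<close> bound its \<open>t\<close>-energy.\<close>

lemma hausdorff_measure_nonzero_energy:
  fixes F :: "'a::metric_space set" and t M :: real
  assumes "compact F" and t: "0 < t" and M: "0 < M"
    and energy: "\<And>K::nat. \<exists>(I::'i set) \<mu> p. finite I \<and> (\<forall>i\<in>I. 0 \<le> \<mu> i \<and> p i \<in> F) \<and> 1/2 \<le> sum \<mu> I \<and>
       (\<Sum>n\<le>K. ((1/2)^n) powr (-t) * (\<Sum>i\<in>I. \<Sum>j\<in>I. \<mu> i * \<mu> j * of_bool (dist (p i) (p j) \<le> (1/2)^n))) \<le> M"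
  shows "hausdorff_measure t F \<noteq> 0"
proof
  assume "hausdorff_measure t F = 0"
  \<comment> \<open>The constants make the two final terms at most 1/8 and 1/4, against a mass of at
    least 1/2. The 1/4 in \<open>\<epsilon>\<close> forces the selected \<open>d n\<close> to be at
    most 1, so that dyadic scales exist for them.\<close>
  define c where "c = 2 * 2 powr t * M"
  define \<epsilon> where "\<epsilon> = min (1 / (8 * c)) (1/4)"
  have c: "c > 0" using M by (simp add: c_def)
  then have \<epsilon>: "\<epsilon> > 0" by (simp add: \<epsilon>_def)
  have "hausdorff_premeasure t 1 F < ennreal \<epsilon>"
    using \<open>hausdorff_measure t F = 0\<close> \<epsilon> by (simp add: hausdorff_measure_eq_0_iff)
  then obtain U where U: "U \<in> delta_covers 1 F" and sumU: "(\<Sum>n. diam_power t (U n)) < ennreal \<epsilon>"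
    unfolding hausdorff_premeasure_def by (auto simp: INF_less_iff)
  have bU: "bounded (U n)" for n using U by (auto simp: delta_covers_def)
  \<comment> \<open>Enlarging the t-th powers by summable amounts gives even sets of diameter 0 a
    positive size and leaves room to thicken the cover to an open one.\<close>
  define d where "d n = (diameter (U n) powr t + \<epsilon> * (1/2) ^ Suc n) powr (1 / t)" for n
  have dt: "d n powr t = diameter (U n) powr t + \<epsilon> * (1/2) ^ Suc n" for n
    using t \<epsilon> by (simp add: d_def powr_powr)
  have d_pos: "d n > 0" for n
  proof -
    have "0 < diameter (U n) powr t + \<epsilon> * (1/2) ^ Suc n"
      using \<epsilon> by (intro add_nonneg_pos) auto
    then show ?thesis by (simp add: d_def)
  qed
  have d_gt: "diameter (U n) < d n" for n
  proof (rule ccontr)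
    assume "\<not> ?thesis"
    then have "d n powr t \<le> diameter (U n) powr t" using t d_pos[of n] by (intro powr_mono2) auto
    moreover have "0 < \<epsilon> * (1/2) ^ Suc n" using \<epsilon> by (intro mult_pos_pos zero_less_power) auto
    ultimately show False using dt[of n] by linarith
  qed
  define V where "V n = (\<Union>x\<in>U n. ball x ((d n - diameter (U n)) / 2))" for n
  have "open (V n)" for n unfolding V_def by auto
  have V_dist: "dist x y \<le> d n" if xy: "x \<in> V n" "y \<in> V n" for x y n
  proof -
    obtain x' y' where x'y': "x' \<in> U n" "y' \<in> U n" "dist x' x < (d n - diameter (U n)) / 2"
      "dist y' y < (d n - diameter (U n)) / 2" using xy by (auto simp: V_def)
    have "dist x y \<le> dist x x' + dist x' y' + dist y' y"
      using dist_triangle[of x y x'] dist_triangle[of x' y y'] by linarith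
    then show ?thesis
      using x'y' diameter_bounded_bound[OF bU x'y'(1,2)] by (simp add: dist_commute)
  qed
  have "U n \<subseteq> V n" for n
    unfolding V_def using d_gt[of n] by force
  then have "F \<subseteq> (\<Union>n. V n)"
    using U unfolding delta_covers_def by blast
  then obtain C where C: "finite C" "F \<subseteq> (\<Union>n\<in>C. V n)"
    using compactE_image[OF \<open>compact F\<close>, of UNIV V] \<open>\<And>n. open (V n)\<close> by auto
  have sum_d: "(\<Sum>n\<in>C. d n powr t) \<le> 2 * \<epsilon>"
  proof -
    have "ennreal (\<Sum>n\<in>C. diameter (U n) powr t) = (\<Sum>n\<in>C. diam_power t (U n))"
      using t by (subst sum_ennreal[symmetric]) (auto simp: diam_power_eq_powr)
    also have "\<dots> \<le> (\<Sum>n. diam_power t (U n))"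
      using C by (intro sum_le_suminf) auto
    finally have "(\<Sum>n\<in>C. diameter (U n) powr t) \<le> \<epsilon>"
      using sumU \<epsilon> by (metis ennreal_le_iff less_imp_le order_le_less_trans)
    moreover have "(\<Sum>n\<in>C. (1/2) ^ Suc n) \<le> (1::real)"
      using sum_le_suminf[of "\<lambda>n. (1/2::real) ^ Suc n" C] C power_half_series
      by (auto simp: sums_iff)
    then have "(\<Sum>n\<in>C. \<epsilon> * (1/2) ^ Suc n) \<le> \<epsilon>"
      using \<epsilon> by (simp only: sum_distrib_left[symmetric]) (simp add: mult_le_cancel_left2)
    ultimately show ?thesis by (simp only: dt sum.distrib)
  qed
  have d_le1: "d n \<le> 1" if "n \<in> C" for n
  proof (rule ccontr)
    assume "\<not> d n \<le> 1"
    then have "1 < d n powr t" using t by (simp add: gr_one_powr)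
    also have "d n powr t \<le> (\<Sum>n\<in>C. d n powr t)"
      using C that by (intro member_le_sum) auto
    also have "\<dots> \<le> 1/2" using sum_d by (simp add: \<epsilon>_def)
    finally show False by simp
  qed
  have "\<exists>l. \<forall>n\<in>C. (1/2) ^ Suc (l n) < d n \<and> d n \<le> (1/2) ^ l n"
    using obtain_dyadic_scale d_le1 d_pos by (intro bchoice) blast
  then obtain l where l: "\<And>n. n \<in> C \<Longrightarrow> (1/2) ^ Suc (l n) < d n" "\<And>n. n \<in> C \<Longrightarrow> d n \<le> (1/2) ^ l n"
    by blast
  \<comment> \<open>The cut-off is fixed only now, after compactness has left finitely many scales;
    the family of points may depend on it.\<close>
  define K where "K = Max (insert 0 (l ` C))"
  have lK: "l n \<le> K" if "n \<in> C" for n using C that by (auto simp: K_def)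
  obtain I :: "'i set" and \<mu> p where I: "finite I" "\<And>i. i \<in> I \<Longrightarrow> 0 \<le> \<mu> i \<and> p i \<in> F" "1/2 \<le> sum \<mu> I"
    and en: "(\<Sum>n\<le>K. ((1/2)^n) powr (-t) * (\<Sum>i\<in>I. \<Sum>j\<in>I. \<mu> i * \<mu> j * of_bool (dist (p i) (p j) \<le> (1/2)^n))) \<le> M"
    using energy[of K] by blast
  \<comment> \<open>Each point is charged to one set of the cover that contains it;
    \<open>w n\<close> is the mass charged to \<open>V n\<close>.\<close>
  have "\<exists>g. \<forall>i\<in>I. g i \<in> C \<and> p i \<in> V (g i)"
    using I(2) C(2) by (intro bchoice) blast
  then obtain g where g: "\<And>i. i \<in> I \<Longrightarrow> g i \<in> C" "\<And>i. i \<in> I \<Longrightarrow> p i \<in> V (g i)" by blast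
  define w where "w n = (\<Sum>i\<in>I. \<mu> i * of_bool (g i = n))" for n
  \<comment> \<open>Two points charged to the same \<open>V n\<close> are within \<open>d n\<close>,
    hence counted at the scale \<open>l n\<close>. The factor \<open>2 powr t\<close> pays for
    rounding \<open>d n\<close> to a power of 1/2.\<close>
  have key: "(\<Sum>n\<in>C. of_bool (g i = n) * of_bool (g j = n) * d n powr (-t))
      \<le> 2 powr t * (\<Sum>k\<le>K. ((1/2)^k) powr (-t) * of_bool (dist (p i) (p j) \<le> (1/2)^k))"
    if ij: "i \<in> I" "j \<in> I" for i j
  proof (cases "g i = g j")
    case True
    let ?n = "g i"
    have "dist (p i) (p j) \<le> (1/2) ^ l ?n"
      using V_dist[of "p i" ?n "p j"] g ij True l(2)[of ?n] by force
    have "(\<Sum>n\<in>C. of_bool (g i = n) * of_bool (g j = n) * d n powr (-t)) = (\<Sum>n\<in>C. if g i = n then d n powr (-t) else 0)"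
      using True by (intro sum.cong) auto
    also have "\<dots> = d ?n powr (-t)"
      using g ij C by simp
    also have "\<dots> \<le> ((1/2) ^ Suc (l ?n)) powr (-t)"
      using l(1)[of ?n] g ij t by (intro powr_mono2') auto
    also have "\<dots> = 2 powr t * (((1/2) ^ l ?n) powr (-t) * of_bool (dist (p i) (p j) \<le> (1/2) ^ l ?n))"
      using \<open>dist (p i) (p j) \<le> (1/2) ^ l ?n\<close> by (simp add: powr_mult powr_divide powr_minus field_simps)
    also have "\<dots> \<le> 2 powr t * (\<Sum>k\<le>K. ((1/2)^k) powr (-t) * of_bool (dist (p i) (p j) \<le> (1/2)^k))"
      using lK[of ?n] g ij
      by (intro mult_left_mono member_le_sum[of "l ?n" _ "\<lambda>k. ((1/2)^k) powr (-t) * of_bool (dist (p i) (p j) \<le> (1/2)^k)"]) auto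
    finally show ?thesis .
  next
    case False
    then have "(\<Sum>n\<in>C. of_bool (g i = n) * of_bool (g j = n) * d n powr (-t)) = 0"
      by (intro sum.neutral) auto
    then show ?thesis by (simp add: sum_nonneg)
  qed
  have "(\<Sum>n\<in>C. (w n)\<^sup>2 / d n powr t)
      = (\<Sum>n\<in>C. \<Sum>i\<in>I. \<Sum>j\<in>I. \<mu> i * \<mu> j * (of_bool (g i = n) * of_bool (g j = n) * d n powr (-t)))"
    unfolding w_def power2_eq_square sum_product
    by (intro sum.cong refl) (simp add: sum_distrib_left powr_minus divide_inverse mult_ac)
  also have "\<dots> = (\<Sum>i\<in>I. \<Sum>j\<in>I. \<mu> i * \<mu> j * (\<Sum>n\<in>C. of_bool (g i = n) * of_bool (g j = n) * d n powr (-t)))"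
    unfolding sum_distrib_left by (subst sum.swap, intro sum.cong refl, subst sum.swap, simp)
  also have "\<dots> \<le> (\<Sum>i\<in>I. \<Sum>j\<in>I. \<mu> i * \<mu> j *
        (2 powr t * (\<Sum>k\<le>K. ((1/2)^k) powr (-t) * of_bool (dist (p i) (p j) \<le> (1/2)^k))))"
    using key I by (intro sum_mono mult_left_mono) auto
  also have "\<dots> = 2 powr t * (\<Sum>i\<in>I. \<Sum>j\<in>I. \<Sum>k\<le>K. ((1/2)^k) powr (-t) * (\<mu> i * \<mu> j * of_bool (dist (p i) (p j) \<le> (1/2)^k)))"
    by (simp only: sum_distrib_left mult_ac)
  also have "\<dots> = 2 powr t * (\<Sum>k\<le>K. ((1/2)^k) powr (-t) * (\<Sum>i\<in>I. \<Sum>j\<in>I. \<mu> i * \<mu> j * of_bool (dist (p i) (p j) \<le> (1/2)^k)))"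
    unfolding sum_distrib_left
    by (simp only: sum.swap[of _ "{..K}" I])
  also have "\<dots> \<le> 2 powr t * M" using en by (intro mult_left_mono) auto
  finally have sq: "(\<Sum>n\<in>C. (w n)\<^sup>2 / d n powr t) \<le> 2 powr t * M" .
  have "1/2 \<le> sum \<mu> I" by fact
  also have "\<dots> = (\<Sum>i\<in>I. \<Sum>n\<in>C. \<mu> i * of_bool (g i = n))"
    using g C by (intro sum.cong) (auto simp: if_distrib[of "\<lambda>x. _ * x"] of_bool_def cong: if_cong)
  also have "\<dots> = (\<Sum>n\<in>C. w n)" unfolding w_def by (rule sum.swap)
  also have "\<dots> \<le> (\<Sum>n\<in>C. c * d n powr t / 2 + (w n)\<^sup>2 / d n powr t / (2 * c))"
    using c d_pos by (intro sum_mono AM_GM_weighted) (auto simp: less_imp_neq[THEN not_sym])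
  also have "\<dots> = c / 2 * (\<Sum>n\<in>C. d n powr t) + (\<Sum>n\<in>C. (w n)\<^sup>2 / d n powr t) / (2 * c)"
    by (simp add: sum.distrib sum_distrib_left sum_divide_distrib)
  also have "\<dots> \<le> c / 2 * (2 * \<epsilon>) + 2 powr t * M / (2 * c)"
    using sum_d sq c by (intro add_mono mult_left_mono divide_right_mono) auto
  also have "\<dots> \<le> 1/8 + 1/4"
  proof (rule add_mono)
    have "c * \<epsilon> \<le> c * (1 / (8 * c))" using c by (intro mult_left_mono) (auto simp: \<epsilon>_def)
    then show "c / 2 * (2 * \<epsilon>) \<le> 1/8" using c by simp
    show "2 powr t * M / (2 * c) \<le> 1/4" using M by (simp add: c_def)
  qed
  finally show False by simp
qed

text \<open>Spread the masses over balls of radius \<rho>/2. Balls overlap only for pairs at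
  distance at most \<rho>, so the pair bound controls the square integral of the sum
  \<open>f\<close>; then \<open>f\<close> cannot be concentrated on an open set of tiny measure
  around a null set. Arbitrarily small scales are required so that the balls fit into that open
  set.\<close>

lemma lebesgue_nonzero_pair_sum:
  fixes F :: "'a::euclidean_space set" and M :: real
  assumes "compact F" and M: "0 < M"
    and pairs: "\<And>K::nat. \<exists>n\<ge>K. \<exists>(I::'i set) \<mu> p. finite I \<and> (\<forall>i\<in>I. 0 \<le> \<mu> i \<and> p i \<in> F) \<and> 1/2 \<le> sum \<mu> I \<and>
       (\<Sum>i\<in>I. \<Sum>j\<in>I. \<mu> i * \<mu> j * of_bool (dist (p i) (p j) \<le> (1/2)^n)) \<le> M * ((1/2)^n) ^ DIM('a)"
  shows "\<not> negligible F"
proof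
  assume neg: "negligible F"
  let ?D = "DIM('a)"
  define u where "u = unit_ball_vol (real ?D) * (1/2) ^ ?D"
  have u: "u > 0" by (simp add: u_def)
  \<comment> \<open>\<open>u * \<rho> ^ ?D\<close> is the volume v of a ball of radius \<rho>/2.
    With \<open>c = 2 * M * \<rho> ^ ?D\<close> below, the size term and the quadratic term become
    v/8 and v/4, against a mass of at least v/2.\<close>
  define \<epsilon> where "\<epsilon> = u / (8 * M)"
  have \<epsilon>: "\<epsilon> > 0" using u M by (simp add: \<epsilon>_def)
  obtain U where U: "open U" "F \<subseteq> U" "(U - F) \<in> lmeasurable" "emeasure lebesgue (U - F) < ennreal \<epsilon>"
    using sets_lebesgue_outer_open[OF _ \<epsilon>, of F] neg negligible_imp_sets by blast
  have "emeasure lebesgue U \<le> emeasure lebesgue (U - F) + emeasure lebesgue F"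
    using emeasure_subadditive[of "U - F" lebesgue F] U neg
    by (simp add: negligible_imp_sets fmeasurableD Un_absorb2)
  moreover have "emeasure lebesgue F = 0" using neg by (auto simp: negligible_iff_null_sets)
  ultimately have emU: "emeasure lborel U < ennreal \<epsilon>" using U by (simp add: emeasure_completion[of U lborel] main_part_sets)
  then have fU: "emeasure lborel U < \<infinity>" by (metis ennreal_less_top infinity_ennreal_def order_less_trans)
  have mU: "measure lborel U \<le> \<epsilon>"
    using emU \<epsilon> unfolding measure_def by (metis enn2real_leI less_imp_le)
  obtain e where e: "e > 0" "(\<Union>x\<in>F. ball x e) \<subseteq> U"
    using compact_subset_open_imp_ball_epsilon_subset[OF \<open>compact F\<close> U(1,2)] by blast
  obtain K where K: "(1/2::real) ^ K < e" using real_arch_pow_inv[OF e(1), of "1/2"] by auto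
  obtain n I \<mu> p where n: "n \<ge> K" and I: "finite (I::'i set)" "\<And>i. i \<in> I \<Longrightarrow> 0 \<le> \<mu> i \<and> p i \<in> F" "1/2 \<le> sum \<mu> I"
    and en: "(\<Sum>i\<in>I. \<Sum>j\<in>I. \<mu> i * \<mu> j * of_bool (dist (p i) (p j) \<le> (1/2)^n)) \<le> M * ((1/2)^n) ^ ?D"
    using pairs[of K] by blast
  define \<rho> :: real where "\<rho> = (1/2) ^ n"
  have \<rho>: "\<rho> > 0" by (simp add: \<rho>_def)
  have "\<rho> \<le> (1/2) ^ K" unfolding \<rho>_def using n by (intro power_decreasing) auto
  then have \<rho>e: "\<rho> < e" using K by linarith
  define B where "B i = ball (p i) (\<rho> / 2)" for i
  define v where "v = u * \<rho> ^ ?D"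
  have v: "v > 0" using u \<rho> by (simp add: v_def)
  have mB: "measure lborel (B i) = v" for i
    using \<rho> by (simp add: B_def v_def u_def content_ball power_divide power_mult_distrib field_simps)
  have fB: "emeasure lborel (B i) < \<infinity>" for i
    by (simp add: B_def emeasure_ball \<rho> less_imp_le)
  have BU: "B i \<subseteq> U" if "i \<in> I" for i
  proof -
    have "B i \<subseteq> ball (p i) e" using \<rho>e \<rho> by (auto simp: B_def)
    then show ?thesis using e(2) I(2)[OF that] by blast
  qed
  have BB: "measure lborel (B i \<inter> B j) \<le> v * of_bool (dist (p i) (p j) \<le> \<rho>)" for i j
  proof (cases "dist (p i) (p j) \<le> \<rho>")
    case True
    have "measure lborel (B i \<inter> B j) \<le> measure lborel (B i)"
      using fB[of i] by (intro measure_mono_fmeasurable) (auto simp: B_def fmeasurable_def)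
    then show ?thesis using True mB by simp
  next
    case False
    have "x \<notin> B j" if "x \<in> B i" for x
      using False that dist_triangle2[of "p i" "p j" x] by (auto simp: B_def)
    then have "B i \<inter> B j = {}" by blast
    then show ?thesis using False by simp
  qed
  define f where "f x = (\<Sum>i\<in>I. \<mu> i * indicator (B i) x)" for x
  define c where "c = 2 * M * \<rho> ^ ?D"
  have c: "c > 0" using M \<rho> by (simp add: c_def)
  have sq: "(f x)\<^sup>2 = (\<Sum>i\<in>I. \<Sum>j\<in>I. \<mu> i * \<mu> j * indicator (B i \<inter> B j) x)" for x
    unfolding f_def power2_eq_square sum_product
    by (intro sum.cong refl) (auto simp: indicator_def)
  have int1: "integrable lborel (indicator (B i) :: 'a \<Rightarrow> real)" for i
    using fB by (auto simp: B_def intro!: integrable_real_indicator)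
  have int2: "integrable lborel (indicator (B i \<inter> B j) :: 'a \<Rightarrow> real)" for i j
    using fB[of i] le_less_trans[OF emeasure_mono[of "B i \<inter> B j" "B i" lborel]]
    by (auto simp: B_def intro!: integrable_real_indicator)
  have int3: "integrable lborel (indicator U :: 'a \<Rightarrow> real)"
    using fU U(1) by (intro integrable_real_indicator) auto
  have pt: "f x \<le> c / 2 * indicator U x + (f x)\<^sup>2 / (2 * c)" for x
  proof (cases "x \<in> U")
    case True
    then show ?thesis using AM_GM_weighted[OF c, of 1 "f x"] by simp
  next
    case False
    then have "x \<notin> B i" if "i \<in> I" for i using BU[OF that] by blast
    then have "f x = 0" by (simp add: f_def)
    then show ?thesis using False by simp
  qed
  have "v / 2 \<le> (\<Sum>i\<in>I. \<mu> i) * v" using I(3) v by simp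
  also have "\<dots> = (\<integral>x. f x \<partial>lborel)"
    using int1 mB by (simp add: f_def sum_distrib_right)
  also have "\<dots> \<le> (\<integral>x. c / 2 * indicator U x + (f x)\<^sup>2 / (2 * c) \<partial>lborel)"
  proof (rule integral_mono)
    show "integrable lborel f" unfolding f_def using int1 by auto
    show "integrable lborel (\<lambda>x. c / 2 * indicator U x + (f x)\<^sup>2 / (2 * c))"
      unfolding sq using int2 int3 by auto
  qed (rule pt)
  also have "\<dots> = c / 2 * measure lborel U + (\<Sum>i\<in>I. \<Sum>j\<in>I. \<mu> i * \<mu> j * measure lborel (B i \<inter> B j)) / (2 * c)"
    unfolding sq using int2 int3 by simp
  also have "\<dots> \<le> c / 2 * \<epsilon> + (\<Sum>i\<in>I. \<Sum>j\<in>I. \<mu> i * \<mu> j * (v * of_bool (dist (p i) (p j) \<le> \<rho>))) / (2 * c)"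
    using c mU I(2) by (intro add_mono mult_left_mono divide_right_mono sum_mono BB) auto
  also have "(\<Sum>i\<in>I. \<Sum>j\<in>I. \<mu> i * \<mu> j * (v * of_bool (dist (p i) (p j) \<le> \<rho>)))
      = v * (\<Sum>i\<in>I. \<Sum>j\<in>I. \<mu> i * \<mu> j * of_bool (dist (p i) (p j) \<le> \<rho>))"
    by (simp add: sum_distrib_left mult_ac)
  also have "c / 2 * \<epsilon> + v * (\<Sum>i\<in>I. \<Sum>j\<in>I. \<mu> i * \<mu> j * of_bool (dist (p i) (p j) \<le> \<rho>)) / (2 * c)
      \<le> c / 2 * \<epsilon> + v * (M * \<rho> ^ ?D) / (2 * c)"
    using en v c by (intro add_mono mult_left_mono divide_right_mono) (auto simp: \<rho>_def)
  also have "c / 2 * \<epsilon> = v / 8" using M by (simp add: c_def \<epsilon>_def v_def)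
  also have "v * (M * \<rho> ^ ?D) / (2 * c) = v / 4" using M \<rho> by (simp add: c_def)
  finally show False using v by simp
qed

section \<open>Codings and geometry of the fractal\<close>

text \<open>The labelling of the subtree below the symbol \<open>i\<close>. Restricting it to
  \<open>finite_words m\<close> makes it a point of the product space again.\<close>

definition label_shift :: "nat \<Rightarrow> nat \<Rightarrow> 'd::finite labelling \<Rightarrow> 'd labelling" where
  "label_shift m i \<omega> = (\<lambda>w\<in>finite_words m. \<omega> (i # w))"

text \<open>The t-th power of the product of the ratios along the initial words of \<open>w\<close>,
  unfolded from the root so that it matches \<open>label_shift\<close>.\<close>

primrec weight :: "nat \<Rightarrow> real \<Rightarrow> nat list \<Rightarrow> 'd::finite labelling \<Rightarrow> real" where
  "weight m t [] \<omega> = 1"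
| "weight m t (i # w) \<omega> = fst (\<omega> [i]) powr t * weight m t w (label_shift m i \<omega>)"

text \<open>Continuing with the symbol 1, present in every alphabet considered, selects one
  representative point in the piece of each finite word.\<close>

definition extend_word :: "nat list \<Rightarrow> nat \<Rightarrow> nat" where
  "extend_word w k = (if k < length w then w ! k else 1)"

text \<open>Unlike \<open>finite_words m\<close>, this contains the empty word, at length 0, where
  the inductions over generations start.\<close>

definition words :: "nat \<Rightarrow> nat \<Rightarrow> nat list set" where
  "words m k = {w. length w = k \<and> set w \<subseteq> {1..m}}"

lemma finite_set_words [simp]: "finite (words m k)"
  unfolding words_def using finite_lists_length_eq[of "{1..m}" k] by (simp add: conj_commute)

lemma words_0 [simp]: "words m 0 = {[]}"
  by (auto simp: words_def)

lemma words_Suc: "words m (Suc k) = (\<lambda>(i, w). i # w) ` ({1..m} \<times> words m k)"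
proof -
  have "w \<in> (\<lambda>(i, w). i # w) ` ({1..m} \<times> words m k)" if "w \<in> words m (Suc k)" for w
    using that by (cases w) (force simp: words_def)+
  then show ?thesis by (auto simp: words_def)
qed

lemma sum_words_Suc: "(\<Sum>w\<in>words m (Suc k). f w) = (\<Sum>i\<in>{1..m}. \<Sum>w\<in>words m k. f (i # w))"
  unfolding words_Suc
  by (subst sum.reindex) (auto simp: inj_on_def sum.cartesian_product case_prod_unfold)

lemma card_words: "card (words m k) = m ^ k"
  unfolding words_def using card_lists_length_eq[of "{1..m}" k] by (simp add: conj_commute)

lemma extend_word_Cons:
  "extend_word (i # w) 0 = i" "extend_word (i # w) \<circ> Suc = extend_word w"
  by (auto simp: extend_word_def)

lemma label_shift_apply: "w \<in> finite_words m \<Longrightarrow> label_shift m i \<omega> w = \<omega> (i # w)"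
  by (simp add: label_shift_def)

lemma infinite_words_tail: "j \<in> infinite_words m \<Longrightarrow> j \<circ> Suc \<in> infinite_words m"
  by (auto simp: infinite_words_def)

lemma linear_label_map: "linear (label_map \<omega> w)"
  unfolding label_map_def
  by (intro linearI) (auto simp: matrix_vector_right_distrib scaleR_right_distrib matrix_vector_mult_scaleR)

lemma map_upt_Suc_Cons: "map f [0..<Suc k] = f 0 # map (f \<circ> Suc) [0..<k]"
  by (simp add: upt_conv_Cons map_Suc_upt[symmetric] del: upt_Suc)

lemma map_finite_words: "j \<in> infinite_words m \<Longrightarrow> map j [0..<Suc k] \<in> finite_words m"
  by (auto simp: infinite_words_def finite_words_def)

text \<open>\<open>path_map\<close> is defined by adding innermost maps. Peeling off the outermost
  one instead leaves a path of the subtree labelling, which is the source of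
  self-similarity.\<close>

lemma path_map_Suc_shift:
  assumes "j \<in> infinite_words m"
  shows "path_map \<omega> j (Suc k) = label_map \<omega> [j 0] \<circ> path_map (label_shift m (j 0) \<omega>) (j \<circ> Suc) k"
proof (induction k)
  case 0 then show ?case by simp
next
  case (Suc k)
  have "label_map \<omega> (map j [0..<Suc (Suc k)]) = label_map (label_shift m (j 0) \<omega>) (map (j \<circ> Suc) [0..<Suc k])"
    using map_finite_words[OF infinite_words_tail[OF assms], of k]
    by (intro ext) (simp only: map_upt_Suc_Cons[of j "Suc k"] label_map_def label_shift_apply)
  then show ?case
    using Suc.IH by (simp only: path_map.simps comp_assoc)
qed

lemma path_map_cong:
  "(\<And>k. k < n \<Longrightarrow> i k = j k) \<Longrightarrow> path_map \<omega> i n = path_map \<omega> j n"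
proof (induction n)
  case (Suc n)
  then have "map i [0..<Suc n] = map j [0..<Suc n]" by (intro map_cong) auto
  moreover have "path_map \<omega> i n = path_map \<omega> j n" using Suc by simp
  ultimately show ?case by (simp only: path_map.simps)
qed simp

text \<open>Symbols are discrete, so cylinders are open in the product topology, and every preimage
  is a union of cylinders.\<close>

lemma continuous_on_initial_word:
  fixes g :: "(nat \<Rightarrow> nat) \<Rightarrow> 'a::topological_space"
  assumes "\<And>i j. (\<And>k. k < n \<Longrightarrow> i k = j k) \<Longrightarrow> g i = g j"
  shows "continuous_on UNIV g"
proof -
  have cyl: "open {j. \<forall>k<n. j k = i k}" for i :: "nat \<Rightarrow> nat"
  proof -
    have "{j. \<forall>k<n. j k = i k} = (\<Inter>k\<in>{..<n}. (\<lambda>j. j k) -` {i k})" by auto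
    moreover have "open ((\<lambda>j. j k) -` {i k})" for k
      by (intro open_vimage continuous_on_product_coordinates Topological_Spaces.open_discrete)
    ultimately show ?thesis by auto
  qed
  have "open (g -` B)" for B
  proof -
    have "g -` B = (\<Union>i\<in>g -` B. {j. \<forall>k<n. j k = i k})"
    proof (intro equalityI subsetI)
      fix j assume "j \<in> (\<Union>i\<in>g -` B. {j. \<forall>k<n. j k = i k})"
      then obtain i where "g i \<in> B" "\<forall>k<n. j k = i k" by auto
      then show "j \<in> g -` B" using assms[of j i] by simp
    qed auto
    also have "open \<dots>" using cyl by blast
    finally show ?thesis .
  qed
  then show ?thesis by (simp add: continuous_on_open_vimage)
qed

lemma compact_infinite_words: "compact (infinite_words m)"
proof -
  have "infinite_words m = PiE UNIV (\<lambda>_. {1..m})" by (auto simp: infinite_words_def)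
  moreover have "compactin (product_topology (\<lambda>_. euclidean) UNIV) (PiE UNIV (\<lambda>_. {1..m}))"
    by (subst compactin_PiE) (auto simp: finite_imp_compact)
  ultimately show ?thesis by (simp add: euclidean_product_topology)
qed

section \<open>Geometry of the fractal for a single admissible labelling\<close>

locale ifs =
  fixes m :: nat and a :: "nat \<Rightarrow> real^'d" and lo hi :: real
  assumes m_pos: "1 \<le> m" and lo_pos: "0 < lo" and lo_hi: "lo < hi" and hi_1: "hi < 1"
begin

definition admissible :: "'d labelling \<Rightarrow> bool" where
  "admissible \<omega> \<longleftrightarrow> (\<forall>w\<in>finite_words m. fst (\<omega> w) \<in> {lo<..<hi} \<and> orthogonal_matrix (snd (\<omega> w)))"

abbreviation shift :: "nat \<Rightarrow> 'd labelling \<Rightarrow> 'd labelling" where "shift \<equiv> label_shift m"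

abbreviation wt :: "real \<Rightarrow> nat list \<Rightarrow> 'd labelling \<Rightarrow> real" where "wt \<equiv> weight m"

abbreviation pt :: "nat list \<Rightarrow> 'd labelling \<Rightarrow> real^'d" where "pt w \<equiv> projection a (extend_word w)"

abbreviation fractal :: "'d labelling \<Rightarrow> (real^'d) set" where "fractal \<equiv> random_fractal m a"

text \<open>The geometric series puts every coded point into the ball of this radius about 0; the
  summand 1 keeps it positive when all translations vanish.\<close>

definition radius :: real where "radius = (1 + (\<Sum>i\<in>{1..m}. norm (a i))) / (1 - hi)"

lemma radius_pos: "0 < radius"
  unfolding radius_def using hi_1 by (intro divide_pos_pos add_pos_nonneg sum_nonneg) auto

lemma hi_pos: "0 < hi" using lo_pos lo_hi by simp

lemma admissibleD:
  assumes "admissible \<omega>" "w \<in> finite_words m"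
  shows "lo < fst (\<omega> w)" "fst (\<omega> w) < hi" "0 < fst (\<omega> w)" "fst (\<omega> w) < 1" "orthogonal_matrix (snd (\<omega> w))"
  using assms lo_pos hi_1 by (force simp: admissible_def)+

lemma admissible_shift: "admissible \<omega> \<Longrightarrow> i \<in> {1..m} \<Longrightarrow> admissible (shift i \<omega>)"
  by (auto simp: admissible_def label_shift_apply finite_words_def)

lemma norm_label_map:
  assumes "admissible \<omega>" "w \<in> finite_words m"
  shows "norm (label_map \<omega> w x) = fst (\<omega> w) * norm x"
proof -
  have "orthogonal_transformation ((*v) (snd (\<omega> w)))"
    using admissibleD(5)[OF assms] by (simp add: orthogonal_transformation_matrix)
  then have "norm (snd (\<omega> w) *v x) = norm x" by (rule orthogonal_transformation_norm)
  then show ?thesis using admissibleD(3)[OF assms] by (simp add: label_map_def)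
qed

lemma dist_label_map:
  assumes "admissible \<omega>" "w \<in> finite_words m"
  shows "dist (label_map \<omega> w x) (label_map \<omega> w y) = fst (\<omega> w) * dist x y"
  using norm_label_map[OF assms, of "x - y"] linear_diff[OF linear_label_map, of \<omega> w x y]
  by (simp add: dist_norm)

lemma norm_path_map:
  assumes "admissible \<omega>" "j \<in> infinite_words m"
  shows "norm (path_map \<omega> j k x) \<le> hi ^ k * norm x"
proof (induction k arbitrary: x)
  case (Suc k)
  let ?y = "label_map \<omega> (map j [0..<Suc k]) x"
  have "norm (path_map \<omega> j k ?y) \<le> hi ^ k * norm ?y" by (rule Suc)
  also have "norm ?y \<le> hi * norm x"
    using norm_label_map[OF assms(1) map_finite_words[OF assms(2)]] admissibleD(2)[OF assms(1) map_finite_words[OF assms(2)], of k]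
    by (simp only:) (intro mult_right_mono, auto)
  finally show ?case using hi_pos by (simp add: mult_ac del: upt_Suc)
qed simp

lemma norm_path_term:
  assumes "admissible \<omega>" "j \<in> infinite_words m"
  shows "norm (path_map \<omega> j k (a (j k))) \<le> hi ^ k * (\<Sum>i\<in>{1..m}. norm (a i))"
proof -
  have "norm (a (j k)) \<le> (\<Sum>i\<in>{1..m}. norm (a i))"
    using assms(2) by (intro member_le_sum) (auto simp: infinite_words_def)
  then have "hi ^ k * norm (a (j k)) \<le> hi ^ k * (\<Sum>i\<in>{1..m}. norm (a i))"
    using hi_pos by (intro mult_left_mono) auto
  then show ?thesis using norm_path_map[OF assms, of k "a (j k)"] by linarith
qed

lemma summable_hi: "summable (\<lambda>k. hi ^ k * c)"
  using hi_pos hi_1 by (intro summable_mult2 summable_geometric) auto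

lemma summable_path:
  assumes "admissible \<omega>" "j \<in> infinite_words m"
  shows "summable (\<lambda>k. path_map \<omega> j k (a (j k)))"
  using norm_path_term[OF assms] summable_hi by (intro summable_comparison_test[OF _ summable_hi]) auto

lemma projection_eq_suminf:
  assumes "admissible \<omega>" "j \<in> infinite_words m"
  shows "projection a j \<omega> = (\<Sum>k. path_map \<omega> j k (a (j k)))"
  unfolding projection_def using summable_LIMSEQ'[OF summable_path[OF assms]] by (rule limI)

text \<open>After the first summand is split off, the first label map factors out of the series by
  linearity and continuity, and what remains is the series of the subtree.\<close>

lemma projection_rec:
  assumes "admissible \<omega>" "j \<in> infinite_words m"
  shows "projection a j \<omega> = a (j 0) + label_map \<omega> [j 0] (projection a (j \<circ> Suc) (shift (j 0) \<omega>))"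
proof -
  have j0: "j 0 \<in> {1..m}" using assms(2) by (auto simp: infinite_words_def)
  note adm = admissible_shift[OF assms(1) j0] infinite_words_tail[OF assms(2)]
  have "projection a j \<omega> = a (j 0) + (\<Sum>k. path_map \<omega> j (Suc k) (a (j (Suc k))))"
    using suminf_split_head[OF summable_path[OF assms]] by (simp add: projection_eq_suminf[OF assms])
  also have "(\<Sum>k. path_map \<omega> j (Suc k) (a (j (Suc k)))) =
      (\<Sum>k. label_map \<omega> [j 0] (path_map (shift (j 0) \<omega>) (j \<circ> Suc) k (a ((j \<circ> Suc) k))))"
    by (simp only: path_map_Suc_shift[OF assms(2)] comp_apply)
  also have "\<dots> = label_map \<omega> [j 0] (\<Sum>k. path_map (shift (j 0) \<omega>) (j \<circ> Suc) k (a ((j \<circ> Suc) k)))"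
    by (rule bounded_linear.suminf[symmetric, OF _ summable_path[OF adm]])
       (rule linear_conv_bounded_linear[THEN iffD1, OF linear_label_map])
  finally show ?thesis by (simp only: projection_eq_suminf[OF adm])
qed

lemma norm_projection_le:
  assumes "admissible \<omega>" "j \<in> infinite_words m"
  shows "norm (projection a j \<omega>) \<le> radius"
proof -
  let ?A = "\<Sum>i\<in>{1..m}. norm (a i)"
  have "norm (projection a j \<omega>) \<le> (\<Sum>k. hi ^ k * ?A)"
    unfolding projection_eq_suminf[OF assms]
    by (rule norm_suminf_le[OF norm_path_term[OF assms] summable_hi])
  also have "\<dots> = ?A / (1 - hi)"
    using hi_pos hi_1 by (simp add: suminf_mult2[symmetric] suminf_geometric summable_geometric)
  also have "\<dots> \<le> radius" unfolding radius_def using hi_1 by (intro divide_right_mono) auto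
  finally show ?thesis .
qed

lemma extend_word_infinite: "set w \<subseteq> {1..m} \<Longrightarrow> extend_word w \<in> infinite_words m"
proof -
  assume "set w \<subseteq> {1..m}"
  then have "w ! k \<in> {1..m}" if "k < length w" for k using nth_mem[OF that] by blast
  then show ?thesis using m_pos by (auto simp: infinite_words_def extend_word_def)
qed

lemma pt_Cons:
  assumes "admissible \<omega>" "i \<in> {1..m}" "set w \<subseteq> {1..m}"
  shows "pt (i # w) \<omega> = a i + label_map \<omega> [i] (pt w (shift i \<omega>))"
  using projection_rec[OF assms(1) extend_word_infinite[of "i # w"]] assms(2,3)
  by (simp add: extend_word_Cons)

lemma pt_in_fractal: "set w \<subseteq> {1..m} \<Longrightarrow> pt w \<omega> \<in> fractal \<omega>"
  using extend_word_infinite by (auto simp: random_fractal_def)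

lemma bounded_fractal:
  assumes "admissible \<omega>" shows "bounded (fractal \<omega>)"
  using norm_projection_le[OF assms] by (auto simp: bounded_iff random_fractal_def)

text \<open>The coding map is a uniform limit of partial sums that depend on finitely many symbols,
  hence continuous on the compact space of infinite words.\<close>

lemma compact_fractal:
  assumes "admissible \<omega>" shows "compact (fractal \<omega>)"
proof -
  have "uniform_limit (infinite_words m) (\<lambda>n j. \<Sum>k<n. path_map \<omega> j k (a (j k)))
          (\<lambda>j. \<Sum>k. path_map \<omega> j k (a (j k))) sequentially"
    by (rule Weierstrass_m_test[OF norm_path_term[OF assms] summable_hi])
  moreover have "continuous_on UNIV (\<lambda>j. path_map \<omega> j k (a (j k)))" for k
  proof (rule continuous_on_initial_word[of "Suc k"])
    fix i j :: "nat \<Rightarrow> nat" assume "\<And>l. l < Suc k \<Longrightarrow> i l = j l"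
    then show "path_map \<omega> i k (a (i k)) = path_map \<omega> j k (a (j k))"
      using path_map_cong[of k i j \<omega>] by simp
  qed
  then have "continuous_on (infinite_words m) (\<lambda>j. \<Sum>k<n. path_map \<omega> j k (a (j k)))" for n
    by (intro continuous_on_sum) (auto intro: continuous_on_subset)
  ultimately have "continuous_on (infinite_words m) (\<lambda>j. \<Sum>k. path_map \<omega> j k (a (j k)))"
    by (intro uniform_limit_theorem[where F=sequentially]) auto
  then have "continuous_on (infinite_words m) (\<lambda>j. projection a j \<omega>)"
    by (rule continuous_on_eq) (simp add: projection_eq_suminf[OF assms])
  then have "compact ((\<lambda>j. projection a j \<omega>) ` infinite_words m)"
    by (rule compact_continuous_image[OF _ compact_infinite_words])
  moreover have "(\<lambda>j. projection a j \<omega>) ` infinite_words m = fractal \<omega>"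
    by (auto simp: random_fractal_def)
  ultimately show ?thesis by simp
qed

lemma fractal_shift_subset:
  assumes "admissible \<omega>" "i \<in> {1..m}"
  shows "(\<lambda>x. a i + label_map \<omega> [i] x) ` fractal (shift i \<omega>) \<subseteq> fractal \<omega>"
proof safe
  fix x assume "x \<in> fractal (shift i \<omega>)"
  then obtain j where j: "j \<in> infinite_words m" "x = projection a j (shift i \<omega>)"
    by (auto simp: random_fractal_def)
  have c: "case_nat i j \<in> infinite_words m" using j(1) assms(2) by (auto simp: infinite_words_def split: nat.split)
  have "case_nat i j \<circ> Suc = j" by auto
  then have "a i + label_map \<omega> [i] x = projection a (case_nat i j) \<omega>"
    using projection_rec[OF assms(1) c] j(2) by simp
  then show "a i + label_map \<omega> [i] x \<in> fractal \<omega>" using c by (auto simp: random_fractal_def)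
qed

lemma wt_pos:
  assumes "admissible \<omega>" "set w \<subseteq> {1..m}" shows "0 < wt t w \<omega>"
  using assms
proof (induction w arbitrary: \<omega>)
  case (Cons i w)
  then show ?case using admissibleD(3)[of \<omega> "[i]"] admissible_shift[of \<omega> i] by (auto simp: finite_words_def)
qed simp

lemma wt_eq_powr:
  assumes "admissible \<omega>" "set w \<subseteq> {1..m}" shows "wt t w \<omega> = wt 1 w \<omega> powr t"
  using assms
proof (induction w arbitrary: \<omega>)
  case (Cons i w)
  then have "0 < fst (\<omega> [i])" "0 < wt 1 w (shift i \<omega>)" "wt t w (shift i \<omega>) = wt 1 w (shift i \<omega>) powr t"
    using admissibleD(3)[of \<omega> "[i]"] admissible_shift[of \<omega> i] wt_pos[of "shift i \<omega>" w 1]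
    by (auto simp: finite_words_def)
  then show ?case by (simp add: powr_mult)
qed simp

lemma wt_1_le:
  assumes "admissible \<omega>" "set w \<subseteq> {1..m}" shows "wt 1 w \<omega> \<le> hi ^ length w"
  using assms
proof (induction w arbitrary: \<omega>)
  case (Cons i w)
  then have "0 < fst (\<omega> [i])" "fst (\<omega> [i]) < hi" "wt 1 w (shift i \<omega>) \<le> hi ^ length w" "0 < wt 1 w (shift i \<omega>)"
    using admissibleD(2,3)[of \<omega> "[i]"] admissible_shift[of \<omega> i] wt_pos[of "shift i \<omega>" w 1]
    by (auto simp: finite_words_def)
  then show ?case by (auto intro!: mult_mono)
qed simp

text \<open>For the empty word both points lie within \<open>radius\<close> of 0; each further
  symbol contracts their distance by its own ratio.\<close>

lemma projection_near_pt:
  assumes "admissible \<omega>" "j \<in> infinite_words m"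
  shows "\<exists>w\<in>words m k. dist (projection a j \<omega>) (pt w \<omega>) \<le> 2 * radius * wt 1 w \<omega>"
  using assms
proof (induction k arbitrary: j \<omega>)
  case 0
  have "dist (projection a j \<omega>) (pt [] \<omega>) \<le> norm (projection a j \<omega>) + norm (pt [] \<omega>)"
    unfolding dist_norm by (rule norm_triangle_ineq4)
  then show ?case
    using norm_projection_le[OF 0] norm_projection_le[OF 0(1) extend_word_infinite[of "[]"]] by simp
next
  case (Suc k)
  have j0: "j 0 \<in> {1..m}" using Suc(3) by (auto simp: infinite_words_def)
  obtain w where w: "w \<in> words m k"
    "dist (projection a (j \<circ> Suc) (shift (j 0) \<omega>)) (pt w (shift (j 0) \<omega>)) \<le> 2 * radius * wt 1 w (shift (j 0) \<omega>)"
    using Suc.IH[OF admissible_shift[OF Suc(2) j0] infinite_words_tail[OF Suc(3)]] by blast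
  have fw: "[j 0] \<in> finite_words m" using j0 by (auto simp: finite_words_def)
  have "dist (projection a j \<omega>) (pt (j 0 # w) \<omega>)
      = fst (\<omega> [j 0]) * dist (projection a (j \<circ> Suc) (shift (j 0) \<omega>)) (pt w (shift (j 0) \<omega>))"
    using w(1) dist_label_map[OF Suc(2) fw]
    by (simp add: projection_rec[OF Suc(2,3)] pt_Cons[OF Suc(2) j0] words_def)
  also have "\<dots> \<le> fst (\<omega> [j 0]) * (2 * radius * wt 1 w (shift (j 0) \<omega>))"
    using w(2) admissibleD(3)[OF Suc(2) fw] by (intro mult_left_mono) auto
  also have "\<dots> = 2 * radius * wt 1 (j 0 # w) \<omega>"
    using admissibleD(3)[OF Suc(2) fw] by simp
  finally show ?case
    using w(1) j0 by (intro bexI[of _ "j 0 # w"]) (auto simp: words_def)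
qed

text \<open>One ball per word of length k, of radius proportional to the product of its ratios; the
  condition on k makes this cover fine enough.\<close>

lemma hausdorff_premeasure_fractal_le:
  assumes adm: "admissible \<omega>" and t: "0 \<le> t" and k: "4 * radius * hi ^ k \<le> \<delta>"
  shows "hausdorff_premeasure t \<delta> (fractal \<omega>) \<le> ennreal ((4 * radius) powr t) * ennreal (\<Sum>w\<in>words m k. wt t w \<omega>)"
proof -
  let ?U = "\<lambda>w. cball (pt w \<omega>) (2 * radius * wt 1 w \<omega>)"
  have set: "set w \<subseteq> {1..m}" "length w = k" if "w \<in> words m k" for w using that by (auto simp: words_def)
  have pos: "0 < wt 1 w \<omega>" if "w \<in> words m k" for w using wt_pos[OF adm set(1)[OF that]] .
  have diam: "diameter (?U w) \<le> 4 * radius * wt 1 w \<omega>" if "w \<in> words m k" for w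
    using radius_pos pos[OF that] by (simp add: diameter_cball)
  have "hausdorff_premeasure t \<delta> (fractal \<omega>) \<le> (\<Sum>w\<in>words m k. diam_power t (?U w))"
  proof (rule hausdorff_premeasure_le_sum)
    show "fractal \<omega> \<subseteq> (\<Union>w\<in>words m k. ?U w)"
      using projection_near_pt[OF adm, of _ k] by (fastforce simp: random_fractal_def dist_commute)
    show "0 \<le> \<delta>" using k radius_pos hi_pos by (smt (verit) mult_nonneg_nonneg zero_le_power)
    fix w assume w: "w \<in> words m k"
    have "4 * radius * wt 1 w \<omega> \<le> 4 * radius * hi ^ k"
      using wt_1_le[OF adm set(1)[OF w]] set(2)[OF w] radius_pos by (intro mult_left_mono) auto
    then show "bounded (?U w) \<and> diameter (?U w) \<le> \<delta>" using diam[OF w] k by auto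
  qed simp
  also have "\<dots> \<le> (\<Sum>w\<in>words m k. ennreal ((4 * radius * wt 1 w \<omega>) powr t))"
    using diam pos radius_pos t by (intro sum_mono diam_power_le_powr) auto
  also have "\<dots> = (\<Sum>w\<in>words m k. ennreal ((4 * radius) powr t * wt t w \<omega>))"
    using pos radius_pos by (intro sum.cong refl arg_cong[where f=ennreal]) (simp add: wt_eq_powr[OF adm set(1), of _ t] powr_mult less_imp_le)
  also have "\<dots> = ennreal ((4 * radius) powr t * (\<Sum>w\<in>words m k. wt t w \<omega>))"
    using wt_pos[OF adm set(1)] by (subst sum_ennreal) (auto simp: sum_distrib_left less_imp_le)
  also have "\<dots> = ennreal ((4 * radius) powr t) * ennreal (\<Sum>w\<in>words m k. wt t w \<omega>)"
    using wt_pos[OF adm set(1)] by (intro ennreal_mult sum_nonneg) (auto simp: less_imp_le)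
  finally show ?thesis .
qed

text \<open>Read contrapositively: positivity in a subtree passes up to the whole fractal, as the
  zero-one argument requires.\<close>

lemma hausdorff_measure_0_shift:
  assumes adm: "admissible \<omega>" and i: "i \<in> {1..m}" and t: "0 \<le> t"
    and 0: "hausdorff_measure t (fractal \<omega>) = 0"
  shows "hausdorff_measure t (fractal (shift i \<omega>)) = 0"
proof -
  have fw: "[i] \<in> finite_words m" using i by (auto simp: finite_words_def)
  have "hausdorff_measure t ((\<lambda>x. a i + label_map \<omega> [i] x) ` fractal (shift i \<omega>)) = 0"
    by (rule hausdorff_measure_0_subset[OF fractal_shift_subset[OF adm i] 0])
  then show ?thesis
    by (rule hausdorff_measure_0_similarity[OF admissibleD(3)[OF adm fw] _ t, rotated])
       (simp add: dist_label_map[OF adm fw])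
qed

text \<open>A translation and a linear left inverse undo the embedding of the subtree fractal, and
  both preserve null sets.\<close>

lemma negligible_shift:
  assumes adm: "admissible \<omega>" and i: "i \<in> {1..m}" and 0: "negligible (fractal \<omega>)"
  shows "negligible (fractal (shift i \<omega>))"
proof -
  have fw: "[i] \<in> finite_words m" using i by (auto simp: finite_words_def)
  let ?L = "label_map \<omega> [i]"
  have "inj ?L"
    using dist_label_map[OF adm fw] admissibleD(3)[OF adm fw] by (intro injI) (metis dist_eq_0_iff mult_eq_0_iff less_irrefl)
  then obtain g where g: "linear g" "g \<circ> ?L = id"
    using linear_injective_left_inverse[OF linear_label_map] by blast
  have "negligible ((\<lambda>x. a i + ?L x) ` fractal (shift i \<omega>))"
    by (rule negligible_subset[OF 0 fractal_shift_subset[OF adm i]])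
  then have "negligible ((\<lambda>x. - a i + x) ` (\<lambda>x. a i + ?L x) ` fractal (shift i \<omega>))"
    by (rule negligible_translation)
  then have "negligible (g ` (\<lambda>x. - a i + x) ` (\<lambda>x. a i + ?L x) ` fractal (shift i \<omega>))"
    by (rule negligible_differentiable_image_negligible[OF _ _ linear_imp_differentiable_on[OF g(1)], rotated]) simp
  moreover have "g ` (\<lambda>x. - a i + x) ` (\<lambda>x. a i + ?L x) ` fractal (shift i \<omega>) = fractal (shift i \<omega>)"
    using g(2) by (simp add: image_image fun_eq_iff)
  ultimately show ?thesis by simp
qed

end

section \<open>The probability space of labels\<close>

lemma continuous_on_matrix_vector_Pair:
  "continuous_on UNIV (\<lambda>p. fst p *v snd p :: real^'m)"
  unfolding matrix_vector_mult_def by (intro continuous_intros)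

lemma borel_measurable_matrix_vector_mult [measurable (raw)]:
  fixes A :: "'a \<Rightarrow> real^'n^'m"
  assumes "A \<in> borel_measurable N" "x \<in> borel_measurable N"
  shows "(\<lambda>\<omega>. A \<omega> *v x \<omega>) \<in> borel_measurable N"
  by (rule borel_measurable_continuous_Pair[OF assms continuous_on_matrix_vector_Pair])

locale random_ifs = ifs m a lo hi
  for m :: nat and a :: "nat \<Rightarrow> real^'d" and lo hi :: real +
  fixes \<theta> :: "(real^'d^'d) measure"
  assumes haar: "haar_probability \<theta>"
begin

definition label :: "(real \<times> (real^'d^'d)) measure" where
  "label = ratio_law lo hi \<Otimes>\<^sub>M \<theta>"

definition space_lab :: "'d labelling measure" where
  "space_lab = label_space m lo hi \<theta>"

lemma space_lab_PiM: "space_lab = PiM (finite_words m) (\<lambda>_. label)"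
  by (simp add: space_lab_def label_space_def label_def)

lemma prob_space_ratio: "prob_space (ratio_law lo hi)"
proof -
  have 1: "emeasure lborel {lo<..<hi} \<noteq> 0" "emeasure lborel {lo<..<hi} \<noteq> \<infinity>" using lo_hi by auto
  have "prob_space (uniform_measure lborel {lo<..<hi})"
    using 1 by (intro prob_space_uniform_measure) auto
  moreover have "emeasure (uniform_measure lborel {lo<..<hi}) {lo<..<hi} = 1"
    using 1 by (subst emeasure_uniform_measure) (use lo_hi in \<open>auto simp: divide_ennreal\<close>)
  ultimately show ?thesis
    unfolding ratio_law_def by (intro prob_space_restrict_space) auto
qed

lemma prob_space_theta: "prob_space \<theta>"
  using haar by (simp add: haar_probability_def)

lemma sets_theta: "sets \<theta> = sets (restrict_space borel orthogonal_group)"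
  using haar by (simp add: haar_probability_def)

lemma space_theta: "space \<theta> = orthogonal_group"
  using sets_eq_imp_space_eq[OF sets_theta] by (simp add: space_restrict_space)

lemma space_ratio: "space (ratio_law lo hi) = {lo<..<hi}"
  by (simp add: ratio_law_def space_restrict_space)

lemma space_label: "space label = {lo<..<hi} \<times> orthogonal_group"
  by (simp add: label_def space_pair_measure space_theta space_ratio)

sublocale label: prob_space label
proof -
  interpret r: prob_space "ratio_law lo hi" by (rule prob_space_ratio)
  interpret t: prob_space \<theta> by (rule prob_space_theta)
  interpret rt: pair_prob_space "ratio_law lo hi" \<theta> ..
  show "prob_space label" unfolding label_def by (rule rt.prob_space_axioms)
qed

sublocale lab: prob_space space_lab
  unfolding space_lab_PiM by (intro prob_space_PiM label.prob_space_axioms)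

lemma measurable_ratio [measurable]: "(\<lambda>x. x) \<in> borel_measurable (ratio_law lo hi)"
  unfolding ratio_law_def by (intro measurable_restrict_space1) simp

lemma measurable_theta [measurable]: "(\<lambda>x. x) \<in> borel_measurable \<theta>"
  unfolding measurable_cong_sets[OF sets_theta refl] by (intro measurable_restrict_space1) simp

lemma measurable_fst_label [measurable]: "fst \<in> borel_measurable label"
  using measurable_compose[OF measurable_fst measurable_ratio, of \<theta>] by (simp add: label_def)

lemma measurable_snd_label [measurable]: "snd \<in> borel_measurable label"
  using measurable_compose[OF measurable_snd measurable_theta, of "ratio_law lo hi"] by (simp add: label_def)

lemma admissible_space: "\<omega> \<in> space space_lab \<Longrightarrow> admissible \<omega>"
  by (auto simp: space_lab_PiM space_PiM PiE_iff space_label admissible_def orthogonal_group_def split: prod.splits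
      dest!: bspec)

lemma singleton_word: "i \<in> {1..m} \<Longrightarrow> [i] \<in> finite_words m"
  by (auto simp: finite_words_def)

lemma measurable_coordinate [measurable (raw)]:
  "w \<in> finite_words m \<Longrightarrow> (\<lambda>\<omega>. \<omega> w) \<in> measurable space_lab label"
  unfolding space_lab_PiM by (rule measurable_component_singleton)

lemma Cons_finite_word: "i \<in> {1..m} \<Longrightarrow> w \<in> finite_words m \<Longrightarrow> i # w \<in> finite_words m"
  by (auto simp: finite_words_def)

section \<open>Subtrees: invariance of the law, independence and resampling\<close>

lemma measurable_shift [measurable (raw)]:
  "i \<in> {1..m} \<Longrightarrow> shift i \<in> measurable space_lab space_lab"
  unfolding label_shift_def space_lab_PiM
  by (intro measurable_restrict measurable_component_singleton Cons_finite_word)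

text \<open>Prepending a symbol maps the index set injectively into itself, and all factors of the
  product coincide.\<close>

lemma distr_shift: "i \<in> {1..m} \<Longrightarrow> distr space_lab space_lab (shift i) = space_lab"
  unfolding label_shift_def space_lab_PiM
  using distr_PiM_reindex[of "finite_words m" "\<lambda>_. label" "(#) i" "finite_words m"]
    label.prob_space_axioms Cons_finite_word by auto

lemma nn_integral_shift:
  assumes "i \<in> {1..m}" "f \<in> borel_measurable space_lab"
  shows "(\<integral>\<^sup>+\<omega>. f (shift i \<omega>) \<partial>space_lab) = (\<integral>\<^sup>+\<omega>. f \<omega> \<partial>space_lab)"
proof -
  have "(\<integral>\<^sup>+\<omega>. f \<omega> \<partial>space_lab) = (\<integral>\<^sup>+\<omega>. f \<omega> \<partial>distr space_lab space_lab (shift i))"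
    by (simp add: distr_shift[OF assms(1)])
  also have "\<dots> = (\<integral>\<^sup>+\<omega>. f (shift i \<omega>) \<partial>space_lab)"
    using assms by (intro nn_integral_distr) measurable
  finally show ?thesis ..
qed

lemma distr_coordinate: "w \<in> finite_words m \<Longrightarrow> distr space_lab label (\<lambda>\<omega>. \<omega> w) = label"
  unfolding space_lab_PiM by (rule distr_PiM_component) (auto intro: label.prob_space_axioms)

lemma indep_coordinates: "lab.indep_vars (\<lambda>_. label) (\<lambda>w \<omega>. \<omega> w) (finite_words m)"
proof -
  have ne: "finite_words m \<noteq> {}" using singleton_word[of 1] m_pos by auto
  have "distr space_lab (PiM (finite_words m) (\<lambda>_. label)) (\<lambda>\<omega>. \<lambda>w\<in>finite_words m. \<omega> w)
      = distr space_lab space_lab (\<lambda>\<omega>. \<omega>)"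
    by (intro distr_cong) (auto simp: space_lab_PiM space_PiM PiE_restrict)
  also have "\<dots> = PiM (finite_words m) (\<lambda>w. distr space_lab label (\<lambda>\<omega>. \<omega> w))"
    by (simp add: distr_coordinate space_lab_PiM[symmetric] cong: PiM_cong)
  finally show ?thesis
    using ne by (subst lab.indep_vars_iff_distr_eq_PiM') auto
qed

text \<open>The two subtrees read disjoint sets of coordinates, namely words with different first
  symbols.\<close>

lemma indep_shifts:
  assumes "i \<in> {1..m}" "j \<in> {1..m}" "i \<noteq> j"
  shows "lab.indep_var space_lab (shift i) space_lab (shift j)"
proof -
  let ?A = "\<lambda>i. (#) i ` finite_words m"
  let ?f = "\<lambda>i X. \<lambda>w\<in>finite_words m. X (i # w)"
  have "lab.indep_var (PiM (?A i) (\<lambda>_. label)) (\<lambda>\<omega>. restrict (\<lambda>w. \<omega> w) (?A i))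
      (PiM (?A j) (\<lambda>_. label)) (\<lambda>\<omega>. restrict (\<lambda>w. \<omega> w) (?A j))"
    using assms Cons_finite_word by (intro lab.indep_var_restrict[OF indep_coordinates]) auto
  then have "lab.indep_var space_lab (?f i \<circ> (\<lambda>\<omega>. restrict (\<lambda>w. \<omega> w) (?A i)))
      space_lab (?f j \<circ> (\<lambda>\<omega>. restrict (\<lambda>w. \<omega> w) (?A j)))"
    by (rule lab.indep_var_compose)
       (auto simp: space_lab_PiM intro!: measurable_restrict measurable_component_singleton)
  moreover have "?f i \<circ> (\<lambda>\<omega>. restrict (\<lambda>w. \<omega> w) (?A i)) = shift i" for i
    by (auto simp: label_shift_def fun_eq_iff)
  ultimately show ?thesis by simp
qed

lemma distr_shifts:
  assumes "i \<in> {1..m}" "j \<in> {1..m}" "i \<noteq> j"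
  shows "distr space_lab (space_lab \<Otimes>\<^sub>M space_lab) (\<lambda>\<omega>. (shift i \<omega>, shift j \<omega>)) = space_lab \<Otimes>\<^sub>M space_lab"
  using indep_shifts[OF assms]
  unfolding lab.indep_var_distribution_eq distr_shift[OF assms(1)] distr_shift[OF assms(2)]
  by (elim conjE) (rule sym)

lemma nn_integral_shifts:
  assumes ij: "i \<in> {1..m}" "j \<in> {1..m}" "i \<noteq> j"
    and [measurable]: "f \<in> borel_measurable space_lab" "g \<in> borel_measurable space_lab"
  shows "(\<integral>\<^sup>+\<omega>. f (shift i \<omega>) * g (shift j \<omega>) \<partial>space_lab)
    = (\<integral>\<^sup>+\<omega>. f \<omega> \<partial>space_lab) * (\<integral>\<^sup>+\<omega>. g \<omega> \<partial>space_lab)"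
proof -
  have [measurable]: "shift i \<in> measurable space_lab space_lab" "shift j \<in> measurable space_lab space_lab"
    using ij by (auto intro: measurable_shift)
  have "(\<integral>\<^sup>+\<omega>. f (shift i \<omega>) * g (shift j \<omega>) \<partial>space_lab)
      = (\<integral>\<^sup>+p. f (fst p) * g (snd p) \<partial>distr space_lab (space_lab \<Otimes>\<^sub>M space_lab) (\<lambda>\<omega>. (shift i \<omega>, shift j \<omega>)))"
    by (subst nn_integral_distr) auto
  also have "\<dots> = (\<integral>\<^sup>+x. \<integral>\<^sup>+y. f x * g y \<partial>space_lab \<partial>space_lab)"
    unfolding distr_shifts[OF ij] by (subst lab.nn_integral_fst[symmetric]) auto
  also have "\<dots> = (\<integral>\<^sup>+\<omega>. f \<omega> \<partial>space_lab) * (\<integral>\<^sup>+\<omega>. g \<omega> \<partial>space_lab)"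
    by (simp add: nn_integral_cmult nn_integral_multc)
  finally show ?thesis .
qed

text \<open>Fubini in the single coordinate \<open>w\<close>: since \<open>f l\<close> ignores that
  coordinate, the label found there may be replaced by an independent copy.\<close>

lemma nn_integral_resample:
  fixes f :: "real \<times> (real^'d^'d) \<Rightarrow> 'd labelling \<Rightarrow> ennreal"
  assumes w: "w \<in> finite_words m"
    and f[measurable]: "case_prod f \<in> borel_measurable (label \<Otimes>\<^sub>M space_lab)"
    and indep: "\<And>l x \<omega>. f l (fun_upd \<omega> w x) = f l \<omega>"
  shows "(\<integral>\<^sup>+\<omega>. f (\<omega> w) \<omega> \<partial>space_lab) = (\<integral>\<^sup>+\<omega>. \<integral>\<^sup>+l. f l \<omega> \<partial>label \<partial>space_lab)"
proof -
  define I where "I = finite_words m - {w}"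
  have ins: "insert w I = finite_words m" using w by (auto simp: I_def)
  let ?P = "PiM I (\<lambda>_. label)"
  interpret P: prob_space ?P by (intro prob_space_PiM label.prob_space_axioms)
  interpret LP: pair_sigma_finite label ?P ..
  interpret LM: pair_sigma_finite label space_lab ..
  have D: "distr (label \<Otimes>\<^sub>M ?P) space_lab (\<lambda>(x, X). fun_upd X w x) = space_lab"
    using distr_pair_PiM_eq_PiM[of I "\<lambda>_. label" w] label.prob_space_axioms by (simp add: ins space_lab_PiM)
  have [measurable]: "(\<lambda>(x, X). fun_upd X w x) \<in> measurable (label \<Otimes>\<^sub>M ?P) space_lab"
    using measurable_add_dim[of w I "\<lambda>_. label"] unfolding ins space_lab_PiM
    by (subst measurable_pair_swap_iff) (simp add: case_prod_unfold)
  have [measurable]: "(\<lambda>\<omega>. \<omega> w) \<in> measurable space_lab label" by (rule measurable_coordinate[OF w])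
  have split: "(\<integral>\<^sup>+\<omega>. g \<omega> \<partial>space_lab) = (\<integral>\<^sup>+X. \<integral>\<^sup>+x. g (fun_upd X w x) \<partial>label \<partial>?P)"
    if [measurable]: "g \<in> borel_measurable space_lab" for g
  proof -
    have "(\<integral>\<^sup>+\<omega>. g \<omega> \<partial>space_lab) = (\<integral>\<^sup>+\<omega>. g \<omega> \<partial>distr (label \<Otimes>\<^sub>M ?P) space_lab (\<lambda>(x, X). fun_upd X w x))"
      by (simp add: D)
    also have "\<dots> = (\<integral>\<^sup>+p. g (fun_upd (snd p) w (fst p)) \<partial>(label \<Otimes>\<^sub>M ?P))"
      by (subst nn_integral_distr) (auto simp: case_prod_unfold)
    also have "\<dots> = (\<integral>\<^sup>+X. \<integral>\<^sup>+x. g (fun_upd X w x) \<partial>label \<partial>?P)"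
      by (subst LP.nn_integral_snd[symmetric]) (auto simp: case_prod_unfold)
    finally show ?thesis .
  qed
  have m1: "(\<lambda>\<omega>. f (\<omega> w) \<omega>) \<in> borel_measurable space_lab"
    using measurable_compose[of "\<lambda>\<omega>. (\<omega> w, \<omega>)" space_lab "label \<Otimes>\<^sub>M space_lab" "case_prod f" borel] by simp
  have m2: "(\<lambda>\<omega>. \<integral>\<^sup>+l. f l \<omega> \<partial>label) \<in> borel_measurable space_lab"
    by measurable
  show ?thesis
    unfolding split[OF m1] split[OF m2]
    by (simp add: indep label.emeasure_space_1)
qed

text \<open>Subtrees read only words of length at least 2. A first-generation label is thus
  invisible to all of them, including the subtree below its own symbol, and can be resampled with
  every subtree held fixed.\<close>

lemma shift_upd: "shift j (fun_upd \<omega> [i] l) = shift j \<omega>"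
  by (auto simp: label_shift_def fun_eq_iff finite_words_def)

section \<open>Measurability of points and weights\<close>

lemma measurable_label_map:
  assumes "w \<in> finite_words m" "f \<in> borel_measurable space_lab"
  shows "(\<lambda>\<omega>. label_map \<omega> w (f \<omega>)) \<in> borel_measurable space_lab"
proof -
  have [measurable]: "(\<lambda>\<omega>. \<omega> w) \<in> measurable space_lab label" by (rule measurable_coordinate[OF assms(1)])
  note assms(2)[measurable]
  show ?thesis unfolding label_map_def by measurable
qed

lemma measurable_path_map:
  assumes "j \<in> infinite_words m" "f \<in> borel_measurable space_lab"
  shows "(\<lambda>\<omega>. path_map \<omega> j k (f \<omega>)) \<in> borel_measurable space_lab"
  using assms(2)
proof (induction k arbitrary: f)
  case (Suc k)
  then show ?case
    using Suc.IH[OF measurable_label_map[OF map_finite_words[OF assms(1), of k] Suc.prems]] by (simp del: upt_Suc)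
qed simp

lemma measurable_projection:
  assumes "j \<in> infinite_words m"
  shows "projection a j \<in> borel_measurable space_lab"
proof -
  have "(\<lambda>\<omega>. \<Sum>k\<le>n. path_map \<omega> j k (a (j k))) \<in> borel_measurable space_lab" for n
    by (intro borel_measurable_sum measurable_path_map[OF assms] borel_measurable_const)
  then have "(\<lambda>\<omega>. lim (\<lambda>n. \<Sum>k\<le>n. path_map \<omega> j k (a (j k)))) \<in> borel_measurable space_lab"
    by (rule borel_measurable_lim_metric)
  then show ?thesis unfolding projection_def[abs_def] by simp
qed

lemma measurable_pt: "set w \<subseteq> {1..m} \<Longrightarrow> pt w \<in> borel_measurable space_lab"
  by (intro measurable_projection extend_word_infinite)

lemma measurable_wt: "set w \<subseteq> {1..m} \<Longrightarrow> wt t w \<in> borel_measurable space_lab"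
proof (induction w)
  case Nil
  have "wt t [] = (\<lambda>_. 1)" by auto
  then show ?case by simp
next
  case (Cons i w)
  then have [measurable]: "wt t w \<in> borel_measurable space_lab" "shift i \<in> measurable space_lab space_lab"
    "(\<lambda>\<omega>. \<omega> [i]) \<in> measurable space_lab label"
    using measurable_shift[of i] measurable_coordinate[OF singleton_word[of i]] by auto
  have "wt t (i # w) = (\<lambda>\<omega>. fst (\<omega> [i]) powr t * wt t w (shift i \<omega>))" by auto
  then show ?case by simp
qed

section \<open>Moments of the contraction ratio\<close>

definition moment :: "real \<Rightarrow> real" where
  "moment t = (\<integral>l. fst l powr t \<partial>label)"

lemma label_bounds:
  assumes "l \<in> space label" shows "lo < fst l" "fst l < hi" "0 < fst l" "fst l < 1"
  using assms lo_pos hi_1 by (auto simp: space_label)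

lemma integrable_moment: "integrable label (\<lambda>l. fst l powr t)"
proof (rule label.integrable_const_bound[where B="lo powr t + hi powr t"])
  have "fst l powr t \<le> lo powr t + hi powr t" if "l \<in> space label" for l
  proof (cases "0 \<le> t")
    case True
    have "fst l powr t \<le> hi powr t" using label_bounds[OF that] True by (intro powr_mono2) auto
    then show ?thesis by (simp add: add_increasing)
  next
    case False
    have "fst l powr t \<le> lo powr t" using label_bounds[OF that] False lo_pos by (intro powr_mono2') auto
    then show ?thesis by (simp add: add_increasing2)
  qed
  then show "AE l in label. norm (fst l powr t) \<le> lo powr t + hi powr t" by auto
qed measurable

lemma moment_nonneg: "0 \<le> moment t"
  unfolding moment_def by simp

lemma nn_integral_moment: "(\<integral>\<^sup>+l. ennreal (fst l powr t) \<partial>label) = ennreal (moment t)"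
  unfolding moment_def by (intro nn_integral_eq_integral integrable_moment) simp

text \<open>Ratios stay below \<open>hi < 1\<close>, so raising the exponent gains a power of
  \<open>hi\<close>. This puts \<open>real m * moment t\<close> strictly above 1 for t < s and
  strictly below 1 for t > s.\<close>

lemma moment_le:
  assumes "u \<le> t" shows "moment t \<le> hi powr (t - u) * moment u"
proof -
  have "moment t \<le> (\<integral>l. hi powr (t - u) * fst l powr u \<partial>label)"
    unfolding moment_def
  proof (intro integral_mono_AE AE_I2)
    fix l assume l: "l \<in> space label"
    have "fst l powr t = fst l powr (t - u) * fst l powr u" by (simp add: powr_add[symmetric])
    also have "\<dots> \<le> hi powr (t - u) * fst l powr u"
      using label_bounds[OF l] assms by (intro mult_right_mono powr_mono2) auto
    finally show "fst l powr t \<le> hi powr (t - u) * fst l powr u" .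
  qed (auto intro: integrable_moment)
  then show ?thesis by (simp add: moment_def)
qed

lemma moment_0: "moment 0 = 1"
proof -
  \<comment> \<open>Positivity of the ratio matters here, because \<open>0 powr 0\<close> is
    0.\<close>
  have "moment 0 = (\<integral>l. 1 \<partial>label)"
    unfolding moment_def by (intro Bochner_Integration.integral_cong) (auto dest: label_bounds(3))
  then show ?thesis by (simp add: label.prob_space)
qed

text \<open>All first-generation labels have the law \<open>label\<close>. The defining equation of
  s thereby becomes \<open>real m * moment s = 1\<close>.\<close>

lemma integral_sum_ratios:
  "(\<integral>\<omega>. (\<Sum>i = 1..m. fst (\<omega> [i]) powr t) \<partial>space_lab) = real m * moment t"
proof -
  have "integrable space_lab (\<lambda>\<omega>. fst (\<omega> [i]) powr t)"
    and "(\<integral>\<omega>. fst (\<omega> [i]) powr t \<partial>space_lab) = moment t" if i: "i \<in> {1..m}" for i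
  proof -
    have D: "distr space_lab label (\<lambda>\<omega>. \<omega> [i]) = label" by (rule distr_coordinate[OF singleton_word[OF i]])
    have [measurable]: "(\<lambda>\<omega>. \<omega> [i]) \<in> measurable space_lab label" by (rule measurable_coordinate[OF singleton_word[OF i]])
    show "integrable space_lab (\<lambda>\<omega>. fst (\<omega> [i]) powr t)"
      using integrable_moment[of t] by (subst (asm) D[symmetric], subst (asm) integrable_distr_eq) auto
    have "moment t = (\<integral>l. fst l powr t \<partial>distr space_lab label (\<lambda>\<omega>. \<omega> [i]))"
      unfolding moment_def D ..
    then show "(\<integral>\<omega>. fst (\<omega> [i]) powr t \<partial>space_lab) = moment t"
      by (simp add: integral_distr)
  qed
  then show ?thesis by (subst Bochner_Integration.integral_sum) auto
qed

text \<open>The first ratio is independent of the subtree, whose law is that of the whole tree, so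
  each symbol contributes one factor \<open>moment t\<close>.\<close>

lemma nn_integral_wt:
  "set w \<subseteq> {1..m} \<Longrightarrow> (\<integral>\<^sup>+\<omega>. ennreal (wt t w \<omega>) \<partial>space_lab) = ennreal (moment t ^ length w)"
proof (induction w)
  case Nil
  then show ?case by (simp add: lab.emeasure_space_1)
next
  case (Cons i w)
  then have i: "i \<in> {1..m}" and w: "set w \<subseteq> {1..m}" by auto
  note [measurable] = measurable_shift[OF i] measurable_wt[OF w]
  have "(\<integral>\<^sup>+\<omega>. ennreal (wt t (i # w) \<omega>) \<partial>space_lab)
      = (\<integral>\<^sup>+\<omega>. (\<lambda>l \<omega>. ennreal (fst l powr t) * ennreal (wt t w (shift i \<omega>))) (\<omega> [i]) \<omega> \<partial>space_lab)"
    by (simp add: ennreal_mult')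
  also have "\<dots> = (\<integral>\<^sup>+\<omega>. \<integral>\<^sup>+l. ennreal (fst l powr t) * ennreal (wt t w (shift i \<omega>)) \<partial>label \<partial>space_lab)"
    by (rule nn_integral_resample[OF singleton_word[OF i]]) (measurable, simp only: shift_upd)
  also have "\<dots> = ennreal (moment t) * (\<integral>\<^sup>+\<omega>. ennreal (wt t w (shift i \<omega>)) \<partial>space_lab)"
    by (simp add: nn_integral_multc nn_integral_cmult nn_integral_moment)
  also have "(\<integral>\<^sup>+\<omega>. ennreal (wt t w (shift i \<omega>)) \<partial>space_lab) = (\<integral>\<^sup>+\<omega>. ennreal (wt t w \<omega>) \<partial>space_lab)"
    by (rule nn_integral_shift[OF i]) measurable
  finally show ?case using Cons.IH[OF w] moment_nonneg by (simp add: ennreal_mult)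
qed

lemma nn_integral_sum_wt:
  "(\<integral>\<^sup>+\<omega>. ennreal (\<Sum>w\<in>words m k. wt t w \<omega>) \<partial>space_lab) = ennreal ((real m * moment t) ^ k)"
proof -
  have set: "set w \<subseteq> {1..m}" "length w = k" if "w \<in> words m k" for w using that by (auto simp: words_def)
  have "(\<integral>\<^sup>+\<omega>. ennreal (\<Sum>w\<in>words m k. wt t w \<omega>) \<partial>space_lab) = (\<integral>\<^sup>+\<omega>. (\<Sum>w\<in>words m k. ennreal (wt t w \<omega>)) \<partial>space_lab)"
    using wt_pos[OF admissible_space set(1)]
    by (intro nn_integral_cong sum_ennreal[symmetric]) (auto simp: less_imp_le)
  also have "\<dots> = (\<Sum>w\<in>words m k. ennreal (moment t ^ k))"
    using measurable_wt[OF set(1)] set by (subst nn_integral_sum) (auto simp: nn_integral_wt)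
  also have "\<dots> = ennreal ((real m * moment t) ^ k)"
    using moment_nonneg by (simp add: card_words power_mult_distrib ennreal_mult ennreal_of_nat_eq_real_of_nat flip: of_nat_power)
  finally show ?thesis .
qed

end

section \<open>Transversality\<close>

definition similarity :: "real \<times> (real^'d^'d) \<Rightarrow> real^'d \<Rightarrow> real^'d" where
  "similarity l x = fst l *\<^sub>R (snd l *v x)"

lemma label_map_eq_similarity: "label_map \<omega> w x = similarity (\<omega> w) x"
  by (simp add: label_map_def similarity_def)

lemma measurable_indicator_cball:
  fixes f :: "'a \<Rightarrow> real^'d"
  assumes "f \<in> borel_measurable N"
  shows "(\<lambda>x. indicator (cball c \<rho>) (f x) :: ennreal) \<in> borel_measurable N"
proof -
  have "(indicator (cball c \<rho>) :: real^'d \<Rightarrow> ennreal) \<in> borel_measurable borel"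
    by (intro borel_measurable_indicator borel_closed closed_cball)
  from measurable_compose[OF assms this] show ?thesis .
qed

text \<open>A difference of two ball volumes, estimated by (c + \<rho>)^n \<ge> c^(n-1) (c +
  \<rho>).\<close>

lemma emeasure_shell_ge:
  fixes c \<rho> :: real
  assumes "0 < c" "0 < \<rho>"
  shows "ennreal (unit_ball_vol (real DIM('a)) * c ^ (DIM('a) - 1) * \<rho>)
    \<le> emeasure lborel {y :: 'a::euclidean_space. c \<le> norm y \<and> norm y \<le> c + \<rho>}"
proof -
  let ?v = "unit_ball_vol (real DIM('a))" and ?n = "DIM('a)"
  have "{y :: 'a. c \<le> norm y \<and> norm y \<le> c + \<rho>} = cball 0 (c + \<rho>) - ball 0 c" by auto
  moreover have "emeasure lborel (cball 0 (c + \<rho>) - ball 0 c :: 'a set)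
      = emeasure lborel (cball 0 (c + \<rho>) :: 'a set) - emeasure lborel (ball 0 c :: 'a set)"
    using assms by (intro emeasure_Diff) (auto simp: emeasure_ball)
  ultimately have "emeasure lborel {y :: 'a. c \<le> norm y \<and> norm y \<le> c + \<rho>}
      = emeasure lborel (cball 0 (c + \<rho>) :: 'a set) - emeasure lborel (ball 0 c :: 'a set)"
    by simp
  also have "\<dots> = ennreal (?v * (c + \<rho>) ^ ?n - ?v * c ^ ?n)"
    using assms by (simp add: emeasure_ball emeasure_cball ennreal_minus)
  finally have eq: "emeasure lborel {y :: 'a. c \<le> norm y \<and> norm y \<le> c + \<rho>} = ennreal (?v * (c + \<rho>) ^ ?n - ?v * c ^ ?n)" .
  obtain k where k: "?n = Suc k" using DIM_positive[where 'a='a] gr0_conv_Suc by blast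
  have "c ^ k * (c + \<rho>) \<le> (c + \<rho>) ^ k * (c + \<rho>)"
    using assms by (intro mult_right_mono power_mono) auto
  then have "c ^ (?n - 1) * \<rho> \<le> (c + \<rho>) ^ ?n - c ^ ?n"
    unfolding k by (simp add: algebra_simps)
  then have "?v * (c ^ (?n - 1) * \<rho>) \<le> ?v * ((c + \<rho>) ^ ?n - c ^ ?n)"
    by (rule mult_left_mono) simp
  then show ?thesis unfolding eq by (intro ennreal_leI) (simp add: algebra_simps)
qed

lemma rotation_exists:
  fixes x y :: "real^'d"
  assumes "norm x = norm y"
  obtains R where "orthogonal_matrix R" "R *v x = y"
proof -
  obtain f where f: "orthogonal_transformation f" "f x = y"
    using orthogonal_transformation_exists[OF assms] by blast
  then have "orthogonal_matrix (matrix f)" "matrix f *v x = y"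
    by (auto simp: orthogonal_transformation_matrix matrix_works)
  then show ?thesis by (rule that)
qed

section \<open>The law of a randomly scaled and rotated point\<close>

context random_ifs
begin

lemma measurable_similarity [measurable (raw)]:
  assumes [measurable]: "f \<in> measurable N label" "g \<in> borel_measurable N"
  shows "(\<lambda>x. similarity (f x) (g x)) \<in> borel_measurable N"
  unfolding similarity_def by measurable

lemma norm_similarity:
  assumes "l \<in> space label" shows "norm (similarity l x) = fst l * norm x"
proof -
  have "orthogonal_transformation ((*v) (snd l))"
    using assms by (auto simp: space_label orthogonal_group_def orthogonal_transformation_matrix)
  then have "norm (snd l *v x) = norm x" by (rule orthogonal_transformation_norm)
  then show ?thesis using label_bounds[OF assms] by (simp add: similarity_def)
qed

lemma measurable_left_mult:
  assumes "orthogonal_matrix R" shows "(\<lambda>Q. R ** Q) \<in> measurable \<theta> \<theta>"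
proof -
  have "continuous_on UNIV (\<lambda>Q. R ** Q)"
    unfolding matrix_matrix_mult_def by (intro continuous_intros)
  then have "(\<lambda>Q. R ** Q) \<in> borel_measurable borel" by (rule borel_measurable_continuous_onI)
  from measurable_compose[OF measurable_theta this]
  have "(\<lambda>Q. R ** Q) \<in> measurable \<theta> (restrict_space borel orthogonal_group)"
    using assms by (intro measurable_restrict_space2)
      (auto simp: space_theta orthogonal_group_def orthogonal_matrix_mul)
  then show ?thesis unfolding measurable_cong_sets[OF refl sets_theta] .
qed

definition hit :: "real^'d \<Rightarrow> real \<Rightarrow> real^'d \<Rightarrow> ennreal" where
  "hit x \<rho> c = (\<integral>\<^sup>+l. indicator (cball c \<rho>) (similarity l x) \<partial>label)"

lemma hit_mono: "cball c \<rho> \<subseteq> cball c' \<rho>' \<Longrightarrow> hit x \<rho> c \<le> hit x \<rho>' c'"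
  unfolding hit_def by (intro nn_integral_mono) (auto simp: indicator_def)

lemma hit_le_1: "hit x \<rho> c \<le> 1"
proof -
  have "hit x \<rho> c \<le> (\<integral>\<^sup>+l. 1 \<partial>label)"
    unfolding hit_def by (intro nn_integral_mono) (auto simp: indicator_def)
  then show ?thesis by (simp add: label.emeasure_space_1)
qed

text \<open>For each fixed ratio, left invariance of \<open>\<theta>\<close> absorbs the rotation of
  the centre. Hence hitting probabilities depend on the centre only through its norm.\<close>

lemma hit_rotate:
  assumes R: "orthogonal_matrix R" shows "hit x \<rho> (R *v c) = hit x \<rho> c"
proof -
  interpret t: prob_space \<theta> by (rule prob_space_theta)
  have inner: "(\<integral>\<^sup>+Q. indicator (cball (R *v c) \<rho>) (r *\<^sub>R (Q *v x)) \<partial>\<theta>)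
      = (\<integral>\<^sup>+Q. indicator (cball c \<rho>) (r *\<^sub>R (Q *v x)) \<partial>\<theta> :: ennreal)" for r
  proof -
    have D: "distr \<theta> \<theta> (\<lambda>Q. R ** Q) = \<theta>"
      using haar R by (simp add: haar_probability_def orthogonal_group_def)
    have ot: "orthogonal_transformation ((*v) R)"
      using R by (simp add: orthogonal_transformation_matrix)
    have d: "dist (R *v y) (R *v z) = dist y z" for y z
      using orthogonal_transformation_norm[OF ot, of "y - z"] by (simp add: dist_norm matrix_vector_mult_diff_distrib)
    have "(\<lambda>Q. r *\<^sub>R (Q *v x)) \<in> borel_measurable \<theta>" by measurable
    then have m: "(\<lambda>Q. indicator (cball (R *v c) \<rho>) (r *\<^sub>R (Q *v x)) :: ennreal) \<in> borel_measurable \<theta>"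
      by (rule measurable_indicator_cball)
    have "(\<integral>\<^sup>+Q. indicator (cball (R *v c) \<rho>) (r *\<^sub>R (Q *v x)) \<partial>\<theta> :: ennreal)
        = (\<integral>\<^sup>+Q. indicator (cball (R *v c) \<rho>) (r *\<^sub>R (Q *v x)) \<partial>distr \<theta> \<theta> (\<lambda>Q. R ** Q))"
      by (simp only: D)
    also have "\<dots> = (\<integral>\<^sup>+Q. indicator (cball (R *v c) \<rho>) (r *\<^sub>R ((R ** Q) *v x)) \<partial>\<theta>)"
      by (intro nn_integral_distr measurable_left_mult R) (simp add: m)
    also have "\<dots> = (\<integral>\<^sup>+Q. indicator (cball c \<rho>) (r *\<^sub>R (Q *v x)) \<partial>\<theta>)"
    proof (intro nn_integral_cong)
      fix Q
      have "r *\<^sub>R ((R ** Q) *v x) = R *v (r *\<^sub>R (Q *v x))"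
        by (simp add: matrix_vector_mul_assoc[symmetric] matrix_vector_mult_scaleR)
      then show "(indicator (cball (R *v c) \<rho>) (r *\<^sub>R ((R ** Q) *v x)) :: ennreal) = indicator (cball c \<rho>) (r *\<^sub>R (Q *v x))"
        by (simp add: indicator_def d)
    qed
    finally show ?thesis .
  qed
  have "hit x \<rho> c = (\<integral>\<^sup>+r. \<integral>\<^sup>+Q. indicator (cball c \<rho>) (r *\<^sub>R (Q *v x)) \<partial>\<theta> \<partial>ratio_law lo hi)" for c
  proof -
    have m: "(\<lambda>l. indicator (cball c \<rho>) (similarity l x) :: ennreal) \<in> borel_measurable label"
      by (intro measurable_indicator_cball measurable_similarity) auto
    show ?thesis
      unfolding hit_def label_def
      by (subst t.nn_integral_fst[symmetric]) (use m in \<open>auto simp: label_def similarity_def\<close>)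
  qed
  then show ?thesis by (simp only: inner)
qed

lemma hit_norm_cong:
  assumes "norm c = norm c'" shows "hit x \<rho> c = hit x \<rho> c'"
proof -
  obtain R where "orthogonal_matrix R" "R *v c = c'" using rotation_exists[OF assms] .
  then show ?thesis using hit_rotate[of R x \<rho> c] by simp
qed

lemma ratio_interval_le:
  assumes "\<alpha> \<le> \<beta>"
  shows "(\<integral>\<^sup>+l. indicator {\<alpha>..\<beta>} (fst l) \<partial>label) \<le> ennreal ((\<beta> - \<alpha>) / (hi - lo))"
proof -
  interpret t: prob_space \<theta> by (rule prob_space_theta)
  have m: "(\<lambda>l. indicator {\<alpha>..\<beta>} (fst l) :: ennreal) \<in> borel_measurable label" by measurable
  have "(\<integral>\<^sup>+l. indicator {\<alpha>..\<beta>} (fst l) \<partial>label) = (\<integral>\<^sup>+r. indicator {\<alpha>..\<beta>} r \<partial>ratio_law lo hi)"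
    unfolding label_def using m
    by (subst t.nn_integral_fst[symmetric]) (auto simp: label_def t.emeasure_space_1)
  also have "\<dots> = (\<integral>\<^sup>+r. indicator {\<alpha>..\<beta>} r * indicator {lo<..<hi} r \<partial>uniform_measure lborel {lo<..<hi})"
    unfolding ratio_law_def by (intro nn_integral_restrict_space) simp
  also have "\<dots> = (\<integral>\<^sup>+r. indicator {\<alpha>..\<beta>} r * indicator {lo<..<hi} r * indicator {lo<..<hi} r \<partial>lborel) / emeasure lborel {lo<..<hi}"
    by (intro nn_integral_uniform_measure) auto
  also have "\<dots> \<le> (\<integral>\<^sup>+r. indicator {\<alpha>..\<beta>} r \<partial>lborel) / emeasure lborel {lo<..<hi}"
    by (intro divide_right_mono_ennreal nn_integral_mono) (auto simp: indicator_def)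
  also have "\<dots> = ennreal ((\<beta> - \<alpha>) / (hi - lo))"
    using assms lo_hi by (simp add: divide_ennreal)
  finally show ?thesis .
qed

text \<open>The law of \<open>r Q x\<close> is rotation invariant, so the probability of hitting a ball is bounded by
  its average over all rotated balls; a thin shell of radii is added to average against Lebesgue
  measure.\<close>

lemma hit_shell_le:
  assumes c: "c \<noteq> 0" and \<rho>: "0 < \<rho>" and x: "0 < \<eta>" "\<eta> \<le> norm x"
  shows "ennreal (norm c ^ (CARD('d) - 1)) * hit x \<rho> c \<le> ennreal (5 * 2 ^ CARD('d) / (\<eta> * (hi - lo)) * \<rho> ^ CARD('d))"
proof -
  let ?d = "CARD('d)" and ?v = "unit_ball_vol (real CARD('d))"
  define S where "S = {y :: real^'d. norm c \<le> norm y \<and> norm y \<le> norm c + \<rho>}"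
  have S [measurable]: "S \<in> sets borel" unfolding S_def by measurable
  \<comment> \<open>Moving \<open>c\<close> radially to the norm of \<open>y\<close> costs at most
    \<rho>, which doubling the radius absorbs; a rotation then carries it to
    \<open>y\<close>.\<close>
  have le: "hit x \<rho> c \<le> hit x (2 * \<rho>) y" if y: "y \<in> S" for y
  proof -
    let ?c = "(norm y / norm c) *\<^sub>R c"
    have "?c - c = ((norm y - norm c) / norm c) *\<^sub>R c"
      using c by (simp add: diff_divide_distrib scaleR_left_diff_distrib)
    then have "dist ?c c \<le> \<rho>" using c y by (simp add: dist_norm S_def)
    have "z \<in> cball ?c (2 * \<rho>)" if "z \<in> cball c \<rho>" for z
      using \<open>dist ?c c \<le> \<rho>\<close> that dist_triangle[of ?c z c] by simp
    then have "hit x \<rho> c \<le> hit x (2 * \<rho>) ?c" by (intro hit_mono) blast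
    also have "\<dots> = hit x (2 * \<rho>) y" using c by (intro hit_norm_cong) simp
    finally show ?thesis .
  qed
  \<comment> \<open>Points within 2\<rho> of the shell have norms in an interval of length 5\<rho>,
    which confines the ratio to an interval of length 5\<rho>/|x|. This is the origin of the 5; the
    power of 2 comes from the volume of a ball of radius 2\<rho>.\<close>
  have near: "norm c - 2 * \<rho> \<le> norm z \<and> norm z \<le> norm c + 3 * \<rho>" if "y \<in> S" "dist y z \<le> 2 * \<rho>" for y z :: "real^'d"
    using that norm_triangle_ineq2[of y z] norm_triangle_ineq2[of z y] by (auto simp: S_def dist_norm norm_minus_commute)
  let ?A = "{(norm c - 2 * \<rho>) / norm x..(norm c + 3 * \<rho>) / norm x}"
  have x0: "0 < norm x" using x by linarith
  have nn: "0 \<le> ?v * (2 * \<rho>) ^ ?d" using \<rho> by simp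
  have "emeasure lborel S * hit x \<rho> c = (\<integral>\<^sup>+y. indicator S y * hit x \<rho> c \<partial>lborel)"
    by (simp add: nn_integral_multc)
  also have "\<dots> \<le> (\<integral>\<^sup>+y. indicator S y * hit x (2 * \<rho>) y \<partial>lborel)"
    using le by (intro nn_integral_mono) (auto simp: indicator_def)
  also have "\<dots> = (\<integral>\<^sup>+y. \<integral>\<^sup>+l. indicator S y * indicator {p. dist (fst p) (snd p) \<le> 2 * \<rho>} (y, similarity l x) \<partial>label \<partial>lborel)"
    unfolding hit_def by (intro nn_integral_cong) (subst nn_integral_cmult[symmetric], auto simp: indicator_def intro!: nn_integral_cong)
  also have "\<dots> = (\<integral>\<^sup>+l. \<integral>\<^sup>+y. indicator S y * indicator {p. dist (fst p) (snd p) \<le> 2 * \<rho>} (y, similarity l x) \<partial>lborel \<partial>label)"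
  proof -
    interpret P: pair_sigma_finite lborel label ..
    have "closed {p :: (real^'d) \<times> (real^'d). dist (fst p) (snd p) \<le> 2 * \<rho>}"
      by (intro closed_Collect_le continuous_intros)
    then have [measurable]: "{p :: (real^'d) \<times> (real^'d). dist (fst p) (snd p) \<le> 2 * \<rho>} \<in> sets (borel \<Otimes>\<^sub>M borel)"
      unfolding borel_prod by (rule borel_closed)
    show ?thesis by (rule P.Fubini'[symmetric]) measurable
  qed
  also have "\<dots> \<le> (\<integral>\<^sup>+l. ennreal (?v * (2 * \<rho>) ^ ?d) * indicator ?A (fst l) \<partial>label)"
  proof (intro nn_integral_mono)
    fix l assume l: "l \<in> space label"
    have "(\<integral>\<^sup>+y. indicator S y * indicator {p. dist (fst p) (snd p) \<le> 2 * \<rho>} (y, similarity l x) \<partial>lborel)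
        \<le> (\<integral>\<^sup>+y. indicator ?A (fst l) * indicator (cball (similarity l x) (2 * \<rho>)) y \<partial>lborel)"
    proof (intro nn_integral_mono)
      fix y
      show "indicator S y * indicator {p. dist (fst p) (snd p) \<le> 2 * \<rho>} (y, similarity l x)
          \<le> (indicator ?A (fst l) * indicator (cball (similarity l x) (2 * \<rho>)) y :: ennreal)"
        using near[of y "similarity l x"] norm_similarity[OF l, of x] x0
        by (auto simp: indicator_def dist_commute field_simps)
    qed
    also have "\<dots> = indicator ?A (fst l) * ennreal (?v * (2 * \<rho>) ^ ?d)"
      using \<rho> by (subst nn_integral_cmult_indicator) (auto simp: emeasure_cball)
    finally show "(\<integral>\<^sup>+y. indicator S y * indicator {p. dist (fst p) (snd p) \<le> 2 * \<rho>} (y, similarity l x) \<partial>lborel)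
        \<le> ennreal (?v * (2 * \<rho>) ^ ?d) * indicator ?A (fst l)" by (simp add: mult.commute)
  qed
  also have "\<dots> = ennreal (?v * (2 * \<rho>) ^ ?d) * (\<integral>\<^sup>+l. indicator ?A (fst l) \<partial>label)"
    by (rule nn_integral_cmult) measurable
  also have "\<dots> \<le> ennreal (?v * (2 * \<rho>) ^ ?d) * ennreal (((norm c + 3 * \<rho>) / norm x - (norm c - 2 * \<rho>) / norm x) / (hi - lo))"
    using x0 \<rho> by (intro mult_left_mono ratio_interval_le divide_right_mono) auto
  also have "((norm c + 3 * \<rho>) / norm x - (norm c - 2 * \<rho>) / norm x) / (hi - lo) = 5 * \<rho> / norm x / (hi - lo)"
    by (simp add: diff_divide_distrib[symmetric])
  also have "ennreal (?v * (2 * \<rho>) ^ ?d) * ennreal (5 * \<rho> / norm x / (hi - lo)) \<le> ennreal (?v * (2 * \<rho>) ^ ?d) * ennreal (5 * \<rho> / \<eta> / (hi - lo))"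
    using x x0 \<rho> lo_hi by (intro mult_left_mono ennreal_leI divide_right_mono divide_left_mono mult_pos_pos) auto
  finally have up: "emeasure lborel S * hit x \<rho> c \<le> ennreal (?v * (2 * \<rho>) ^ ?d * (5 * \<rho> / \<eta> / (hi - lo)))"
    by (simp only: ennreal_mult'[OF nn])
  have pos: "0 < ?v * \<rho>" using \<rho> by simp
  then have nz: "ennreal (?v * \<rho>) \<noteq> 0" by (simp only: ennreal_eq_0_iff not_le)
  have "ennreal (?v * norm c ^ (?d - 1) * \<rho>) \<le> emeasure lborel S"
    unfolding S_def using emeasure_shell_ge[of "norm c" \<rho>, where 'a="real^'d"] c \<rho> by simp
  then have "ennreal (?v * norm c ^ (?d - 1) * \<rho>) * hit x \<rho> c \<le> emeasure lborel S * hit x \<rho> c"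
    by (rule mult_right_mono) simp
  also note up
  also have "?v * (2 * \<rho>) ^ ?d * (5 * \<rho> / \<eta> / (hi - lo)) = (?v * \<rho>) * (5 * 2 ^ ?d / (\<eta> * (hi - lo)) * \<rho> ^ ?d)"
    by (simp add: power_mult_distrib)
  also have "ennreal (?v * norm c ^ (?d - 1) * \<rho>) = ennreal (?v * \<rho>) * ennreal (norm c ^ (?d - 1))"
    using \<rho> by (simp add: ennreal_mult'[symmetric] mult_ac)
  also have "ennreal ((?v * \<rho>) * (5 * 2 ^ ?d / (\<eta> * (hi - lo)) * \<rho> ^ ?d)) = ennreal (?v * \<rho>) * ennreal (5 * 2 ^ ?d / (\<eta> * (hi - lo)) * \<rho> ^ ?d)"
    using \<rho> by (intro ennreal_mult') auto
  finally show ?thesis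
    unfolding mult.assoc ennreal_mult_le_mult_iff[OF nz ennreal_neq_top] .
qed

text \<open>Large radii are settled by the trivial bound 1; small balls centred near 0 are never
  hit; all others have a centre of norm bounded below, where the shell estimate applies. The bound
  is uniform in the centre because the centre will be another random point.\<close>

lemma transversality:
  assumes \<eta>: "0 < \<eta>" and t: "0 \<le> t" "t \<le> real CARD('d)"
  obtains C where "0 \<le> C" "\<And>x c \<rho>. \<eta> \<le> norm x \<Longrightarrow> 0 < \<rho> \<Longrightarrow> hit x \<rho> c \<le> ennreal (C * \<rho> powr t)"
proof -
  let ?d = "CARD('d)"
  \<comment> \<open>Every image has norm at least \<open>lo * \<eta> = 2 * b\<close>, so a ball of
    radius at most \<open>b\<close> about a centre of norm below \<open>b\<close> misses it. The cap
    of \<open>\<rho>0\<close> at 1 makes \<rho>^d \<le> \<rho>^t.\<close>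
  define b where "b = lo * \<eta> / 2"
  have b: "0 < b" using lo_pos \<eta> by (simp add: b_def)
  define \<rho>0 where "\<rho>0 = min b 1"
  have \<rho>0: "0 < \<rho>0" using b by (simp add: \<rho>0_def)
  define C1 where "C1 = 5 * 2 ^ ?d / (\<eta> * (hi - lo)) / b ^ (?d - 1)"
  have C1: "0 \<le> C1" using \<eta> lo_hi b by (simp add: C1_def)
  define C where "C = max C1 (\<rho>0 powr (-t))"
  have bound: "hit x \<rho> c \<le> ennreal (C * \<rho> powr t)" if x: "\<eta> \<le> norm x" and \<rho>: "0 < \<rho>" for x c \<rho>
  proof (cases "\<rho> \<le> \<rho>0")
    case True
    show ?thesis
    proof (cases "b \<le> norm c")
      case True': True
      then have c: "c \<noteq> 0" using b by auto
      have "ennreal (b ^ (?d - 1)) * hit x \<rho> c \<le> ennreal (norm c ^ (?d - 1)) * hit x \<rho> c"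
        using True' b by (intro mult_right_mono ennreal_leI power_mono) auto
      also have "\<dots> \<le> ennreal (5 * 2 ^ ?d / (\<eta> * (hi - lo)) * \<rho> ^ ?d)"
        by (rule hit_shell_le[OF c \<rho> \<eta> x])
      also have "\<dots> = ennreal (b ^ (?d - 1) * (C1 * \<rho> ^ ?d))"
        using b by (simp add: C1_def)
      also have "\<dots> = ennreal (b ^ (?d - 1)) * ennreal (C1 * \<rho> ^ ?d)"
        using b by (intro ennreal_mult') auto
      finally have "hit x \<rho> c \<le> ennreal (C1 * \<rho> ^ ?d)"
        using b by (subst (asm) ennreal_mult_le_mult_iff) auto
      also have "\<dots> \<le> ennreal (C * \<rho> powr t)"
      proof (intro ennreal_leI mult_mono)
        have "\<rho> powr real ?d \<le> \<rho> powr t"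
          using True \<rho> t by (intro powr_mono') (auto simp: \<rho>0_def)
        then show "\<rho> ^ ?d \<le> \<rho> powr t" using \<rho> by (simp add: powr_realpow)
      qed (use C1 \<rho> in \<open>auto simp: C_def\<close>)
      finally show ?thesis .
    next
      case False
      have "(indicator (cball c \<rho>) (similarity l x) :: ennreal) = 0" if l: "l \<in> space label" for l
      proof -
        have "2 * b \<le> lo * norm x" using x lo_pos by (simp add: b_def)
        also have "\<dots> \<le> fst l * norm x" using label_bounds[OF l] by (intro mult_right_mono) auto
        also have "\<dots> = norm (similarity l x)" by (simp add: norm_similarity[OF l])
        finally have "\<rho> < dist c (similarity l x)"
          using True False norm_triangle_ineq2[of "similarity l x" c] by (auto simp: \<rho>0_def dist_norm norm_minus_commute)
        then show ?thesis by simp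
      qed
      then have "hit x \<rho> c = (\<integral>\<^sup>+l. 0 \<partial>label)" unfolding hit_def by (intro nn_integral_cong)
      then show ?thesis by simp
    qed
  next
    case False
    have "1 \<le> (\<rho> / \<rho>0) powr t" using False \<rho>0 t by (intro ge_one_powr_ge_zero) auto
    also have "\<dots> = \<rho>0 powr (-t) * \<rho> powr t" using \<rho> \<rho>0 by (simp add: powr_divide powr_minus field_simps)
    also have "\<dots> \<le> C * \<rho> powr t" by (intro mult_right_mono) (auto simp: C_def)
    finally have "ennreal 1 \<le> ennreal (C * \<rho> powr t)" by (rule ennreal_leI)
    then show ?thesis using order_trans[OF hit_le_1] by (simp only: ennreal_1)
  qed
  show ?thesis by (rule that[OF _ bound]) (use C1 in \<open>auto simp: C_def\<close>)
qed

end

section \<open>Pair counts\<close>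

text \<open>Paley-Zygmund and Markov in one pointwise inequality. After integration, 1/B - 1/(4B) -
  1/(8B) - 1/(2B) = 1/(8B) is left for the event, a bound that involves neither \<open>W\<close> nor
  \<open>Y\<close> otherwise.\<close>

lemma (in prob_space) second_moment_event:
  fixes W Y :: "'a \<Rightarrow> real"
  assumes [measurable]: "W \<in> borel_measurable M" "Y \<in> borel_measurable M"
    and nn: "\<And>x. x \<in> space M \<Longrightarrow> 0 \<le> W x" "\<And>x. x \<in> space M \<Longrightarrow> 0 \<le> Y x"
    and W: "(\<integral>\<^sup>+x. ennreal (W x) \<partial>M) = 1"
    and W2: "(\<integral>\<^sup>+x. ennreal ((W x)\<^sup>2) \<partial>M) \<le> ennreal B"
    and Y: "(\<integral>\<^sup>+x. ennreal (Y x) \<partial>M) \<le> ennreal E"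
    and pos: "0 < B" "0 < E"
  shows "1 / (8 * B) \<le> prob {x\<in>space M. 1/2 \<le> W x \<and> Y x \<le> 8 * B * E}"
proof -
  let ?G = "{x\<in>space M. 1/2 \<le> W x \<and> Y x \<le> 8 * B * E}"
  have G: "?G \<in> events" by measurable
  have pt: "W x / B \<le> indicator ?G x + (W x)\<^sup>2 / (4 * B\<^sup>2) + Y x / (8 * B * E) + 1 / (2 * B)"
    if x: "x \<in> space M" for x
  proof -
    have "0 \<le> (W x / (2 * B) - 1)\<^sup>2" by simp
    also have "\<dots> = 1 + (W x)\<^sup>2 / (4 * B\<^sup>2) - W x / B"
      using pos by (simp add: power2_eq_square field_simps)
    finally have sq: "W x / B \<le> 1 + (W x)\<^sup>2 / (4 * B\<^sup>2)" by simp
    have nn': "0 \<le> Y x / (8 * B * E)" "0 \<le> (W x)\<^sup>2 / (4 * B\<^sup>2)" "0 \<le> 1 / (2 * B)"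
      using nn(2)[OF x] pos by auto
    consider "x \<in> ?G" | "W x < 1/2" | "8 * B * E < Y x" using x by fastforce
    then show ?thesis
    proof cases
      case 1
      then have "indicator ?G x = (1::real)" by simp
      then show ?thesis using sq nn' by linarith
    next
      case 2
      then have "W x / B \<le> 1 / (2 * B)" using pos by (simp add: field_simps)
      moreover have "0 \<le> (indicator ?G x :: real)" by simp
      ultimately show ?thesis using nn' by linarith
    next
      case 3
      then have "1 \<le> Y x / (8 * B * E)" using pos by (simp add: field_simps)
      moreover have "0 \<le> (indicator ?G x :: real)" by simp
      ultimately show ?thesis using sq nn' by linarith
    qed
  qed
  have "ennreal (1 / B) = ennreal (1 / B) * (\<integral>\<^sup>+x. ennreal (W x) \<partial>M)" using W by simp
  also have "\<dots> = (\<integral>\<^sup>+x. ennreal (1 / B) * ennreal (W x) \<partial>M)" by (rule nn_integral_cmult[symmetric]) simp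
  also have "\<dots> \<le> (\<integral>\<^sup>+x. indicator ?G x + ennreal (1 / (4 * B\<^sup>2)) * ennreal ((W x)\<^sup>2)
      + ennreal (1 / (8 * B * E)) * ennreal (Y x) + ennreal (1 / (2 * B)) \<partial>M)"
  proof (intro nn_integral_mono)
    fix x assume x: "x \<in> space M"
    have "ennreal (1 / B) * ennreal (W x) = ennreal (W x / B)"
      using pos nn(1)[OF x] by (simp add: ennreal_mult[symmetric])
    also have "\<dots> \<le> ennreal (indicator ?G x + (W x)\<^sup>2 / (4 * B\<^sup>2) + Y x / (8 * B * E) + 1 / (2 * B))"
      by (rule ennreal_leI[OF pt[OF x]])
    also have "\<dots> = indicator ?G x + ennreal (1 / (4 * B\<^sup>2)) * ennreal ((W x)\<^sup>2)
      + ennreal (1 / (8 * B * E)) * ennreal (Y x) + ennreal (1 / (2 * B))"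
    proof -
      have 1: "ennreal (1 / (4 * B\<^sup>2)) * ennreal ((W x)\<^sup>2) = ennreal ((W x)\<^sup>2 / (4 * B\<^sup>2))"
        by (simp add: ennreal_mult[symmetric])
      have 2: "ennreal (1 / (8 * B * E)) * ennreal (Y x) = ennreal (Y x / (8 * B * E))"
        using pos nn(2)[OF x] by (simp add: ennreal_mult[symmetric])
      have 3: "(indicator ?G x :: ennreal) = ennreal (indicator ?G x)" by (simp add: indicator_def)
      show ?thesis unfolding 1 2 3
        using pos nn(2)[OF x] by (simp add: ennreal_plus[symmetric] del: ennreal_plus)
    qed
    finally show "ennreal (1 / B) * ennreal (W x) \<le> indicator ?G x + ennreal (1 / (4 * B\<^sup>2)) * ennreal ((W x)\<^sup>2)
      + ennreal (1 / (8 * B * E)) * ennreal (Y x) + ennreal (1 / (2 * B))" .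
  qed
  also have "\<dots> = emeasure M ?G + ennreal (1 / (4 * B\<^sup>2)) * (\<integral>\<^sup>+x. ennreal ((W x)\<^sup>2) \<partial>M)
      + ennreal (1 / (8 * B * E)) * (\<integral>\<^sup>+x. ennreal (Y x) \<partial>M) + ennreal (1 / (2 * B))"
    using G by (simp add: nn_integral_add nn_integral_cmult emeasure_space_1)
  also have "\<dots> \<le> ennreal (prob ?G) + ennreal (1 / (4 * B\<^sup>2)) * ennreal B + ennreal (1 / (8 * B * E)) * ennreal E + ennreal (1 / (2 * B))"
    unfolding emeasure_eq_measure by (intro add_mono mult_left_mono W2 Y) auto
  also have "\<dots> = ennreal (prob ?G + 1 / (4 * B\<^sup>2) * B + 1 / (8 * B * E) * E + 1 / (2 * B))"
    using pos by (simp only: ennreal_mult[symmetric] ennreal_plus[symmetric] less_imp_le divide_nonneg_nonneg mult_nonneg_nonneg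
        add_nonneg_nonneg measure_nonneg zero_le_one zero_le_numeral zero_le_power2)
  finally have "1 / B \<le> prob ?G + 1 / (4 * B\<^sup>2) * B + 1 / (8 * B * E) * E + 1 / (2 * B)"
    using pos by (subst (asm) ennreal_le_iff) auto
  also have "1 / (4 * B\<^sup>2) * B = 1 / (4 * B)" using pos by (simp add: power2_eq_square)
  also have "1 / (8 * B * E) * E = 1 / (8 * B)" using pos by simp
  finally show ?thesis using pos by (simp add: field_simps)
qed

text \<open>Continuity from above along the tail unions. It replaces one event per cut-off by a
  single event on which infinitely many cut-offs are good.\<close>

lemma (in prob_space) prob_infinitely_often_ge:
  assumes G: "\<And>n::nat. G n \<in> events" "\<And>n. p \<le> prob (G n)"
  shows "p \<le> prob (\<Inter>K. \<Union>n\<in>{K..}. G n)"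
proof -
  have "(\<lambda>K. prob (\<Union>n\<in>{K..}. G n)) \<longlonglongrightarrow> prob (\<Inter>K. \<Union>n\<in>{K..}. G n)"
    using G by (intro finite_Lim_measure_decseq) (auto simp: decseq_def intro: le_trans)
  moreover have "p \<le> prob (\<Union>n\<in>{K..}. G n)" for K
    using G by (intro order_trans[OF G(2)[of K] finite_measure_mono]) auto
  ultimately show ?thesis by (intro LIMSEQ_le_const) auto
qed

section \<open>Random pair sums and their off-diagonal terms\<close>

locale distinct_ifs = random_ifs m a lo hi \<theta>
  for m :: nat and a :: "nat \<Rightarrow> real^'d" and lo hi :: real and \<theta> :: "(real^'d^'d) measure" +
  assumes distinct: "\<And>i j. i \<in> {1..m} \<Longrightarrow> j \<in> {1..m} \<Longrightarrow> i \<noteq> j \<Longrightarrow> a i \<noteq> a j"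
begin

text \<open>Divided by the square of \<open>(real m * moment t) ^ k\<close>, this is the product
  mass of the pairs of generation-k points at distance at most \<rho>.\<close>

definition pair_sum :: "real \<Rightarrow> nat \<Rightarrow> real \<Rightarrow> 'd labelling \<Rightarrow> real" where
  "pair_sum t k \<rho> \<omega> = (\<Sum>w\<in>words m k. \<Sum>v\<in>words m k.
     wt t w \<omega> * wt t v \<omega> * of_bool (dist (pt w \<omega>) (pt v \<omega>) \<le> \<rho>))"

lemma wordsD: "w \<in> words m k \<Longrightarrow> set w \<subseteq> {1..m}" "w \<in> words m k \<Longrightarrow> length w = k"
  by (auto simp: words_def)

lemma wt_nonneg: "\<omega> \<in> space space_lab \<Longrightarrow> set w \<subseteq> {1..m} \<Longrightarrow> 0 \<le> wt t w \<omega>"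
  using wt_pos[OF admissible_space] by (simp add: less_imp_le)

lemma pair_sum_nonneg: "\<omega> \<in> space space_lab \<Longrightarrow> 0 \<le> pair_sum t k \<rho> \<omega>"
  unfolding pair_sum_def by (intro sum_nonneg mult_nonneg_nonneg wt_nonneg wordsD) auto

lemma measurable_pair_sum [measurable (raw)]:
  assumes [measurable]: "f \<in> borel_measurable N" "g \<in> measurable N space_lab"
  shows "(\<lambda>x. pair_sum t k (f x) (g x)) \<in> borel_measurable N"
  unfolding pair_sum_def
proof (intro borel_measurable_sum)
  fix w v assume wv: "w \<in> words m k" "v \<in> words m k"
  note [measurable] = measurable_wt[OF wordsD(1)[OF wv(1)]] measurable_wt[OF wordsD(1)[OF wv(2)]]
    measurable_pt[OF wordsD(1)[OF wv(1)]] measurable_pt[OF wordsD(1)[OF wv(2)]]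
  have [measurable]: "Measurable.pred N (\<lambda>x. dist (pt w (g x)) (pt v (g x)) \<le> f x)" by measurable
  show "(\<lambda>x. wt t w (g x) * wt t v (g x) * of_bool (dist (pt w (g x)) (pt v (g x)) \<le> f x)) \<in> borel_measurable N"
    unfolding of_bool_def by measurable
qed

lemma nn_integral_wt_wt:
  assumes "i \<in> {1..m}" "j \<in> {1..m}" "i \<noteq> j" "set w \<subseteq> {1..m}" "set v \<subseteq> {1..m}"
  shows "(\<integral>\<^sup>+\<omega>. ennreal (wt t w (shift i \<omega>)) * ennreal (wt t v (shift j \<omega>)) \<partial>space_lab)
    = ennreal (moment t ^ (length w + length v))"
  using assms measurable_wt[of w t] measurable_wt[of v t] moment_nonneg
  by (subst nn_integral_shifts) (auto simp: nn_integral_wt power_add ennreal_mult)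

text \<open>Off the diagonal, resampling the label of the first symbol \<open>i\<close> moves one of the two points
  independently of the other.\<close>

lemma nn_integral_hit_le:
  assumes ij: "i \<in> {1..m}" "j \<in> {1..m}" "i \<noteq> j" and wv: "set w \<subseteq> {1..m}" "set v \<subseteq> {1..m}"
    and K: "\<And>x c. \<eta> \<le> norm x \<Longrightarrow> hit x \<rho> c \<le> K"
  shows "(\<integral>\<^sup>+\<omega>. ennreal (wt t w (shift i \<omega>)) * ennreal (wt t v (shift j \<omega>)) *
      ((if \<eta> \<le> norm (pt w (shift i \<omega>)) then 1 else 0) *
       (if dist (a i + similarity (\<omega> [i]) (pt w (shift i \<omega>))) (a j + similarity (\<omega> [j]) (pt v (shift j \<omega>))) \<le> \<rho> then 1 else 0)) \<partial>space_lab)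
    \<le> K * ennreal (moment t ^ (length w + length v))"
proof -
  let ?W = "\<lambda>\<omega>. ennreal (wt t w (shift i \<omega>)) * ennreal (wt t v (shift j \<omega>))"
  let ?I = "\<lambda>\<omega>. (if \<eta> \<le> norm (pt w (shift i \<omega>)) then 1 else 0) :: ennreal"
  let ?H = "\<lambda>l \<omega>. (if dist (a i + similarity l (pt w (shift i \<omega>))) (a j + similarity (\<omega> [j]) (pt v (shift j \<omega>))) \<le> \<rho> then 1 else 0) :: ennreal"
  note [measurable] = measurable_shift[OF ij(1)] measurable_shift[OF ij(2)] measurable_wt[OF wv(1)] measurable_wt[OF wv(2)]
    measurable_pt[OF wv(1)] measurable_pt[OF wv(2)] measurable_coordinate[OF singleton_word[OF ij(1)]]
    measurable_coordinate[OF singleton_word[OF ij(2)]]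
  have ji: "fun_upd \<omega> [i] l [j] = \<omega> [j]" for \<omega> :: "'d labelling" and l using ij by simp
  have m: "case_prod (\<lambda>l \<omega>. ?W \<omega> * (?I \<omega> * ?H l \<omega>)) \<in> borel_measurable (label \<Otimes>\<^sub>M space_lab)"
    by measurable
  have "(\<integral>\<^sup>+\<omega>. ?W \<omega> * (?I \<omega> * ?H (\<omega> [i]) \<omega>) \<partial>space_lab)
      = (\<integral>\<^sup>+\<omega>. \<integral>\<^sup>+l. ?W \<omega> * (?I \<omega> * ?H l \<omega>) \<partial>label \<partial>space_lab)"
    by (rule nn_integral_resample[OF singleton_word[OF ij(1)] m]) (simp only: shift_upd ji)
  also have "\<dots> \<le> (\<integral>\<^sup>+\<omega>. K * ?W \<omega> \<partial>space_lab)"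
  proof (intro nn_integral_mono)
    fix \<omega> assume \<omega>: "\<omega> \<in> space space_lab"
    \<comment> \<open>The centre is random but does not involve the resampled label at
      \<open>[i]\<close>, so the bound \<open>K\<close>, uniform over centres, applies for each
      \<omega>.\<close>
    let ?c = "a j + similarity (\<omega> [j]) (pt v (shift j \<omega>)) - a i"
    have "dist (a i + z) (a j + similarity (\<omega> [j]) (pt v (shift j \<omega>))) = dist ?c z" for z
      by (simp add: dist_norm norm_minus_commute algebra_simps)
    then have eq: "?H l \<omega> = indicator (cball ?c \<rho>) (similarity l (pt w (shift i \<omega>)))" for l
      by (simp add: indicator_def)
    have m': "(\<lambda>l. indicator (cball ?c \<rho>) (similarity l (pt w (shift i \<omega>))) :: ennreal) \<in> borel_measurable label"
      by (intro measurable_indicator_cball measurable_similarity) auto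
    have "(\<integral>\<^sup>+l. ?W \<omega> * (?I \<omega> * ?H l \<omega>) \<partial>label) = (?W \<omega> * ?I \<omega>) * hit (pt w (shift i \<omega>)) \<rho> ?c"
      unfolding eq hit_def mult.assoc[symmetric] by (rule nn_integral_cmult[OF m'])
    also have "\<dots> = ?W \<omega> * (?I \<omega> * hit (pt w (shift i \<omega>)) \<rho> ?c)" by (rule mult.assoc)
    also have "\<dots> \<le> ?W \<omega> * K"
      using K[of "pt w (shift i \<omega>)" ?c] by (intro mult_left_mono) auto
    finally show "(\<integral>\<^sup>+l. ?W \<omega> * (?I \<omega> * ?H l \<omega>) \<partial>label) \<le> K * ?W \<omega>" by (simp only: mult.commute)
  qed
  also have "\<dots> = K * ennreal (moment t ^ (length w + length v))"
    unfolding nn_integral_wt_wt[OF ij wv, symmetric] by (rule nn_integral_cmult) measurable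
  finally show ?thesis .
qed

lemma min_translation_dist:
  obtains \<delta> where "0 < \<delta>" "\<And>i j. i \<in> {1..m} \<Longrightarrow> j \<in> {1..m} \<Longrightarrow> i \<noteq> j \<Longrightarrow> \<delta> \<le> dist (a i) (a j)"
proof -
  \<comment> \<open>The inserted 1 keeps the minimum meaningful when there is only one
    symbol.\<close>
  let ?D = "insert 1 ((\<lambda>(i, j). dist (a i) (a j)) ` {p \<in> {1..m} \<times> {1..m}. fst p \<noteq> snd p})"
  have fin: "finite ?D" by auto
  show ?thesis
  proof (rule that[of "Min ?D"])
    show "0 < Min ?D" using fin distinct by (subst Min_gr_iff) auto
    fix i j assume "i \<in> {1..m}" "j \<in> {1..m}" "i \<noteq> j"
    then have "dist (a i) (a j) \<in> ?D" by force
    then show "Min ?D \<le> dist (a i) (a j)" using fin by (rule Min_le[rotated])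
  qed
qed

definition pair_term :: "real \<Rightarrow> real \<Rightarrow> nat list \<Rightarrow> nat list \<Rightarrow> 'd labelling \<Rightarrow> real" where
  "pair_term t \<rho> w v \<omega> = wt t w \<omega> * wt t v \<omega> * of_bool (dist (pt w \<omega>) (pt v \<omega>) \<le> \<rho>)"

lemma pair_sum_alt: "pair_sum t k \<rho> \<omega> = (\<Sum>w\<in>words m k. \<Sum>v\<in>words m k. pair_term t \<rho> w v \<omega>)"
  by (simp only: pair_sum_def pair_term_def)

text \<open>Three cases give three summands: the label at \<open>[i]\<close> is resampled if the
  first subtree point has norm at least \<eta>, the label at \<open>[j]\<close> if the second has,
  and otherwise the images are at least \<delta>/2 apart, so that only \<rho> \<ge> \<delta>/2
  matters.\<close>

lemma off_diagonal:
  assumes t: "0 \<le> t" "t \<le> real CARD('d)"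
  obtains C where "0 \<le> C" "\<And>i j w v \<rho>. i \<in> {1..m} \<Longrightarrow> j \<in> {1..m} \<Longrightarrow> i \<noteq> j \<Longrightarrow> set w \<subseteq> {1..m} \<Longrightarrow> set v \<subseteq> {1..m} \<Longrightarrow> 0 < \<rho> \<Longrightarrow>
    (\<integral>\<^sup>+\<omega>. ennreal (pair_term t \<rho> (i # w) (j # v) \<omega>) \<partial>space_lab)
      \<le> ennreal (C * \<rho> powr t * moment t ^ (length w + length v))"
proof -
  obtain \<delta> where \<delta>: "0 < \<delta>" "\<And>i j. i \<in> {1..m} \<Longrightarrow> j \<in> {1..m} \<Longrightarrow> i \<noteq> j \<Longrightarrow> \<delta> \<le> dist (a i) (a j)"
    using min_translation_dist by blast
  \<comment> \<open>Two points of norm below \<delta>/4 displace their translations by less than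
    \<delta>/2 altogether, half of the available gap.\<close>
  define \<eta> where "\<eta> = \<delta> / 4"
  have "0 < \<eta>" using \<delta> by (simp add: \<eta>_def)
  from transversality[OF this t] obtain C where
    C: "0 \<le> C" "\<And>x c \<rho>. \<eta> \<le> norm x \<Longrightarrow> 0 < \<rho> \<Longrightarrow> hit x \<rho> c \<le> ennreal (C * \<rho> powr t)" by blast
  \<comment> \<open>\<open>C\<close> occurs once for each label that may be resampled; the last
    summand makes the bound at least 1 in the remaining case \<rho> \<ge> \<delta>/2.\<close>
  define C' where "C' = 2 * C + (2 / \<delta>) powr t"
  have main: "(\<integral>\<^sup>+\<omega>. ennreal (pair_term t \<rho> (i # w) (j # v) \<omega>) \<partial>space_lab)
      \<le> ennreal (C' * \<rho> powr t * moment t ^ (length w + length v))"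
    if ij: "i \<in> {1..m}" "j \<in> {1..m}" "i \<noteq> j" and wv: "set w \<subseteq> {1..m}" "set v \<subseteq> {1..m}" and \<rho>: "0 < \<rho>"
    for i j w v \<rho>
  proof -
    note [measurable] = measurable_shift[OF ij(1)] measurable_shift[OF ij(2)] measurable_wt[OF wv(1)] measurable_wt[OF wv(2)]
      measurable_pt[OF wv(1)] measurable_pt[OF wv(2)] measurable_coordinate[OF singleton_word[OF ij(1)]]
      measurable_coordinate[OF singleton_word[OF ij(2)]]
    let ?x = "\<lambda>\<omega>. pt w (shift i \<omega>)" and ?y = "\<lambda>\<omega>. pt v (shift j \<omega>)"
    let ?A = "\<lambda>\<omega>. ((if \<eta> \<le> norm (?x \<omega>) then 1 else 0) *
      (if dist (a i + similarity (\<omega> [i]) (?x \<omega>)) (a j + similarity (\<omega> [j]) (?y \<omega>)) \<le> \<rho> then 1 else 0) :: ennreal)"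
    let ?B = "\<lambda>\<omega>. ((if \<eta> \<le> norm (?y \<omega>) then 1 else 0) *
      (if dist (a j + similarity (\<omega> [j]) (?y \<omega>)) (a i + similarity (\<omega> [i]) (?x \<omega>)) \<le> \<rho> then 1 else 0) :: ennreal)"
    let ?W = "\<lambda>\<omega>. ennreal (wt t w (shift i \<omega>)) * ennreal (wt t v (shift j \<omega>))"
    let ?V = "\<lambda>\<omega>. ennreal (wt t v (shift j \<omega>)) * ennreal (wt t w (shift i \<omega>))"
    let ?q = "ennreal (moment t ^ (length w + length v))"
    have "(\<integral>\<^sup>+\<omega>. ennreal (pair_term t \<rho> (i # w) (j # v) \<omega>) \<partial>space_lab)
      \<le> (\<integral>\<^sup>+\<omega>. ?W \<omega> * ?A \<omega> + ?V \<omega> * ?B \<omega> + ennreal ((2 / \<delta>) powr t * \<rho> powr t) * ?W \<omega> \<partial>space_lab)"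
    proof (intro nn_integral_mono)
      fix \<omega> assume "\<omega> \<in> space space_lab"
      then have adm: "admissible \<omega>" by (rule admissible_space)
      note fi = singleton_word[OF ij(1)] and fj = singleton_word[OF ij(2)]
      let ?D = "dist (a i + label_map \<omega> [i] (?x \<omega>)) (a j + label_map \<omega> [j] (?y \<omega>))"
      have pos: "0 < wt t w (shift i \<omega>)" "0 < wt t v (shift j \<omega>)"
        using wt_pos[OF admissible_shift[OF adm ij(1)] wv(1)] wt_pos[OF admissible_shift[OF adm ij(2)] wv(2)] by auto
      have r: "fst (\<omega> [i]) powr t \<le> 1" "fst (\<omega> [j]) powr t \<le> 1"
        using admissibleD(3,4)[OF adm fi] admissibleD(3,4)[OF adm fj] t by (auto intro!: powr_le1)
      have "pair_term t \<rho> (i # w) (j # v) \<omega> \<le> (1 * wt t w (shift i \<omega>)) * (1 * wt t v (shift j \<omega>)) * of_bool (?D \<le> \<rho>)"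
        using pos r unfolding pair_term_def weight.simps pt_Cons[OF adm ij(1) wv(1)] pt_Cons[OF adm ij(2) wv(2)]
        by (intro mult_mono mult_nonneg_nonneg) auto
      then have "ennreal (pair_term t \<rho> (i # w) (j # v) \<omega>) \<le> ?W \<omega> * of_bool (?D \<le> \<rho>)"
        using pos by (cases "?D \<le> \<rho>") (auto simp: ennreal_mult[symmetric] ennreal_neg intro!: ennreal_leI)
      also have "\<dots> \<le> ?W \<omega> * (?A \<omega> + ?B \<omega> + ennreal ((2 / \<delta>) powr t * \<rho> powr t))"
      proof (rule mult_left_mono)
        show "of_bool (?D \<le> \<rho>) \<le> ?A \<omega> + ?B \<omega> + ennreal ((2 / \<delta>) powr t * \<rho> powr t)"
        proof (cases "?D \<le> \<rho>")
          case True
          show ?thesis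
          proof (cases "\<eta> \<le> norm (?x \<omega>) \<or> \<eta> \<le> norm (?y \<omega>)")
            case True': True
            then have "1 \<le> ?A \<omega> + ?B \<omega>"
              using True by (auto simp: label_map_eq_similarity[symmetric] dist_commute)
            then show ?thesis using True by (simp add: add_increasing2)
          next
            case False
            have "norm (label_map \<omega> [i] (?x \<omega>)) \<le> 1 * norm (?x \<omega>)" "norm (label_map \<omega> [j] (?y \<omega>)) \<le> 1 * norm (?y \<omega>)"
              using admissibleD(3,4)[OF adm fi] admissibleD(3,4)[OF adm fj]
              unfolding norm_label_map[OF adm fi] norm_label_map[OF adm fj]
              by (auto intro!: mult_left_le_one_le simp: less_imp_le)
            moreover have "dist (a i) (a j) \<le> ?D + norm (label_map \<omega> [i] (?x \<omega>)) + norm (label_map \<omega> [j] (?y \<omega>))"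
              by (simp add: dist_norm) (smt (verit) add_diff_cancel_left' add_diff_eq diff_diff_add norm_triangle_ineq norm_triangle_ineq2 norm_minus_commute)
            ultimately have "\<delta> / 2 \<le> \<rho>" using False True \<delta>(2)[OF ij] by (simp add: \<eta>_def)
            then have "1 \<le> (2 * \<rho> / \<delta>) powr t" using \<delta>(1) t by (intro ge_one_powr_ge_zero) (auto simp: field_simps)
            also have "\<dots> = (2 / \<delta>) powr t * \<rho> powr t" using \<delta>(1) \<rho> by (simp add: powr_mult[symmetric])
            finally have "1 \<le> ennreal ((2 / \<delta>) powr t * \<rho> powr t)" using ennreal_leI by fastforce
            then show ?thesis using True by (simp add: add_increasing)
          qed
        qed simp
      qed simp
      also have "\<dots> = ?W \<omega> * ?A \<omega> + ?V \<omega> * ?B \<omega> + ennreal ((2 / \<delta>) powr t * \<rho> powr t) * ?W \<omega>"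
        by (simp only: distrib_left mult.commute[of "ennreal (wt t v (shift j \<omega>))" "ennreal (wt t w (shift i \<omega>))"]
            mult.commute[of "ennreal ((2 / \<delta>) powr t * \<rho> powr t)"])
      finally show "ennreal (pair_term t \<rho> (i # w) (j # v) \<omega>)
        \<le> ?W \<omega> * ?A \<omega> + ?V \<omega> * ?B \<omega> + ennreal ((2 / \<delta>) powr t * \<rho> powr t) * ?W \<omega>" .
    qed
    also have "\<dots> = (\<integral>\<^sup>+\<omega>. ?W \<omega> * ?A \<omega> \<partial>space_lab) + (\<integral>\<^sup>+\<omega>. ?V \<omega> * ?B \<omega> \<partial>space_lab)
        + ennreal ((2 / \<delta>) powr t * \<rho> powr t) * (\<integral>\<^sup>+\<omega>. ?W \<omega> \<partial>space_lab)"
      by (subst nn_integral_add, measurable, subst nn_integral_add, measurable, subst nn_integral_cmult, measurable)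
    also have "\<dots> \<le> ennreal (C * \<rho> powr t) * ?q + ennreal (C * \<rho> powr t) * ?q + ennreal ((2 / \<delta>) powr t * \<rho> powr t) * ?q"
    proof (intro add_mono)
      show "(\<integral>\<^sup>+\<omega>. ?W \<omega> * ?A \<omega> \<partial>space_lab) \<le> ennreal (C * \<rho> powr t) * ?q"
        by (rule nn_integral_hit_le[OF ij wv C(2)[OF _ \<rho>]])
      show "(\<integral>\<^sup>+\<omega>. ?V \<omega> * ?B \<omega> \<partial>space_lab) \<le> ennreal (C * \<rho> powr t) * ?q"
        by (rule order_trans[OF nn_integral_hit_le[OF ij(2,1) ij(3)[symmetric] wv(2,1) C(2)[OF _ \<rho>]]])
           (simp_all only: add.commute order_refl)
      show "ennreal ((2 / \<delta>) powr t * \<rho> powr t) * (\<integral>\<^sup>+\<omega>. ?W \<omega> \<partial>space_lab) \<le> ennreal ((2 / \<delta>) powr t * \<rho> powr t) * ?q"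
        by (simp only: nn_integral_wt_wt[OF ij wv] order_refl)
    qed
    also have "\<dots> = ennreal (C' * \<rho> powr t * moment t ^ (length w + length v))"
    proof -
      have "0 \<le> moment t ^ (length w + length v)" using moment_nonneg by simp
      then show ?thesis
        using C(1) by (simp add: ennreal_mult[symmetric] ennreal_plus[symmetric] C'_def algebra_simps del: ennreal_plus)
    qed
    finally show ?thesis .
  qed
  show ?thesis by (rule that[OF _ main]) (use C(1) in \<open>auto simp: C'_def\<close>)
qed

section \<open>Diagonal terms and the recursion over generations\<close>

lemma measurable_pair_term:
  assumes wv: "set w \<subseteq> {1..m}" "set v \<subseteq> {1..m}"
  shows "pair_term t \<rho> w v \<in> borel_measurable space_lab"
proof -
  note [measurable] = measurable_wt[OF wv(1)] measurable_wt[OF wv(2)] measurable_pt[OF wv(1)] measurable_pt[OF wv(2)]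
  have [measurable]: "Measurable.pred space_lab (\<lambda>x. dist (pt w x) (pt v x) \<le> \<rho>)" by measurable
  show ?thesis unfolding pair_term_def[abs_def] of_bool_def by measurable
qed

lemma pair_term_nonneg: "\<omega> \<in> space space_lab \<Longrightarrow> set w \<subseteq> {1..m} \<Longrightarrow> set v \<subseteq> {1..m} \<Longrightarrow> 0 \<le> pair_term t \<rho> w v \<omega>"
  unfolding pair_term_def by (intro mult_nonneg_nonneg wt_nonneg) auto

text \<open>Both points lie in the piece of \<open>i\<close>, whose map scales distances by its
  ratio r: the scale becomes \<rho>/r in the subtree, and each of the two weights gives off a factor
  r^t.\<close>

lemma diagonal_eq:
  assumes adm: "admissible \<omega>" and i: "i \<in> {1..m}"
  shows "(\<Sum>w\<in>words m k. \<Sum>v\<in>words m k. pair_term t \<rho> (i # w) (i # v) \<omega>)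
    = fst (\<omega> [i]) powr (2 * t) * pair_sum t k (\<rho> / fst (\<omega> [i])) (shift i \<omega>)"
  unfolding pair_sum_alt sum_distrib_left
proof (intro sum.cong refl)
  fix w v assume "w \<in> words m k" "v \<in> words m k"
  then have wv: "set w \<subseteq> {1..m}" "set v \<subseteq> {1..m}" by (auto simp: words_def)
  have r: "0 < fst (\<omega> [i])" by (rule admissibleD(3)[OF adm singleton_word[OF i]])
  have "fst (\<omega> [i]) powr (2 * t) = fst (\<omega> [i]) powr t * fst (\<omega> [i]) powr t"
    by (simp add: powr_add[symmetric])
  moreover have "dist (pt (i # w) \<omega>) (pt (i # v) \<omega>) \<le> \<rho> \<longleftrightarrow> dist (pt w (shift i \<omega>)) (pt v (shift i \<omega>)) \<le> \<rho> / fst (\<omega> [i])"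
    using r unfolding pt_Cons[OF adm i wv(1)] pt_Cons[OF adm i wv(2)]
    by (simp add: dist_label_map[OF adm singleton_word[OF i]] field_simps)
  ultimately show "pair_term t \<rho> (i # w) (i # v) \<omega> = fst (\<omega> [i]) powr (2 * t) * pair_term t (\<rho> / fst (\<omega> [i])) w v (shift i \<omega>)"
    unfolding pair_term_def weight.simps by simp
qed

lemma diagonal_integral:
  assumes i: "i \<in> {1..m}"
  shows "(\<integral>\<^sup>+\<omega>. ennreal (\<Sum>w\<in>words m k. \<Sum>v\<in>words m k. pair_term t \<rho> (i # w) (i # v) \<omega>) \<partial>space_lab)
    = (\<integral>\<^sup>+l. ennreal (fst l powr (2 * t)) * (\<integral>\<^sup>+\<omega>. ennreal (pair_sum t k (\<rho> / fst l) \<omega>) \<partial>space_lab) \<partial>label)"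
proof -
  interpret LM: pair_sigma_finite label space_lab ..
  note [measurable] = measurable_shift[OF i]
  let ?f = "\<lambda>l \<omega>. ennreal (fst l powr (2 * t)) * ennreal (pair_sum t k (\<rho> / fst l) (shift i \<omega>))"
  have "(\<integral>\<^sup>+\<omega>. ennreal (\<Sum>w\<in>words m k. \<Sum>v\<in>words m k. pair_term t \<rho> (i # w) (i # v) \<omega>) \<partial>space_lab)
      = (\<integral>\<^sup>+\<omega>. ?f (\<omega> [i]) \<omega> \<partial>space_lab)"
    by (intro nn_integral_cong) (simp add: diagonal_eq[OF admissible_space i] ennreal_mult')
  also have "\<dots> = (\<integral>\<^sup>+\<omega>. \<integral>\<^sup>+l. ?f l \<omega> \<partial>label \<partial>space_lab)"
    by (rule nn_integral_resample[where f="?f", OF singleton_word[OF i]]) (measurable, simp only: shift_upd)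
  also have "\<dots> = (\<integral>\<^sup>+l. \<integral>\<^sup>+\<omega>. ?f l \<omega> \<partial>space_lab \<partial>label)"
    by (rule LM.Fubini') measurable
  also have "\<dots> = (\<integral>\<^sup>+l. ennreal (fst l powr (2 * t)) * (\<integral>\<^sup>+\<omega>. ennreal (pair_sum t k (\<rho> / fst l) \<omega>) \<partial>space_lab) \<partial>label)"
  proof (intro nn_integral_cong)
    fix l
    have "(\<integral>\<^sup>+\<omega>. ?f l \<omega> \<partial>space_lab) = ennreal (fst l powr (2 * t)) * (\<integral>\<^sup>+\<omega>. ennreal (pair_sum t k (\<rho> / fst l) (shift i \<omega>)) \<partial>space_lab)"
      by (rule nn_integral_cmult) measurable
    also have "(\<integral>\<^sup>+\<omega>. ennreal (pair_sum t k (\<rho> / fst l) (shift i \<omega>)) \<partial>space_lab) = (\<integral>\<^sup>+\<omega>. ennreal (pair_sum t k (\<rho> / fst l) \<omega>) \<partial>space_lab)"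
      by (rule nn_integral_shift[OF i]) measurable
    finally show "(\<integral>\<^sup>+\<omega>. ?f l \<omega> \<partial>space_lab) = ennreal (fst l powr (2 * t)) * (\<integral>\<^sup>+\<omega>. ennreal (pair_sum t k (\<rho> / fst l) \<omega>) \<partial>space_lab)" .
  qed
  finally show ?thesis .
qed

lemma pair_sum_Suc:
  "pair_sum t (Suc k) \<rho> \<omega> = (\<Sum>i\<in>{1..m}. \<Sum>j\<in>{1..m}. \<Sum>w\<in>words m k. \<Sum>v\<in>words m k. pair_term t \<rho> (i # w) (j # v) \<omega>)"
  unfolding pair_sum_alt sum_words_Suc by (intro sum.cong refl sum.swap)

text \<open>Write c for \<open>real m * moment t\<close>. On the diagonal r^(2t) (\<rho>/r)^t = r^t
  \<rho>^t, so the main term grows only by c while c^2 is allowed; the gap absorbs the off-diagonal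
  terms. The summand c^k accounts for pairs of equal words, present at every scale: it is 1 for k =
  0, and r^(2t) \<le> r^t lets it grow by at most c.\<close>

lemma nn_integral_pair_sum_le:
  assumes t: "0 \<le> t" "t \<le> real CARD('d)" and c: "1 < real m * moment t"
  obtains A where "0 \<le> A" "\<And>k \<rho>. 0 < \<rho> \<Longrightarrow> (\<integral>\<^sup>+\<omega>. ennreal (pair_sum t k \<rho> \<omega>) \<partial>space_lab)
    \<le> ennreal (A * ((real m * moment t) ^ k)\<^sup>2 * \<rho> powr t + (real m * moment t) ^ k)"
proof -
  let ?c = "real m * moment t"
  obtain C where C: "0 \<le> C" "\<And>i j w v \<rho>. i \<in> {1..m} \<Longrightarrow> j \<in> {1..m} \<Longrightarrow> i \<noteq> j \<Longrightarrow> set w \<subseteq> {1..m} \<Longrightarrow> set v \<subseteq> {1..m} \<Longrightarrow> 0 < \<rho> \<Longrightarrow>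
    (\<integral>\<^sup>+\<omega>. ennreal (pair_term t \<rho> (i # w) (j # v) \<omega>) \<partial>space_lab)
      \<le> ennreal (C * \<rho> powr t * moment t ^ (length w + length v))" using off_diagonal[OF t] by blast
  \<comment> \<open>The solution of the balance equation \<open>A_eq\<close> of the recursion; c > 1
    makes its denominator positive.\<close>
  define A where "A = (real m)\<^sup>2 * C / (?c * (?c - 1))"
  have A: "0 \<le> A" unfolding A_def using C(1) c moment_nonneg by (intro divide_nonneg_nonneg mult_nonneg_nonneg) auto
  have A_eq: "?c * A + (real m)\<^sup>2 * C = ?c\<^sup>2 * A"
  proof -
    have p: "0 < ?c" "0 < ?c - 1" using c by linarith+
    have nz: "?c * (?c - 1) \<noteq> 0" using mult_pos_pos[OF p] by (rule less_imp_neq[THEN not_sym])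
    have "A * (?c * (?c - 1)) = (real m)\<^sup>2 * C"
      using nonzero_eq_divide_eq[OF nz] A_def by blast
    then show ?thesis by (simp add: algebra_simps power2_eq_square)
  qed
  have bound: "(\<integral>\<^sup>+\<omega>. ennreal (pair_sum t k \<rho> \<omega>) \<partial>space_lab) \<le> ennreal (A * (?c ^ k)\<^sup>2 * \<rho> powr t + ?c ^ k)"
    if "0 < \<rho>" for k \<rho>
    using that
  proof (induction k arbitrary: \<rho>)
    case 0
    have "(\<integral>\<^sup>+\<omega>. ennreal (pair_sum t 0 \<rho> \<omega>) \<partial>space_lab) = (\<integral>\<^sup>+\<omega>. 1 \<partial>space_lab)"
      using 0 by (intro nn_integral_cong) (simp add: pair_sum_def)
    also have "\<dots> = ennreal 1" by (simp add: lab.emeasure_space_1)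
    also have "\<dots> \<le> ennreal (A * (?c ^ 0)\<^sup>2 * \<rho> powr t + ?c ^ 0)" using A by (intro ennreal_leI) simp
    finally show ?case .
  next
    case (Suc k)
    let ?S = "\<lambda>i j \<omega>. \<Sum>w\<in>words m k. \<Sum>v\<in>words m k. pair_term t \<rho> (i # w) (j # v) \<omega>"
    let ?X = "A * (?c ^ k)\<^sup>2 * \<rho> powr t + ?c ^ k"
    have X: "0 \<le> ?X" using A c by simp
    have set: "set (i # w) \<subseteq> {1..m}" if "i \<in> {1..m}" "w \<in> words m k" for i w
      using that by (auto simp: words_def)
    have mS: "?S i j \<in> borel_measurable space_lab" if "i \<in> {1..m}" "j \<in> {1..m}" for i j
      using that by (intro borel_measurable_sum measurable_pair_term set)
    have S_nn: "0 \<le> ?S i j \<omega>" if "i \<in> {1..m}" "j \<in> {1..m}" "\<omega> \<in> space space_lab" for i j \<omega>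
      using that by (intro sum_nonneg pair_term_nonneg set)
    have diag: "(\<integral>\<^sup>+\<omega>. ennreal (?S i i \<omega>) \<partial>space_lab) \<le> ennreal (moment t * ?X)" if i: "i \<in> {1..m}" for i
    proof -
      have "(\<integral>\<^sup>+\<omega>. ennreal (?S i i \<omega>) \<partial>space_lab)
          \<le> (\<integral>\<^sup>+l. ennreal ?X * ennreal (fst l powr t) \<partial>label)"
        unfolding diagonal_integral[OF i]
      proof (intro nn_integral_mono)
        fix l assume l: "l \<in> space label"
        let ?r = "fst l"
        have r: "0 < ?r" "?r < 1" using label_bounds[OF l] by auto
        have two: "?r powr (2 * t) = ?r powr t * ?r powr t" by (simp add: powr_add[symmetric])
        have "ennreal (?r powr (2 * t)) * (\<integral>\<^sup>+\<omega>. ennreal (pair_sum t k (\<rho> / ?r) \<omega>) \<partial>space_lab)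
            \<le> ennreal (?r powr (2 * t)) * ennreal (A * (?c ^ k)\<^sup>2 * (\<rho> / ?r) powr t + ?c ^ k)"
          using Suc r by (intro mult_left_mono Suc.IH) auto
        also have "\<dots> = ennreal (?r powr (2 * t) * (A * (?c ^ k)\<^sup>2 * (\<rho> / ?r) powr t + ?c ^ k))"
          using A moment_nonneg by (intro ennreal_mult[symmetric] add_nonneg_nonneg mult_nonneg_nonneg zero_le_power) auto
        also have "?r powr (2 * t) * (A * (?c ^ k)\<^sup>2 * (\<rho> / ?r) powr t + ?c ^ k)
            = ?r powr t * (A * (?c ^ k)\<^sup>2 * \<rho> powr t + ?r powr t * ?c ^ k)"
        proof -
          have "?r powr t \<noteq> 0" using r by simp
          moreover have "(\<rho> / ?r) powr t = \<rho> powr t / ?r powr t"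
            using r Suc.prems by (simp add: powr_divide)
          ultimately show ?thesis unfolding two by (simp add: field_simps)
        qed
        also have "\<dots> \<le> ennreal (?r powr t * ?X)"
          using r t c by (intro ennreal_leI mult_left_mono add_left_mono mult_left_le_one_le powr_le1) auto
        also have "\<dots> = ennreal ?X * ennreal (?r powr t)"
          using X by (simp add: ennreal_mult[symmetric] mult.commute)
        finally show "ennreal (?r powr (2 * t)) * (\<integral>\<^sup>+\<omega>. ennreal (pair_sum t k (\<rho> / ?r) \<omega>) \<partial>space_lab)
            \<le> ennreal ?X * ennreal (?r powr t)" .
      qed
      also have "\<dots> = ennreal ?X * ennreal (moment t)"
        by (subst nn_integral_cmult) (auto simp: nn_integral_moment)
      also have "\<dots> = ennreal (moment t * ?X)"
        using X moment_nonneg by (simp add: ennreal_mult[symmetric] mult.commute)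
      finally show ?thesis .
    qed
    have off: "(\<integral>\<^sup>+\<omega>. ennreal (?S i j \<omega>) \<partial>space_lab) \<le> ennreal (C * \<rho> powr t * (?c ^ k)\<^sup>2)"
      if ij: "i \<in> {1..m}" "j \<in> {1..m}" "i \<noteq> j" for i j
    proof -
      have "(\<integral>\<^sup>+\<omega>. ennreal (?S i j \<omega>) \<partial>space_lab)
          = (\<integral>\<^sup>+\<omega>. (\<Sum>w\<in>words m k. \<Sum>v\<in>words m k. ennreal (pair_term t \<rho> (i # w) (j # v) \<omega>)) \<partial>space_lab)"
      proof (intro nn_integral_cong)
        fix \<omega> assume \<omega>: "\<omega> \<in> space space_lab"
        show "ennreal (?S i j \<omega>) = (\<Sum>w\<in>words m k. \<Sum>v\<in>words m k. ennreal (pair_term t \<rho> (i # w) (j # v) \<omega>))"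
          using ij \<omega> by (subst sum_ennreal[symmetric], intro sum_nonneg pair_term_nonneg set, simp_all)
            (intro sum.cong refl sum_ennreal[symmetric] pair_term_nonneg set, simp_all)
      qed
      also have "\<dots> = (\<Sum>w\<in>words m k. \<Sum>v\<in>words m k. (\<integral>\<^sup>+\<omega>. ennreal (pair_term t \<rho> (i # w) (j # v) \<omega>) \<partial>space_lab))"
        using measurable_pair_term[OF set[OF ij(1)] set[OF ij(2)]]
        by (subst nn_integral_sum, simp) (intro sum.cong refl nn_integral_sum, simp)
      also have "\<dots> \<le> (\<Sum>w\<in>words m k. \<Sum>v\<in>words m k. ennreal (C * \<rho> powr t * moment t ^ (k + k)))"
        using C(2)[OF ij wordsD(1) wordsD(1) Suc.prems] by (intro sum_mono) (simp add: wordsD(2))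
      also have "\<dots> = ennreal (real (m ^ k) * (real (m ^ k) * (C * \<rho> powr t * moment t ^ (k + k))))"
        by (simp only: sum_constant card_words ennreal_of_nat_eq_real_of_nat ennreal_mult'[OF of_nat_0_le_iff])
      also have "real (m ^ k) * (real (m ^ k) * (C * \<rho> powr t * moment t ^ (k + k))) = C * \<rho> powr t * (?c ^ k)\<^sup>2"
        by (simp add: power_add power_mult_distrib power2_eq_square)
      finally show ?thesis .
    qed
    have "(\<integral>\<^sup>+\<omega>. ennreal (pair_sum t (Suc k) \<rho> \<omega>) \<partial>space_lab)
        = (\<integral>\<^sup>+\<omega>. (\<Sum>i\<in>{1..m}. \<Sum>j\<in>{1..m}. ennreal (?S i j \<omega>)) \<partial>space_lab)"
    proof (intro nn_integral_cong)
      fix \<omega> assume \<omega>: "\<omega> \<in> space space_lab"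
      show "ennreal (pair_sum t (Suc k) \<rho> \<omega>) = (\<Sum>i\<in>{1..m}. \<Sum>j\<in>{1..m}. ennreal (?S i j \<omega>))"
        unfolding pair_sum_Suc
        by (subst sum_ennreal[symmetric], intro sum_nonneg S_nn \<omega>, assumption, assumption)
           (intro sum.cong refl sum_ennreal[symmetric] S_nn \<omega>)
    qed
    also have "\<dots> = (\<Sum>i\<in>{1..m}. \<Sum>j\<in>{1..m}. (\<integral>\<^sup>+\<omega>. ennreal (?S i j \<omega>) \<partial>space_lab))"
      by (subst nn_integral_sum, intro borel_measurable_sum measurable_compose[OF mS measurable_ennreal], assumption, assumption)
         (intro sum.cong refl nn_integral_sum measurable_compose[OF mS measurable_ennreal])
    \<comment> \<open>The off-diagonal bound is added for i = j as well, so that it is counted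
      exactly \<open>(real m)\<^sup>2\<close> times.\<close>
    also have "\<dots> \<le> (\<Sum>i\<in>{1..m}. \<Sum>j\<in>{1..m}. ennreal (of_bool (i = j) * (moment t * ?X) + C * \<rho> powr t * (?c ^ k)\<^sup>2))"
    proof (intro sum_mono)
      fix i j assume ij: "i \<in> {1..m}" "j \<in> {1..m}"
      show "(\<integral>\<^sup>+\<omega>. ennreal (?S i j \<omega>) \<partial>space_lab) \<le> ennreal (of_bool (i = j) * (moment t * ?X) + C * \<rho> powr t * (?c ^ k)\<^sup>2)"
      proof (cases "i = j")
        case True
        have "moment t * ?X \<le> of_bool (i = j) * (moment t * ?X) + C * \<rho> powr t * (?c ^ k)\<^sup>2"
          using True C(1) by simp
        then show ?thesis using order_trans[OF diag[OF ij(1)] ennreal_leI] True by blast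
      next
        case False
        then show ?thesis using off[OF ij False] by simp
      qed
    qed
    also have "\<dots> = ennreal (\<Sum>i\<in>{1..m}. \<Sum>j\<in>{1..m}. of_bool (i = j) * (moment t * ?X) + C * \<rho> powr t * (?c ^ k)\<^sup>2)"
    proof -
      have 1: "0 \<le> moment t * ?X" by (rule mult_nonneg_nonneg[OF moment_nonneg X])
      have 2: "0 \<le> C * \<rho> powr t * (?c ^ k)\<^sup>2" using C(1) by simp
      have nn: "0 \<le> of_bool (i = j) * (moment t * ?X) + C * \<rho> powr t * (?c ^ k)\<^sup>2" for i j :: nat
        by (rule add_nonneg_nonneg[OF _ 2], rule mult_nonneg_nonneg[OF _ 1]) simp
      show ?thesis using nn by (simp only: sum_ennreal sum_nonneg)
    qed
    also have "(\<Sum>i\<in>{1..m}. \<Sum>j\<in>{1..m}. of_bool (i = j) * (moment t * ?X) + C * \<rho> powr t * (?c ^ k)\<^sup>2)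
        = real m * (moment t * ?X) + (real m)\<^sup>2 * (C * \<rho> powr t * (?c ^ k)\<^sup>2)"
    proof -
      have "(\<Sum>j\<in>{1..m}. of_bool (i = j) * (moment t * ?X)) = moment t * ?X" if "i \<in> {1..m}" for i
      proof -
        have "(\<Sum>j\<in>{1..m}. of_bool (i = j) * (moment t * ?X)) = (\<Sum>j\<in>{1..m}. if i = j then moment t * ?X else 0)"
          by (intro sum.cong) auto
        then show ?thesis using that by (simp only: sum.delta' finite_atLeastAtMost if_True)
      qed
      then show ?thesis by (simp only: sum.distrib) (simp add: power2_eq_square)
    qed
    also have "\<dots> = (?c * A + (real m)\<^sup>2 * C) * (?c ^ k)\<^sup>2 * \<rho> powr t + ?c ^ Suc k"
      by (simp add: algebra_simps)
    also have "\<dots> = A * (?c ^ Suc k)\<^sup>2 * \<rho> powr t + ?c ^ Suc k"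
      unfolding A_eq by (simp add: power_mult_distrib mult_ac)
    finally show ?case .
  qed
  show ?thesis by (rule that[OF A bound])
qed

end

section \<open>Almost sure positivity and the theorem\<close>

lemma powr_less_1:
  fixes x e :: real
  shows "0 < x \<Longrightarrow> x < 1 \<Longrightarrow> 0 < e \<Longrightarrow> x powr e < 1"
  using powr_less_mono2[of e x 1] by simp

context distinct_ifs
begin

text \<open>All points lie within \<open>radius\<close> of 0, so at scale \<open>2 * radius\<close>
  every pair counts. The second moment of the mass is thus an instance of the pair sum
  bound.\<close>

lemma sum_wt_squared:
  assumes "\<omega> \<in> space space_lab"
  shows "(\<Sum>w\<in>words m k. wt t w \<omega>)\<^sup>2 = pair_sum t k (2 * radius) \<omega>"
proof -
  have "dist (pt w \<omega>) (pt v \<omega>) \<le> 2 * radius" if "w \<in> words m k" "v \<in> words m k" for w v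
  proof -
    have "dist (pt w \<omega>) (pt v \<omega>) \<le> norm (pt w \<omega>) + norm (pt v \<omega>)"
      unfolding dist_norm by (rule norm_triangle_ineq4)
    then show ?thesis
      using norm_projection_le[OF admissible_space[OF assms] extend_word_infinite[OF wordsD(1)[OF that(1)]]]
        norm_projection_le[OF admissible_space[OF assms] extend_word_infinite[OF wordsD(1)[OF that(2)]]] by linarith
  qed
  then show ?thesis
    unfolding pair_sum_def power2_eq_square sum_product by (intro sum.cong refl) simp
qed

text \<open>The weights \<open>e\<close> unify two uses: 2^(n u) at every scale yields truncated
  energies, and 2^(K d) at n = K alone yields a squared density at one scale. Individual weights may
  grow with K; only their sums against 2^(-n t) must stay bounded.\<close>

lemma good_event:
  assumes t: "0 \<le> t" "t \<le> real CARD('d)" and c: "1 < real m * moment t"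
    and e: "\<And>K n. 0 \<le> e K n" and E1: "\<And>K. (\<Sum>n\<le>K. e K n * ((1/2)^n) powr t) \<le> E1"
  obtains G M where "G \<in> sets space_lab" "0 < measure space_lab G" "0 < M"
    "\<And>\<omega> K0. \<omega> \<in> G \<Longrightarrow> \<exists>K\<ge>K0. \<exists>k. 1/2 \<le> (\<Sum>w\<in>words m k. wt t w \<omega> / (real m * moment t) ^ k) \<and>
       (\<Sum>n\<le>K. e K n * (pair_sum t k ((1/2)^n) \<omega> / ((real m * moment t) ^ k)\<^sup>2)) \<le> M"
proof -
  let ?c = "real m * moment t"
  obtain A where A: "0 \<le> A" "\<And>k \<rho>. 0 < \<rho> \<Longrightarrow> (\<integral>\<^sup>+\<omega>. ennreal (pair_sum t k \<rho> \<omega>) \<partial>space_lab)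
    \<le> ennreal (A * (?c ^ k)\<^sup>2 * \<rho> powr t + ?c ^ k)"
    using nn_integral_pair_sum_le[OF t c] by blast
  have A': "(\<integral>\<^sup>+\<omega>. ennreal (pair_sum t k \<rho> \<omega> / (?c ^ k)\<^sup>2) \<partial>space_lab) \<le> ennreal (A * \<rho> powr t + 1 / ?c ^ k)"
    if "0 < \<rho>" for k \<rho>
  proof -
    have "(\<integral>\<^sup>+\<omega>. ennreal (pair_sum t k \<rho> \<omega> / (?c ^ k)\<^sup>2) \<partial>space_lab)
        = (\<integral>\<^sup>+\<omega>. ennreal (1 / (?c ^ k)\<^sup>2) * ennreal (pair_sum t k \<rho> \<omega>) \<partial>space_lab)"
      by (intro nn_integral_cong) (simp add: ennreal_mult[symmetric] pair_sum_nonneg)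
    also have "\<dots> = ennreal (1 / (?c ^ k)\<^sup>2) * (\<integral>\<^sup>+\<omega>. ennreal (pair_sum t k \<rho> \<omega>) \<partial>space_lab)"
      by (rule nn_integral_cmult) measurable
    also have "\<dots> \<le> ennreal (1 / (?c ^ k)\<^sup>2) * ennreal (A * (?c ^ k)\<^sup>2 * \<rho> powr t + ?c ^ k)"
      by (intro mult_left_mono A(2) that) simp
    also have "\<dots> = ennreal (1 / (?c ^ k)\<^sup>2 * (A * (?c ^ k)\<^sup>2 * \<rho> powr t + ?c ^ k))"
      using A moment_nonneg by (intro ennreal_mult[symmetric] add_nonneg_nonneg mult_nonneg_nonneg zero_le_power) auto
    also have "1 / (?c ^ k)\<^sup>2 * (A * (?c ^ k)\<^sup>2 * \<rho> powr t + ?c ^ k) = A * \<rho> powr t + 1 / ?c ^ k"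
    proof -
      have alg: "1 / x\<^sup>2 * (A * x\<^sup>2 * y + x) = A * y + 1 / x" if "0 < x" for x y :: real
        using that by (simp add: field_simps power2_eq_square)
      have "0 < ?c" using c by linarith
      then show ?thesis by (intro alg zero_less_power)
    qed
    finally show ?thesis .
  qed
  \<comment> \<open>The generation is chosen so deep that the errors c^-k, summed with the weights,
    contribute at most 1.\<close>
  have "\<exists>k. (\<Sum>n\<le>K. e K n) \<le> ?c ^ k" for K
    using real_arch_pow[OF c] less_imp_le by blast
  then obtain \<kappa> where \<kappa>: "\<And>K. (\<Sum>n\<le>K. e K n) \<le> ?c ^ \<kappa> K" by metis
  define W where "W K \<omega> = (\<Sum>w\<in>words m (\<kappa> K). wt t w \<omega> / ?c ^ \<kappa> K)" for K \<omega>
  define Y where "Y K \<omega> = (\<Sum>n\<le>K. e K n * (pair_sum t (\<kappa> K) ((1/2)^n) \<omega> / (?c ^ \<kappa> K)\<^sup>2))" for K \<omega>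
  \<comment> \<open>The summands 1 in \<open>B\<close> and \<open>E\<close> cover the errors c^-k.
    Neither constant depends on K, which keeps the probabilities of the events uniformly
    positive.\<close>
  define B where "B = A * (2 * radius) powr t + 1"
  define E where "E = A * max E1 0 + 1"
  have pos: "0 < B" "0 < E" using A(1) by (auto simp: B_def E_def add_nonneg_pos)
  have c_pos: "0 < ?c ^ k" for k using c by simp
  have W_alt: "W K \<omega> = (\<Sum>w\<in>words m (\<kappa> K). wt t w \<omega>) / ?c ^ \<kappa> K" for K \<omega>
    by (simp add: W_def sum_divide_distrib)
  have W_meas: "W K \<in> borel_measurable space_lab" for K
    unfolding W_def[abs_def] by (intro borel_measurable_sum borel_measurable_divide measurable_wt wordsD(1)) auto
  have Y_meas: "Y K \<in> borel_measurable space_lab" for K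
    unfolding Y_def[abs_def] by measurable
  have W_nn: "0 \<le> W K \<omega>" if "\<omega> \<in> space space_lab" for K \<omega>
    unfolding W_def using c_pos that by (intro sum_nonneg divide_nonneg_nonneg wt_nonneg wordsD(1)) (auto simp: less_imp_le)
  have Y_nn: "0 \<le> Y K \<omega>" if "\<omega> \<in> space space_lab" for K \<omega>
    unfolding Y_def using e that pair_sum_nonneg by (intro sum_nonneg mult_nonneg_nonneg divide_nonneg_nonneg) auto
  have W_int: "(\<integral>\<^sup>+\<omega>. ennreal (W K \<omega>) \<partial>space_lab) = 1" for K
  proof -
    have "(\<integral>\<^sup>+\<omega>. ennreal (W K \<omega>) \<partial>space_lab)
        = (\<integral>\<^sup>+\<omega>. ennreal (1 / ?c ^ \<kappa> K) * ennreal (\<Sum>w\<in>words m (\<kappa> K). wt t w \<omega>) \<partial>space_lab)"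
    proof (intro nn_integral_cong)
      fix \<omega> assume \<omega>: "\<omega> \<in> space space_lab"
      have S: "0 \<le> (\<Sum>w\<in>words m (\<kappa> K). wt t w \<omega>)"
        by (intro sum_nonneg wt_nonneg[OF \<omega>] wordsD(1))
      have I: "0 \<le> 1 / ?c ^ \<kappa> K" by (rule divide_nonneg_nonneg[OF zero_le_one less_imp_le[OF c_pos]])
      show "ennreal (W K \<omega>) = ennreal (1 / ?c ^ \<kappa> K) * ennreal (\<Sum>w\<in>words m (\<kappa> K). wt t w \<omega>)"
        unfolding W_alt ennreal_mult[OF I S, symmetric] by simp
    qed
    also have "\<dots> = ennreal (1 / ?c ^ \<kappa> K) * ennreal (?c ^ \<kappa> K)"
      unfolding nn_integral_sum_wt[symmetric]
      by (intro nn_integral_cmult measurable_compose[OF _ measurable_ennreal] borel_measurable_sum measurable_wt wordsD(1))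
    also have "\<dots> = ennreal (1 / ?c ^ \<kappa> K * ?c ^ \<kappa> K)"
      using c_pos[of "\<kappa> K"] by (intro ennreal_mult[symmetric]) auto
    also have "1 / ?c ^ \<kappa> K * ?c ^ \<kappa> K = 1"
      using less_imp_neq[OF c_pos[of "\<kappa> K"], THEN not_sym] by (simp only: times_divide_eq_left mult_1 divide_self not_False_eq_True)
    finally show ?thesis by simp
  qed
  have W2_int: "(\<integral>\<^sup>+\<omega>. ennreal ((W K \<omega>)\<^sup>2) \<partial>space_lab) \<le> ennreal B" for K
  proof -
    have "(\<integral>\<^sup>+\<omega>. ennreal ((W K \<omega>)\<^sup>2) \<partial>space_lab)
        = (\<integral>\<^sup>+\<omega>. ennreal (pair_sum t (\<kappa> K) (2 * radius) \<omega> / (?c ^ \<kappa> K)\<^sup>2) \<partial>space_lab)"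
      by (intro nn_integral_cong) (simp only: W_alt power_divide sum_wt_squared)
    also have "\<dots> \<le> ennreal (A * (2 * radius) powr t + 1 / ?c ^ \<kappa> K)"
      using radius_pos by (intro A') auto
    also have "\<dots> \<le> ennreal B"
      unfolding B_def using c by (intro ennreal_leI add_left_mono) (simp add: one_le_power)
    finally show ?thesis .
  qed
  have Y_int: "(\<integral>\<^sup>+\<omega>. ennreal (Y K \<omega>) \<partial>space_lab) \<le> ennreal E" for K
  proof -
    have "(\<integral>\<^sup>+\<omega>. ennreal (Y K \<omega>) \<partial>space_lab)
        = (\<integral>\<^sup>+\<omega>. (\<Sum>n\<le>K. ennreal (e K n) * ennreal (pair_sum t (\<kappa> K) ((1/2)^n) \<omega> / (?c ^ \<kappa> K)\<^sup>2)) \<partial>space_lab)"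
    proof (intro nn_integral_cong)
      fix \<omega> assume \<omega>: "\<omega> \<in> space space_lab"
      have "0 \<le> pair_sum t (\<kappa> K) ((1/2)^n) \<omega> / (?c ^ \<kappa> K)\<^sup>2" for n using pair_sum_nonneg[OF \<omega>] by simp
      then show "ennreal (Y K \<omega>) = (\<Sum>n\<le>K. ennreal (e K n) * ennreal (pair_sum t (\<kappa> K) ((1/2)^n) \<omega> / (?c ^ \<kappa> K)\<^sup>2))"
        unfolding Y_def using e by (simp only: ennreal_mult[symmetric] sum_ennreal mult_nonneg_nonneg)
    qed
    also have "\<dots> = (\<Sum>n\<le>K. (\<integral>\<^sup>+\<omega>. ennreal (e K n) * ennreal (pair_sum t (\<kappa> K) ((1/2)^n) \<omega> / (?c ^ \<kappa> K)\<^sup>2) \<partial>space_lab))"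
      by (rule nn_integral_sum) measurable
    also have "\<dots> = (\<Sum>n\<le>K. ennreal (e K n) * (\<integral>\<^sup>+\<omega>. ennreal (pair_sum t (\<kappa> K) ((1/2)^n) \<omega> / (?c ^ \<kappa> K)\<^sup>2) \<partial>space_lab))"
      by (intro sum.cong refl nn_integral_cmult) measurable
    also have "\<dots> \<le> (\<Sum>n\<le>K. ennreal (e K n) * ennreal (A * ((1/2)^n) powr t + 1 / ?c ^ \<kappa> K))"
      by (intro sum_mono mult_left_mono A') auto
    also have "\<dots> = ennreal (\<Sum>n\<le>K. e K n * (A * ((1/2)^n) powr t + 1 / ?c ^ \<kappa> K))"
    proof -
      have "0 \<le> A * ((1/2)^n) powr t + 1 / ?c ^ \<kappa> K" for n :: nat
        using A(1) c_pos[of "\<kappa> K"] by (intro add_nonneg_nonneg) auto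
      then show ?thesis using e by (simp only: ennreal_mult[symmetric] sum_ennreal mult_nonneg_nonneg)
    qed
    also have "\<dots> \<le> ennreal E"
    proof (rule ennreal_leI)
      have "(\<Sum>n\<le>K. e K n * (A * ((1/2)^n) powr t + 1 / ?c ^ \<kappa> K))
          = A * (\<Sum>n\<le>K. e K n * ((1/2)^n) powr t) + (\<Sum>n\<le>K. e K n) / ?c ^ \<kappa> K"
        by (simp add: sum.distrib sum_distrib_left sum_divide_distrib distrib_left mult_ac)
      also have "\<dots> \<le> A * max E1 0 + 1"
        using E1[of K] \<kappa>[of K] c_pos[of "\<kappa> K"] A(1) by (intro add_mono mult_left_mono) (auto simp: divide_le_eq)
      finally show "(\<Sum>n\<le>K. e K n * (A * ((1/2)^n) powr t + 1 / ?c ^ \<kappa> K)) \<le> E" by (simp add: E_def)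
    qed
    finally show ?thesis .
  qed
  let ?G = "\<lambda>K. {\<omega>\<in>space space_lab. 1/2 \<le> W K \<omega> \<and> Y K \<omega> \<le> 8 * B * E}"
  have G_sets: "?G K \<in> sets space_lab" for K
    using W_meas[of K, measurable] Y_meas[of K, measurable] by measurable
  have G_prob: "1 / (8 * B) \<le> measure space_lab (?G K)" for K
    by (rule lab.second_moment_event[OF W_meas Y_meas W_nn Y_nn W_int W2_int Y_int pos])
  show ?thesis
  proof (rule that[of "\<Inter>K. \<Union>n\<in>{K..}. ?G n" "8 * B * E"])
    show "(\<Inter>K. \<Union>n\<in>{K..}. ?G n) \<in> sets space_lab" using G_sets by auto
    have "0 < 1 / (8 * B)" using pos by simp
    also have "\<dots> \<le> measure space_lab (\<Inter>K. \<Union>n\<in>{K..}. ?G n)"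
      by (rule lab.prob_infinitely_often_ge[OF G_sets G_prob])
    finally show "0 < measure space_lab (\<Inter>K. \<Union>n\<in>{K..}. ?G n)" .
    show "0 < 8 * B * E" using pos by simp
    fix \<omega> K0 assume "\<omega> \<in> (\<Inter>K. \<Union>n\<in>{K..}. ?G n)"
    then obtain K where "K0 \<le> K" "1/2 \<le> W K \<omega>" "Y K \<omega> \<le> 8 * B * E" by blast
    then show "\<exists>K\<ge>K0. \<exists>k. 1/2 \<le> (\<Sum>w\<in>words m k. wt t w \<omega> / ?c ^ k) \<and>
       (\<Sum>n\<le>K. e K n * (pair_sum t k ((1/2)^n) \<omega> / (?c ^ k)\<^sup>2)) \<le> 8 * B * E"
      unfolding W_def Y_def by blast
  qed
qed

section \<open>From positive probability to almost sure statements\<close>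

lemma measurable_shift_funpow:
  assumes "i \<in> {1..m}" shows "(shift i ^^ n) \<in> measurable space_lab space_lab"
proof (induction n)
  case 0
  show ?case by (simp add: id_def)
next
  case (Suc n)
  show ?case unfolding funpow.simps by (rule measurable_comp[OF Suc measurable_shift[OF assms]])
qed

text \<open>The subtrees below the words \<open>1\<^sup>n2\<close> are independent copies of the whole tree; hence the event
  \<open>B\<close> that none of them lies in \<open>G\<close> satisfies \<open>P B = (1 - P G) P B\<close>.\<close>

lemma AE_shift_in:
  assumes m2: "2 \<le> m" and G[measurable]: "G \<in> sets space_lab" and pos: "0 < measure space_lab G"
  shows "AE \<omega> in space_lab. \<exists>n. shift 2 ((shift 1 ^^ n) \<omega>) \<in> G"
proof -
  have i: "(1::nat) \<in> {1..m}" "(2::nat) \<in> {1..m}" "(2::nat) \<noteq> 1" using m2 by auto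
  note [measurable] = measurable_shift[OF i(1)] measurable_shift[OF i(2)] measurable_shift_funpow[OF i(1)]
  define B where "B = {\<omega>\<in>space space_lab. \<forall>n. shift 2 ((shift 1 ^^ n) \<omega>) \<notin> G}"
  have "(\<lambda>\<omega>. shift 2 ((shift 1 ^^ n) \<omega>)) \<in> measurable space_lab space_lab" for n
    by (rule measurable_compose[OF measurable_shift_funpow[OF i(1)] measurable_shift[OF i(2)]])
  then have B: "B \<in> sets space_lab" unfolding B_def by measurable
  \<comment> \<open>The condition for n = 0 concerns the subtree below 2, and all later ones
    together say that the subtree below 1 lies in \<open>B\<close>; these two subtrees are
    independent.\<close>
  have step: "\<omega> \<in> B \<longleftrightarrow> shift 2 \<omega> \<in> space space_lab - G \<and> shift 1 \<omega> \<in> B" if \<omega>: "\<omega> \<in> space space_lab" for \<omega>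
  proof -
    have "(\<forall>n. Q n) \<longleftrightarrow> Q 0 \<and> (\<forall>n. Q (Suc n))" for Q :: "nat \<Rightarrow> bool"
      by (metis nat.exhaust)
    from this[of "\<lambda>n. shift 2 ((shift 1 ^^ n) \<omega>) \<notin> G"]
    have "(\<forall>n. shift 2 ((shift 1 ^^ n) \<omega>) \<notin> G) \<longleftrightarrow> shift 2 \<omega> \<notin> G \<and> (\<forall>n. shift 2 ((shift 1 ^^ n) (shift 1 \<omega>)) \<notin> G)"
      by (simp add: funpow_Suc_right del: funpow.simps(2))
    then show ?thesis
      using measurable_space[OF measurable_shift[OF i(1)] \<omega>] measurable_space[OF measurable_shift[OF i(2)] \<omega>] \<omega>
      by (auto simp: B_def)
  qed
  have "emeasure space_lab B = (\<integral>\<^sup>+\<omega>. indicator B \<omega> \<partial>space_lab)" using B by simp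
  also have "\<dots> = (\<integral>\<^sup>+\<omega>. indicator (space space_lab - G) (shift 2 \<omega>) * indicator B (shift 1 \<omega>) \<partial>space_lab)"
    by (intro nn_integral_cong) (auto simp: indicator_def step)
  also have "\<dots> = emeasure space_lab (space space_lab - G) * emeasure space_lab B"
    using B by (subst nn_integral_shifts[OF i(2,1,3)]) auto
  finally have "measure space_lab B = measure space_lab (space space_lab - G) * measure space_lab B"
    by (simp add: lab.emeasure_eq_measure ennreal_mult[symmetric])
  also have "measure space_lab (space space_lab - G) = 1 - measure space_lab G"
    by (rule lab.prob_compl[OF G])
  finally have "measure space_lab G * measure space_lab B = 0" by (simp add: algebra_simps)
  then have "measure space_lab B = 0" using pos by simp
  then have "B \<in> null_sets space_lab" using B by (auto simp: null_sets_def lab.emeasure_eq_measure)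
  then show ?thesis by (rule AE_I') (auto simp: B_def)
qed

text \<open>\<open>P\<close> is inherited upwards from subtrees, so one subtree in \<open>G\<close>
  suffices. Measurability is asked of \<open>G\<close> alone, since \<open>P\<close> will be a
  statement about Hausdorff or Lebesgue measure.\<close>

lemma AE_of_positive_probability:
  assumes m2: "2 \<le> m" and G: "G \<in> sets space_lab" "0 < measure space_lab G" "\<And>\<omega>. \<omega> \<in> G \<Longrightarrow> P \<omega>"
    and P: "\<And>\<omega> i. \<omega> \<in> space space_lab \<Longrightarrow> i \<in> {1..m} \<Longrightarrow> P (shift i \<omega>) \<Longrightarrow> P \<omega>"
  shows "AE \<omega> in space_lab. P \<omega>"
proof (rule AE_mp[OF AE_shift_in[OF m2 G(1,2)]], intro AE_I2 impI)
  have i: "(1::nat) \<in> {1..m}" "(2::nat) \<in> {1..m}" using m2 by auto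
  have down: "P ((shift 1 ^^ n) \<omega>) \<Longrightarrow> \<omega> \<in> space space_lab \<Longrightarrow> P \<omega>" for n \<omega>
  proof (induction n arbitrary: \<omega>)
    case (Suc n)
    have "P ((shift 1 ^^ n) (shift 1 \<omega>))"
      using Suc.prems(1) by (simp add: funpow_Suc_right del: funpow.simps(2))
    from Suc.IH[OF this measurable_space[OF measurable_shift[OF i(1)] Suc.prems(2)]]
    have "P (shift 1 \<omega>)" .
    then show ?case using P[OF Suc.prems(2) i(1)] by simp
  qed simp
  fix \<omega> assume \<omega>: "\<omega> \<in> space space_lab" and "\<exists>n. shift 2 ((shift 1 ^^ n) \<omega>) \<in> G"
  then obtain n where "shift 2 ((shift 1 ^^ n) \<omega>) \<in> G" by blast
  then have "P (shift 2 ((shift 1 ^^ n) \<omega>))" by (rule G(3))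
  then have "P ((shift 1 ^^ n) \<omega>)"
    by (rule P[OF measurable_space[OF measurable_shift_funpow[OF i(1)] \<omega>] i(2)])
  then show "P \<omega>" using \<omega> by (rule down)
qed

text \<open>The masses have exponent t and the energy the smaller exponent u, so the pair bound
  \<rho>^t makes the expected energy a geometric series of ratio 2^-(t-u).\<close>

lemma AE_hausdorff_measure_nonzero:
  assumes m2: "2 \<le> m" and u: "0 < u" "u < t" and t: "t \<le> real CARD('d)" and c: "1 < real m * moment t"
  shows "AE \<omega> in space_lab. hausdorff_measure u (fractal \<omega>) \<noteq> 0"
proof -
  let ?c = "real m * moment t"
  let ?q = "(1/2::real) powr (t - u)"
  have q: "0 < ?q" "?q < 1" using u by (auto intro: powr_less_1)
  have "(\<Sum>n\<le>K. ((1/2)^n) powr (-u) * ((1/2)^n) powr t) \<le> 1 / (1 - ?q)" for K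
  proof -
    have "((1/2::real)^n) powr (-u) * ((1/2)^n) powr t = ?q ^ n" for n
      by (simp add: powr_add[symmetric] powr_realpow[symmetric] powr_powr algebra_simps)
    then have "(\<Sum>n\<le>K. ((1/2)^n) powr (-u) * ((1/2)^n) powr t) = (\<Sum>n\<le>K. ?q ^ n)" by simp
    also have "\<dots> \<le> (\<Sum>n. ?q ^ n)" using q by (intro sum_le_suminf summable_geometric) auto
    also have "\<dots> = 1 / (1 - ?q)" using q by (intro suminf_geometric) auto
    finally show ?thesis .
  qed
  then obtain G M where G: "G \<in> sets space_lab" "0 < measure space_lab G" and M: "0 < M"
    and en: "\<And>\<omega> K0. \<omega> \<in> G \<Longrightarrow> \<exists>K\<ge>K0. \<exists>k. 1/2 \<le> (\<Sum>w\<in>words m k. wt t w \<omega> / ?c ^ k) \<and>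
       (\<Sum>n\<le>K. ((1/2)^n) powr (-u) * (pair_sum t k ((1/2)^n) \<omega> / (?c ^ k)\<^sup>2)) \<le> M"
    using good_event[of t "\<lambda>K n. ((1/2)^n) powr (-u)" "1 / (1 - ?q)"] u t c by auto
  have good: "hausdorff_measure u (fractal \<omega>) \<noteq> 0" if \<omega>: "\<omega> \<in> G" for \<omega>
  proof -
    have sp: "\<omega> \<in> space space_lab" using \<omega> G(1) sets.sets_into_space by blast
    have adm: "admissible \<omega>" by (rule admissible_space[OF sp])
    show ?thesis
    proof (rule hausdorff_measure_nonzero_energy[OF compact_fractal[OF adm] u(1) M])
      fix K0 :: nat
      obtain K k where K: "K0 \<le> K" and mass: "1/2 \<le> (\<Sum>w\<in>words m k. wt t w \<omega> / ?c ^ k)"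
        and E: "(\<Sum>n\<le>K. ((1/2)^n) powr (-u) * (pair_sum t k ((1/2)^n) \<omega> / (?c ^ k)\<^sup>2)) \<le> M"
        using en[OF \<omega>, of K0] by blast
      have eq: "(\<Sum>w\<in>words m k. \<Sum>v\<in>words m k. wt t w \<omega> / ?c ^ k * (wt t v \<omega> / ?c ^ k) * of_bool (dist (pt w \<omega>) (pt v \<omega>) \<le> \<rho>))
          = pair_sum t k \<rho> \<omega> / (?c ^ k)\<^sup>2" for \<rho>
        unfolding pair_sum_def sum_divide_distrib by (simp add: power2_eq_square del: sum_mult_of_bool_eq sum_of_bool_mult_eq)
      \<comment> \<open>The good cut-off K may exceed the requested K0; dropping nonnegative terms
        keeps the bound.\<close>
      have "(\<Sum>n\<le>K0. ((1/2)^n) powr (-u) * (pair_sum t k ((1/2)^n) \<omega> / (?c ^ k)\<^sup>2))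
          \<le> (\<Sum>n\<le>K. ((1/2)^n) powr (-u) * (pair_sum t k ((1/2)^n) \<omega> / (?c ^ k)\<^sup>2))"
        using K pair_sum_nonneg[OF sp] by (intro sum_mono2) auto
      also note E
      finally have le: "(\<Sum>n\<le>K0. ((1/2)^n) powr (-u) * (\<Sum>w\<in>words m k. \<Sum>v\<in>words m k. wt t w \<omega> / ?c ^ k * (wt t v \<omega> / ?c ^ k) * of_bool (dist (pt w \<omega>) (pt v \<omega>) \<le> (1/2)^n))) \<le> M"
        by (simp only: eq)
      have nn: "\<forall>w\<in>words m k. 0 \<le> wt t w \<omega> / ?c ^ k \<and> pt w \<omega> \<in> fractal \<omega>"
        using c wt_nonneg[OF sp] pt_in_fractal by (auto dest!: wordsD(1) intro!: divide_nonneg_nonneg zero_le_power)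
      show "\<exists>(I::nat list set) \<mu> p. finite I \<and> (\<forall>i\<in>I. 0 \<le> \<mu> i \<and> p i \<in> fractal \<omega>) \<and> 1/2 \<le> sum \<mu> I \<and>
       (\<Sum>n\<le>K0. ((1/2)^n) powr (-u) * (\<Sum>i\<in>I. \<Sum>j\<in>I. \<mu> i * \<mu> j * of_bool (dist (p i) (p j) \<le> (1/2)^n))) \<le> M"
        by (intro exI[of _ "words m k"] exI[of _ "\<lambda>w. wt t w \<omega> / ?c ^ k"] exI[of _ "\<lambda>w. pt w \<omega>"] conjI
            finite_set_words nn mass le)
    qed
  qed
  show ?thesis
  proof (rule AE_of_positive_probability[OF m2 G good])
    fix \<omega> i assume "\<omega> \<in> space space_lab" "i \<in> {1..m}" "hausdorff_measure u (fractal (shift i \<omega>)) \<noteq> 0"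
    then show "hausdorff_measure u (fractal \<omega>) \<noteq> 0"
      using hausdorff_measure_0_shift[OF admissible_space _ less_imp_le[OF u(1)]] by blast
  qed
qed

lemma AE_not_negligible:
  assumes m2: "2 \<le> m" and c: "1 < real m * moment (real CARD('d))"
  shows "AE \<omega> in space_lab. \<not> negligible (fractal \<omega>)"
proof -
  let ?t = "real CARD('d)"
  let ?c = "real m * moment ?t"
  \<comment> \<open>Only the scale n = K carries weight. Dividing by \<rho>^d turns the pair mass
    into a squared density, with no sum over scales; this is why the exponent may equal d
    here.\<close>
  let ?e = "\<lambda>K n. of_bool (n = K) * (1 / ((1/2)^K) ^ CARD('d)) :: real"
  have pick: "(\<Sum>n\<le>K. ?e K n * f n) = f K / ((1/2)^K) ^ CARD('d)" for K and f :: "nat \<Rightarrow> real"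
  proof -
    have "(\<Sum>n\<le>K. ?e K n * f n) = (\<Sum>n\<le>K. if n = K then f K / ((1/2)^K) ^ CARD('d) else 0)"
      by (intro sum.cong) auto
    then show ?thesis by (simp only: sum.delta finite_atMost) simp
  qed
  have "(\<Sum>n\<le>K. ?e K n * ((1/2)^n) powr ?t) \<le> 1" for K
    unfolding pick by (simp add: powr_realpow)
  then obtain G M where G: "G \<in> sets space_lab" "0 < measure space_lab G" and M: "0 < M"
    and en: "\<And>\<omega> K0. \<omega> \<in> G \<Longrightarrow> \<exists>K\<ge>K0. \<exists>k. 1/2 \<le> (\<Sum>w\<in>words m k. wt ?t w \<omega> / ?c ^ k) \<and>
       (\<Sum>n\<le>K. ?e K n * (pair_sum ?t k ((1/2)^n) \<omega> / (?c ^ k)\<^sup>2)) \<le> M"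
    using good_event[of ?t ?e 1] c by auto
  have good: "\<not> negligible (fractal \<omega>)" if \<omega>: "\<omega> \<in> G" for \<omega>
  proof -
    have sp: "\<omega> \<in> space space_lab" using \<omega> G(1) sets.sets_into_space by blast
    have adm: "admissible \<omega>" by (rule admissible_space[OF sp])
    show ?thesis
    proof (rule lebesgue_nonzero_pair_sum[OF compact_fractal[OF adm] M])
      fix K0 :: nat
      obtain K k where K: "K0 \<le> K" and mass: "1/2 \<le> (\<Sum>w\<in>words m k. wt ?t w \<omega> / ?c ^ k)"
        and E: "(\<Sum>n\<le>K. ?e K n * (pair_sum ?t k ((1/2)^n) \<omega> / (?c ^ k)\<^sup>2)) \<le> M"
        using en[OF \<omega>, of K0] by blast
      have eq: "(\<Sum>w\<in>words m k. \<Sum>v\<in>words m k. wt ?t w \<omega> / ?c ^ k * (wt ?t v \<omega> / ?c ^ k) * of_bool (dist (pt w \<omega>) (pt v \<omega>) \<le> \<rho>))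
          = pair_sum ?t k \<rho> \<omega> / (?c ^ k)\<^sup>2" for \<rho>
        unfolding pair_sum_def sum_divide_distrib by (simp add: power2_eq_square del: sum_mult_of_bool_eq sum_of_bool_mult_eq)
      have h: "0 < ((1/2::real)^K) ^ CARD('d)" by simp
      have "pair_sum ?t k ((1/2)^K) \<omega> / (?c ^ k)\<^sup>2 \<le> M * ((1/2)^K) ^ CARD('d)"
        using E unfolding pick pos_divide_le_eq[OF h] .
      then have le: "(\<Sum>w\<in>words m k. \<Sum>v\<in>words m k. wt ?t w \<omega> / ?c ^ k * (wt ?t v \<omega> / ?c ^ k) * of_bool (dist (pt w \<omega>) (pt v \<omega>) \<le> (1/2)^K)) \<le> M * ((1/2)^K) ^ DIM(real^'d)"
        by (simp only: eq) simp
      have nn: "\<forall>w\<in>words m k. 0 \<le> wt ?t w \<omega> / ?c ^ k \<and> pt w \<omega> \<in> fractal \<omega>"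
        using c wt_nonneg[OF sp] pt_in_fractal by (auto dest!: wordsD(1) intro!: divide_nonneg_nonneg zero_le_power)
      show "\<exists>n\<ge>K0. \<exists>(I::nat list set) \<mu> p. finite I \<and> (\<forall>i\<in>I. 0 \<le> \<mu> i \<and> p i \<in> fractal \<omega>) \<and> 1/2 \<le> sum \<mu> I \<and>
       (\<Sum>i\<in>I. \<Sum>j\<in>I. \<mu> i * \<mu> j * of_bool (dist (p i) (p j) \<le> (1/2)^n)) \<le> M * ((1/2)^n) ^ DIM(real^'d)"
        by (intro exI[of _ K] exI[of _ "words m k"] exI[of _ "\<lambda>w. wt ?t w \<omega> / ?c ^ k"] exI[of _ "\<lambda>w. pt w \<omega>"] conjI
            K finite_set_words nn mass le)
    qed
  qed
  show ?thesis
  proof (rule AE_of_positive_probability[OF m2 G good])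
    fix \<omega> i assume "\<omega> \<in> space space_lab" "i \<in> {1..m}" "\<not> negligible (fractal (shift i \<omega>))"
    then show "\<not> negligible (fractal \<omega>)"
      using negligible_shift[OF admissible_space] by blast
  qed
qed

text \<open>The infimum of the covering sums over all late generations has expectation below every
  term of a null sequence, hence vanishes almost surely; the sums themselves are never shown to
  converge.\<close>

lemma AE_hausdorff_measure_zero:
  assumes t: "0 \<le> t" and c: "real m * moment t < 1"
  shows "AE \<omega> in space_lab. hausdorff_measure t (fractal \<omega>) = 0"
proof -
  let ?c = "real m * moment t"
  let ?S = "\<lambda>k \<omega>. ennreal ((4 * radius) powr t) * ennreal (\<Sum>w\<in>words m k. wt t w \<omega>)"
  \<comment> \<open>Starting the infimum at K discards coarse covers: for any mesh, all generations
    from a suitable K on are fine enough.\<close>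
  define Z where "Z K \<omega> = (INF k\<in>{K..}. ?S k \<omega>)" for K \<omega>
  have S_meas: "?S k \<in> borel_measurable space_lab" for k
    by (intro borel_measurable_times_ennreal borel_measurable_const measurable_compose[OF _ measurable_ennreal]
        borel_measurable_sum measurable_wt wordsD(1))
  have Z_meas: "Z K \<in> borel_measurable space_lab" for K
    unfolding Z_def[abs_def] by (intro borel_measurable_INF S_meas) auto
  have c0: "0 \<le> ?c" using moment_nonneg by simp
  have "AE \<omega> in space_lab. Z K \<omega> = 0" for K
  proof -
    have "(\<integral>\<^sup>+\<omega>. Z K \<omega> \<partial>space_lab) \<le> ennreal ((4 * radius) powr t * ?c ^ k)" if "K \<le> k" for k
    proof -
      have "(\<integral>\<^sup>+\<omega>. Z K \<omega> \<partial>space_lab) \<le> (\<integral>\<^sup>+\<omega>. ?S k \<omega> \<partial>space_lab)"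
        unfolding Z_def using that by (intro nn_integral_mono INF_lower) auto
      also have "\<dots> = ennreal ((4 * radius) powr t) * ennreal (?c ^ k)"
        unfolding nn_integral_sum_wt[symmetric]
        by (intro nn_integral_cmult measurable_compose[OF _ measurable_ennreal] borel_measurable_sum measurable_wt wordsD(1))
      also have "\<dots> = ennreal ((4 * radius) powr t * ?c ^ k)" using c0 by (intro ennreal_mult[symmetric]) auto
      finally show ?thesis .
    qed
    moreover have "(\<lambda>k. ennreal ((4 * radius) powr t * ?c ^ k)) \<longlonglongrightarrow> ennreal ((4 * radius) powr t * 0)"
      using c0 c by (intro tendsto_ennrealI tendsto_mult tendsto_const LIMSEQ_power_zero) auto
    ultimately have "(\<integral>\<^sup>+\<omega>. Z K \<omega> \<partial>space_lab) \<le> ennreal ((4 * radius) powr t * 0)"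
      by (intro LIMSEQ_le_const) auto
    then show ?thesis using Z_meas by (simp add: nn_integral_0_iff_AE)
  qed
  then have "AE \<omega> in space_lab. \<forall>K. Z K \<omega> = 0" by (simp add: AE_all_countable)
  then show ?thesis
  proof (rule AE_mp, intro AE_I2 impI)
    fix \<omega> assume \<omega>: "\<omega> \<in> space space_lab" and Z: "\<forall>K. Z K \<omega> = 0"
    note adm = admissible_space[OF \<omega>]
    show "hausdorff_measure t (fractal \<omega>) = 0"
      unfolding hausdorff_measure_eq_0_iff
    proof (intro allI impI)
      fix \<delta> :: real assume \<delta>: "0 < \<delta>"
      have "0 < \<delta> / (4 * radius)" using \<delta> radius_pos by simp
      then obtain K where K: "hi ^ K < \<delta> / (4 * radius)" using real_arch_pow_inv hi_1 by blast
      have "4 * radius * hi ^ k \<le> \<delta>" if "K \<le> k" for k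
      proof -
        have "hi ^ k \<le> hi ^ K" using that hi_pos hi_1 by (intro power_decreasing) auto
        then have "hi ^ k \<le> \<delta> / (4 * radius)" using K by linarith
        then show ?thesis using radius_pos by (simp add: field_simps)
      qed
      then have "hausdorff_premeasure t \<delta> (fractal \<omega>) \<le> Z K \<omega>"
        unfolding Z_def using hausdorff_premeasure_fractal_le[OF adm t] by (intro INF_greatest) auto
      then show "hausdorff_premeasure t \<delta> (fractal \<omega>) = 0" using Z by simp
    qed
  qed
qed

section \<open>Location of the exponent and the value of the dimension\<close>

lemma moment_gt_1:
  assumes "real m * moment s = 1" "t < s" shows "1 < real m * moment t"
proof -
  have "1 \<le> real m * (hi powr (s - t) * moment t)"
    using assms moment_le[of t s] by (metis less_imp_le mult_left_mono of_nat_0_le_iff)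
  also have "\<dots> = hi powr (s - t) * (real m * moment t)" by simp
  finally have *: "1 \<le> hi powr (s - t) * (real m * moment t)" .
  have "hi powr (s - t) < 1" using hi_pos hi_1 assms(2) by (intro powr_less_1) auto
  moreover have "0 < real m * moment t"
    using * moment_nonneg[of t] by (smt (verit) mult_nonneg_nonneg mult_eq_0_iff of_nat_0_le_iff)
  ultimately have "hi powr (s - t) * (real m * moment t) < 1 * (real m * moment t)"
    by (rule mult_strict_right_mono)
  then show ?thesis using * by linarith
qed

lemma moment_less_1:
  assumes "real m * moment s = 1" "s < t" shows "real m * moment t < 1"
proof -
  have "real m * moment t \<le> real m * (hi powr (t - s) * moment s)"
    using assms moment_le[of s t] by (intro mult_left_mono) auto
  also have "\<dots> = hi powr (t - s)" using assms(1) by (simp add: algebra_simps)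
  also have "\<dots> < 1" using hi_pos hi_1 assms(2) by (intro powr_less_1) auto
  finally show ?thesis .
qed

text \<open>If s were negative, then 0 would exceed s and \<open>real m * moment 0\<close>, which is
  m, would be below 1.\<close>

lemma exponent_nonneg:
  assumes "real m * moment s = 1" shows "0 \<le> s"
  using moment_less_1[OF assms, of 0] m_pos by (force simp: moment_0)

text \<open>At exponent 0 < s the value is m itself and exceeds 1. This supplies the second symbol
  used in the zero-one argument.\<close>

lemma two_le_m:
  assumes "real m * moment s = 1" "0 < s" shows "2 \<le> m"
  using moment_gt_1[OF assms] by (simp add: moment_0)

text \<open>Exponents decreasing to s form a countable family, so their exceptional null sets
  combine; the bound d holds for every admissible labelling.\<close>

lemma AE_dim_le:
  assumes s: "real m * moment s = 1"
  shows "AE \<omega> in space_lab. hausdorff_dim (fractal \<omega>) \<le> ereal (min s (real CARD('d)))"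
proof -
  have "AE \<omega> in space_lab. \<forall>n::nat. hausdorff_measure (s + 1 / real (Suc n)) (fractal \<omega>) = 0"
    unfolding AE_all_countable
    using exponent_nonneg[OF s] by (intro allI AE_hausdorff_measure_zero moment_less_1[OF s]) (auto intro: add_nonneg_nonneg)
  then show ?thesis
  proof (rule AE_mp, intro AE_I2 impI)
    fix \<omega> assume \<omega>: "\<omega> \<in> space space_lab" and H: "\<forall>n::nat. hausdorff_measure (s + 1 / real (Suc n)) (fractal \<omega>) = 0"
    have le: "hausdorff_dim (fractal \<omega>) \<le> ereal u" if "0 \<le> u" "hausdorff_measure u (fractal \<omega>) = 0" for u
      unfolding hausdorff_dim_def using that by (intro INF_lower) auto
    have "hausdorff_dim (fractal \<omega>) \<le> ereal s"
    proof (rule ereal_le_epsilon2)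
      fix e :: real assume "0 < e"
      then obtain n where n: "1 / real (Suc n) < e" using nat_approx_posE by (metis inverse_eq_divide reals_Archimedean)
      have "hausdorff_dim (fractal \<omega>) \<le> ereal (s + 1 / real (Suc n))"
        using H exponent_nonneg[OF s] by (intro le) (auto intro: add_nonneg_nonneg)
      also have "\<dots> \<le> ereal (s + e)" using n by simp
      finally show "hausdorff_dim (fractal \<omega>) \<le> ereal s + ereal e" by simp
    qed
    moreover have "hausdorff_dim (fractal \<omega>) \<le> ereal (real CARD('d))"
    proof (rule ereal_le_epsilon2)
      fix e :: real assume "0 < e"
      then have "hausdorff_dim (fractal \<omega>) \<le> ereal (real CARD('d) + e)"
        by (intro le hausdorff_measure_above_dim_eq_0 bounded_fractal admissible_space[OF \<omega>]) auto
      then show "hausdorff_dim (fractal \<omega>) \<le> ereal (real CARD('d)) + ereal e" by simp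
    qed
    ultimately show "hausdorff_dim (fractal \<omega>) \<le> ereal (min s (real CARD('d)))" by (simp add: min_def)
  qed
qed

lemma AE_dim_ge:
  assumes s: "real m * moment s = 1"
  shows "AE \<omega> in space_lab. ereal (min s (real CARD('d))) \<le> hausdorff_dim (fractal \<omega>)"
proof (cases "s = 0")
  case True
  then show ?thesis by (intro AE_I2) (auto simp: hausdorff_dim_def intro!: INF_greatest)
next
  case False
  then have s0: "0 < s" using exponent_nonneg[OF s] by simp
  define b where "b = min s (real CARD('d))"
  have b: "0 < b" "b \<le> s" "b \<le> real CARD('d)" using s0 by (auto simp: b_def)
  \<comment> \<open>The shift by 2 makes already \<open>u 0\<close> positive, as the energy
    criterion requires; all \<open>u n\<close> stay below their limit \<open>b\<close>.\<close>
  define u where "u n = b * (1 - 1 / real (n + 2))" for n :: nat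
  have u: "0 < u n" "u n < b" for n
    using b by (auto simp: u_def field_simps intro: add_pos_nonneg)
  have "AE \<omega> in space_lab. \<forall>n. hausdorff_measure (u n) (fractal \<omega>) \<noteq> 0"
    unfolding AE_all_countable
  proof
    fix n
    \<comment> \<open>The mass exponent is the midpoint of \<open>u n\<close> and \<open>b\<close>:
      above the energy exponent, yet below s and at most d.\<close>
    show "AE \<omega> in space_lab. hausdorff_measure (u n) (fractal \<omega>) \<noteq> 0"
      using u[of n] b by (intro AE_hausdorff_measure_nonzero[where t="(u n + b) / 2"] two_le_m[OF s s0] moment_gt_1[OF s]) auto
  qed
  then show ?thesis
  proof eventually_elim
    fix \<omega> assume H: "\<forall>n. hausdorff_measure (u n) (fractal \<omega>) \<noteq> 0"
    show "ereal (min s (real CARD('d))) \<le> hausdorff_dim (fractal \<omega>)"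
      unfolding hausdorff_dim_def b_def[symmetric]
    proof (rule INF_greatest, safe)
      fix t assume t: "0 \<le> t" "hausdorff_measure t (fractal \<omega>) = 0"
      have "u n \<le> t" for n
        using hausdorff_measure_0_mono[OF t(1) _ t(2), of "u n"] H by force
      moreover have "u \<longlonglongrightarrow> b * (1 - 0)"
        unfolding u_def by (intro tendsto_intros LIMSEQ_ignore_initial_segment[OF lim_1_over_n])
      ultimately have "b * (1 - 0) \<le> t" by (intro LIMSEQ_le_const2) auto
      then show "ereal b \<le> ereal t" by simp
    qed
  qed
qed

end

theorem theorem2p2:
  fixes m :: nat
    and a :: "nat \<Rightarrow> real^'d"
    and \<sigma>_lo \<sigma>_hi s :: real
    and \<theta> :: "(real^'d^'d) measure"
  assumes "1 \<le> m"
    and "\<And>i j. i \<in> {1..m} \<Longrightarrow> j \<in> {1..m} \<Longrightarrow> i \<noteq> j \<Longrightarrow> a i \<noteq> a j"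
    and "0 < \<sigma>_lo" and "\<sigma>_lo < \<sigma>_hi" and "\<sigma>_hi < 1"
    and "haar_probability \<theta>"
    and "(\<integral>\<omega>. (\<Sum>i = 1..m. fst (\<omega> [i]) powr s) \<partial>label_space m \<sigma>_lo \<sigma>_hi \<theta>) = 1"
  shows "(AE \<omega> in label_space m \<sigma>_lo \<sigma>_hi \<theta>.
            hausdorff_dim (random_fractal m a \<omega>) = ereal (min s (real CARD('d)))) \<and>
         (s > real CARD('d) \<longrightarrow>
            (AE \<omega> in label_space m \<sigma>_lo \<sigma>_hi \<theta>.
               emeasure lebesgue (random_fractal m a \<omega>) > 0))"
proof -
  interpret distinct_ifs m a \<sigma>_lo \<sigma>_hi \<theta>
    using assms(1-6) by unfold_locales auto
  have s: "real m * moment s = 1"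
    using assms(7) integral_sum_ratios[of s] by (simp add: space_lab_def)
  have "AE \<omega> in space_lab. hausdorff_dim (fractal \<omega>) = ereal (min s (real CARD('d)))"
    using AE_dim_le[OF s] AE_dim_ge[OF s]
  proof eventually_elim
    case (elim \<omega>)
    then show ?case by (rule order.antisym)
  qed
  moreover have "AE \<omega> in space_lab. 0 < emeasure lebesgue (fractal \<omega>)" if "real CARD('d) < s"
  proof -
    have "0 < s" using that by (rule order_le_less_trans[rotated]) simp
    from AE_not_negligible[OF two_le_m[OF s this] moment_gt_1[OF s that]]
    show ?thesis
    proof (rule AE_mp, intro AE_I2 impI)
      fix \<omega> assume "\<omega> \<in> space space_lab" "\<not> negligible (fractal \<omega>)"
      \<comment> \<open>Compactness supplies measurability; on a nonmeasurable set
        \<open>emeasure\<close> would be 0 by convention.\<close>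
      moreover from this have "fractal \<omega> \<in> sets lebesgue"
        by (intro fmeasurableD lmeasurable_compact compact_fractal admissible_space)
      ultimately show "0 < emeasure lebesgue (fractal \<omega>)"
        by (auto simp: negligible_iff_null_sets null_sets_def zero_less_iff_neq_zero)
    qed
  qed
  ultimately show ?thesis unfolding space_lab_def by blast
qed

end
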